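(* Consider the iterates $(x^k)_{k\ge 0}$ and $(h_m^k)_{k\ge 0}$, $m\in[M]$, generated by the algorithm DIANA-PP (defined in the context) with participation level $N\in[M]$. Suppose that, for every $k$, the operators $(\mathcal C_m^k)_{m=1}^M$ are mutually independent, and set $\omega_{\mathrm{av}}=\frac{\omega_{\mathcal C}}{M}+\frac{M-N}{N(M-1)}(1+\omega_{\mathcal C})$. Suppose that $\lambda=\frac NM\frac{1}{1+\omega_{\mathcal C}}$ and $\rho=\frac1{1+\omega_{\mathcal R}}$. Choose a real $b>1$ and set $a=\max\Big(1-(1+b)\frac{M-N}{N(M-1)},0\Big)$. Suppose that $$0<\gamma\le\frac1L\,\frac1{a+(1+b)^2\omega_{\mathrm{av}}}.$$ For every $k\ge 0$ define $$\Psi^k=\|x^k-x^\star\|^2+(b^2+b)\gamma^2\omega_{\mathrm{av}}\frac{1+\omega_{\mathcal C}}{1+\omega_{\mathcal R}}\frac1N\sum_{m=1}^M\|h_m^k-h_m^\star\|^2 .$$ Then, for every $k\ge0$, $\mathbb E[\Psi^k]\le c^k\Psi^0$, where $$c=1-\min\left\{\frac{\gamma\mu}{1+\omega_{\mathcal R}},\ \frac NM\,\frac{1-b^{-2}}{1+\omega_{\mathcal C}}\right\}.$$ Consequently, if $b$ is fixed and $\gamma=\Theta\big(\frac1L\frac1{a+(1+b)^2\omega_{\mathrm{av}}}\big)$, the number of iterations needed to achieve $\epsilon$-accuracy is $$\mathcal O\Big(\Big(\kappa\big(1+\tfrac{\omega_{\mathcal C}}{N}\big)(1+\omega_{\mathcal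 R})+\tfrac MN(1+\omega_{\mathcal C})\Big)\log(1/\epsilon)\Big);$$ that is, for every $b>1$ and $\theta\in(0,1]$ there is a constant $C$ depending only on $b$ and $\theta$ such that, whenever $\frac{\theta}{L}\frac1{a+(1+b)^2\omega_{\mathrm{av}}}\le\gamma\le\frac1L\frac1{a+(1+b)^2\omega_{\mathrm{av}}}$, for every $\epsilon\in(0,\frac12]$ one has $\mathbb E[\Psi^k]\le\epsilon\Psi^0$ for all integers $k\ge C\big(\kappa(1+\frac{\omega_{\mathcal C}}{N})(1+\omega_{\mathcal R})+\frac MN(1+\omega_{\mathcal C})\big)\log(1/\epsilon)$.
   Context: Convention: $\frac{M-N}{N(M-1)}$ is read as $0$ when $M=N=1$. Problem. Let $d\ge1$, $M\ge1$, $[M]=\{1,\dots,M\}$. Let $F_1,\dots,F_M:\mathbb R^d\to\mathbb R$ be convex, differentiable and $L$-smooth for some $L>0$ (i.e. $\nabla F_m$ is $L$-Lipschitz), let $F=\frac1M\sum_{m=1}^M F_m$ be $\mu$-strongly convex for some $\mu>0$ (i.e. $F-\frac\mu2\|\cdot\|^2$ is convex), and let $R:\mathbb R^d\to\mathbb R\cup\{+\infty\}$ be proper, closed, convex. Let $x^\star$ be the unique minimizer of $R+F$, $h_m^\star=\nabla F_m(x^\star)$, and $\kappa=L/\mu$. For $\gamma>0$, $\mathrm{prox}_{\gamma R}(w)=\arg\min_{x}\big(\gamma R(x)+\frac12\|x-w\|^2\big)$. Norms are Euclidean. Stochastic operators. For every $k\ge0$ and $m\in[M]$, $\mathcal C_m^k,\mathcal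 R^k$ are random maps $\mathbb R^d\to\mathbb R^d$ such that for all $v\in\mathbb R^d$: $\mathbb E[\mathcal C_m^k(v)]=v$, $\mathbb E\|\mathcal C_m^k(v)-v\|^2\le\omega_{\mathcal C}\|v\|^2$; $\mathbb E[\mathcal R^k(v)]=v$, $\mathbb E\|\mathcal R^k(v)-v\|^2\le\omega_{\mathcal R}\|v\|^2$, for constants $\omega_{\mathcal C},\omega_{\mathcal R}\ge0$. The random sets $\Omega^k$ used in Algorithm DIANA-PP are independent of all the $\mathcal C_m^{k'}$; the collections $\big(\Omega^k,(\mathcal C_m^k)_{m\in[M]}\big)$ for different $k$ are independent; the $\mathcal R^k$, $k\ge0$, are mutually independent and independent of all $\mathcal C_m^{k'}$ and $\Omega^{k'}$. (The random maps are assumed measurable, so that the unbiasedness of $\mathcal C_m^k,\mathcal R^k$ and their variance bounds with constants $\omega_{\mathcal C},\omega_{\mathcal R}$ also hold conditionally when the operators are applied to random vectors independent of them.) Algorithm DIANA-PP. Input: $\gamma,\lambda,\rho>0$, $N\in[M]$, deterministic $x^0\in\mathbb R^d$ and $h_1^0,\dots,h_M^0\in\mathbb R^d$; $h^0=\frac1M\sum_m h_m^0$. For $k=0,1,\dots$: pick $\Omega^k\subset[M]$ of size $N$ uniformly at random; for $m\in\Omega^k$, set $d_m^{k+1}=\frac MN\,\mathcal C_m^k(\nabla F_m(x^k)-h_m^k)$ and $h_m^{k+1}=h_m^k+\lambda d_m^{k+1}$; for $m\notin\Omega^k$, set $h_m^{k+1}=h_m^k$; then $d^{k+1}=\frac1M\sum_{m\in\Omega^k}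 d_m^{k+1}$, $h^{k+1}=h^k+\lambda d^{k+1}$, $\tilde x^{k+1}=\mathrm{prox}_{\gamma R}\big(x^k-\gamma(h^k+d^{k+1})\big)$, $x^{k+1}=x^k+\rho\,\mathcal R^k(\tilde x^{k+1}-x^k)$. *)

theory Defs
  imports "HOL-Probability.Probability"
begin

definition grad :: "('e::euclidean_space \<Rightarrow> real) \<Rightarrow> 'e \<Rightarrow> 'e" where
  "grad f x = (THE g. GDERIV f x :> g)"

definition L_smooth :: "real \<Rightarrow> ('e::euclidean_space \<Rightarrow> real) \<Rightarrow> bool" where
  "L_smooth L f \<longleftrightarrow> (\<forall>x. f differentiable (at x)) \<and> L-lipschitz_on UNIV (grad f)"

definition strongly_convex :: "real \<Rightarrow> ('e::euclidean_space \<Rightarrow> real) \<Rightarrow> bool" where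
  "strongly_convex \<mu> f \<longleftrightarrow> convex_on UNIV (\<lambda>x. f x - \<mu> / 2 * (norm x)\<^sup>2)"

definition ereal_epigraph :: "('e::euclidean_space \<Rightarrow> ereal) \<Rightarrow> ('e \<times> real) set" where
  "ereal_epigraph R = {(x, t). R x \<le> ereal t}"

definition proper_closed_convex :: "('e::euclidean_space \<Rightarrow> ereal) \<Rightarrow> bool" where
  "proper_closed_convex R \<longleftrightarrow>
     (\<forall>x. R x \<noteq> -\<infinity>) \<and> (\<exists>x. R x \<noteq> \<infinity>) \<and> closed (ereal_epigraph R) \<and> convex (ereal_epigraph R)"

definition prox :: "real \<Rightarrow> ('e::euclidean_space \<Rightarrow> ereal) \<Rightarrow> 'e \<Rightarrow> 'e" where
  "prox \<gamma> R w = arg_min (\<lambda>x. ereal \<gamma> * R x + ereal ((norm (x - w))\<^sup>2 / 2)) (\<lambda>_. True)"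

definition average :: "nat \<Rightarrow> (nat \<Rightarrow> 'v::real_vector) \<Rightarrow> 'v" where
  "average M f = (1 / real M) *\<^sub>R (\<Sum>m\<in>{1..M}. f m)"

definition minimizer ::
  "nat \<Rightarrow> (nat \<Rightarrow> 'e::euclidean_space \<Rightarrow> real) \<Rightarrow> ('e \<Rightarrow> ereal) \<Rightarrow> 'e" where
  "minimizer M F R = arg_min (\<lambda>x. R x + ereal (average M (\<lambda>m. F m x))) (\<lambda>_. True)"

text \<open>
  A random map is a function \<open>c w v\<close> of the outcome \<open>w\<close> and the argument \<open>v\<close>. The
  \<open>\<sigma>\<close>-algebra \<open>G\<close> carries its randomness, and \<open>c\<close> is jointly measurable with respect
  to \<open>G\<close> and the Borel sets. Measurability of each \<open>c _ v\<close> alone, or joint measurability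
  with respect to \<open>P\<close> only, together with independence of the evaluations, would not allow
  an independent random vector to be substituted for \<open>v\<close>: take
  \<open>c w v = (if v = w then 1 else 0)\<close> for \<open>w\<close> uniform on \<open>[0,1]\<close>.
\<close>

definition random_map ::
  "'w measure \<Rightarrow> 'w measure \<Rightarrow> ('w \<Rightarrow> 'e::euclidean_space \<Rightarrow> 'e) \<Rightarrow> bool" where
  "random_map P G c \<longleftrightarrow>
     subalgebra P G \<and> (\<lambda>(w, v). c w v) \<in> borel_measurable (G \<Otimes>\<^sub>M borel)"

definition unbiased_with_variance ::
  "'w measure \<Rightarrow> real \<Rightarrow> ('w \<Rightarrow> 'e::euclidean_space \<Rightarrow> 'e) \<Rightarrow> bool" where
  "unbiased_with_variance P \<omega> c \<longleftrightarrow>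
     (\<forall>v. integrable P (\<lambda>w. c w v) \<and> (\<integral>w. c w v \<partial>P) = v \<and>
          integrable P (\<lambda>w. (norm (c w v - v))\<^sup>2) \<and>
          (\<integral>w. (norm (c w v - v))\<^sup>2 \<partial>P) \<le> \<omega> * (norm v)\<^sup>2)"

definition subsets_of_size :: "nat \<Rightarrow> nat \<Rightarrow> nat set set" where
  "subsets_of_size M N = {S. S \<subseteq> {1..M} \<and> card S = N}"

definition uniform_random_subset ::
  "'w measure \<Rightarrow> nat \<Rightarrow> nat \<Rightarrow> ('w \<Rightarrow> nat set) \<Rightarrow> bool" where
  "uniform_random_subset P M N S \<longleftrightarrow>
     S \<in> measurable P (count_space (subsets_of_size M N)) \<and>
     distr P (count_space (subsets_of_size M N)) S = uniform_count_measure (subsets_of_size M N)"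

definition generated_by ::
  "'w measure \<Rightarrow> nat \<Rightarrow> nat \<Rightarrow> ('w \<Rightarrow> nat set) \<Rightarrow> 'w measure" where
  "generated_by P M N S = vimage_algebra (space P) S (count_space (subsets_of_size M N))"

definition joint_events :: "'w measure \<Rightarrow> 'w measure set \<Rightarrow> 'w set set" where
  "joint_events P \<G> = sigma_sets (space P) (\<Union>G\<in>\<G>. sets G)"

text \<open>
  \<open>GS k\<close>, \<open>GC k m\<close> and \<open>GQ k\<close> are the \<open>\<sigma>\<close>-algebras of the participating set, of the
  operator of client \<open>m\<close> and of the server operator at iteration \<open>k\<close>. Independence of
  the clients' operators within one iteration is not part of this definition.
\<close>

definition independent_randomness ::
  "'w measure \<Rightarrow> nat \<Rightarrow> (nat \<Rightarrow> 'w measure) \<Rightarrow> (nat \<Rightarrow> nat \<Rightarrow> 'w measure) \<Rightarrow>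
   (nat \<Rightarrow> 'w measure) \<Rightarrow> bool" where
  "independent_randomness P M GS GC GQ \<longleftrightarrow>
     prob_space.indep_set P
       (joint_events P (range GS))
       (joint_events P (\<Union>k. GC k ` {1..M})) \<and>
     prob_space.indep_sets P (\<lambda>k. joint_events P (insert (GS k) (GC k ` {1..M}))) UNIV \<and>
     prob_space.indep_sets P (\<lambda>k. sets (GQ k)) UNIV \<and>
     prob_space.indep_set P
       (joint_events P (range GQ))
       (joint_events P (\<Union>k. insert (GS k) (GC k ` {1..M})))"

text \<open>The state consists of \<open>x\<close>, the control vectors \<open>h m\<close>, and the server's copy \<open>hs\<close>.\<close>

definition diana_pp_step ::
  "nat \<Rightarrow> nat \<Rightarrow> (nat \<Rightarrow> 'e::euclidean_space \<Rightarrow> real) \<Rightarrow> ('e \<Rightarrow> ereal) \<Rightarrow>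
   real \<Rightarrow> real \<Rightarrow> real \<Rightarrow> nat set \<Rightarrow> (nat \<Rightarrow> 'e \<Rightarrow> 'e) \<Rightarrow> ('e \<Rightarrow> 'e) \<Rightarrow>
   'e \<times> (nat \<Rightarrow> 'e) \<times> 'e \<Rightarrow> 'e \<times> (nat \<Rightarrow> 'e) \<times> 'e" where
  "diana_pp_step M N F R \<gamma> lam \<rho> S C Q = (\<lambda>(x, h, hs).
     let dm = (\<lambda>m. (real M / real N) *\<^sub>R C m (grad (F m) x - h m));
         d = (1 / real M) *\<^sub>R (\<Sum>m\<in>S. dm m);
         xt = prox \<gamma> R (x - \<gamma> *\<^sub>R (hs + d))
     in (x + \<rho> *\<^sub>R Q (xt - x),
         (\<lambda>m. if m \<in> S then h m + lam *\<^sub>R dm m else h m),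
         hs + lam *\<^sub>R d))"

primrec diana_pp ::
  "nat \<Rightarrow> nat \<Rightarrow> (nat \<Rightarrow> 'e::euclidean_space \<Rightarrow> real) \<Rightarrow> ('e \<Rightarrow> ereal) \<Rightarrow>
   real \<Rightarrow> real \<Rightarrow> real \<Rightarrow> (nat \<Rightarrow> 'w \<Rightarrow> nat set) \<Rightarrow> (nat \<Rightarrow> nat \<Rightarrow> 'w \<Rightarrow> 'e \<Rightarrow> 'e) \<Rightarrow>
   (nat \<Rightarrow> 'w \<Rightarrow> 'e \<Rightarrow> 'e) \<Rightarrow> 'e \<Rightarrow> (nat \<Rightarrow> 'e) \<Rightarrow> nat \<Rightarrow> 'w \<Rightarrow> 'e \<times> (nat \<Rightarrow> 'e) \<times> 'e" where
  "diana_pp M N F R \<gamma> lam \<rho> S C Q x0 h0 0 = (\<lambda>w. (x0, h0, average M h0))"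
| "diana_pp M N F R \<gamma> lam \<rho> S C Q x0 h0 (Suc k) = (\<lambda>w.
     diana_pp_step M N F R \<gamma> lam \<rho> (S k w) (\<lambda>m. C k m w) (Q k w)
       (diana_pp M N F R \<gamma> lam \<rho> S C Q x0 h0 k w))"

text \<open>
  \<open>(M - N) / (N (M - 1))\<close>; for \<open>M = N = 1\<close> it is \<open>0 / 0 = 0\<close>, as intended.
\<close>

definition participation_ratio :: "nat \<Rightarrow> nat \<Rightarrow> real" where
  "participation_ratio M N = (real M - real N) / (real N * (real M - 1))"

text \<open>
  The constant hidden in the complexity bound. It is given explicitly, instead of being
  existentially quantified in the theorem, because the dimension and the sample space are
  type variables there: an existential inside the theorem could depend on them, whereas
  this one visibly depends on \<open>b\<close> and \<open>\<theta>\<close> only. The first summand comes from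
  \<open>a + (1 + b)\<^sup>2 \<omega>av \<le> (1 + 2 (1 + b)\<^sup>2) (1 + \<omega>C / N)\<close>, the second one is
  \<open>1 / (1 - b\<^sup>-\<^sup>2)\<close>.
\<close>

definition complexity_constant :: "real \<Rightarrow> real \<Rightarrow> real" where
  "complexity_constant b \<theta> = (1 + 2 * (1 + b)\<^sup>2) / \<theta> + b\<^sup>2 / (b\<^sup>2 - 1)"

end

theory Submission
  imports Defs
begin

text \<open>
  Conditionally on the state \<open>(x, h)\<close>, the estimate \<open>h + d\<close> of the gradient of \<open>F\<close> is unbiased, and its
  variance is at most \<open>\<omega>av\<close> times the average of \<open>\<parallel>u m\<parallel>\<^sup>2\<close> minus \<open>r\<close> times \<open>\<parallel>average u\<parallel>\<^sup>2\<close>, where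
  \<open>u m = grad (F m) x - h m\<close> and \<open>r = (M - N) / (N (M - 1))\<close>. Write \<open>u m = p m - q m\<close> with
  \<open>p m = grad (F m) x - hstar m\<close> and \<open>q m = h m - hstar m\<close>. Young's inequality with parameter \<open>b\<close> separates
  \<open>p\<close> from \<open>q\<close>, also in the negative term, because \<open>r \<le> \<omega>av\<close>. Cocoercivity of the gradients and the
  step size condition bound the \<open>p\<close> part by \<open>\<gamma> \<langle>x - xstar, average p\<rangle>\<close>, which strong convexity
  turns into a contraction of \<open>\<parallel>x - xstar\<parallel>\<^sup>2\<close>; the \<open>q\<close> part is paid for by the decrease of
  \<open>\<Sum> \<parallel>h m - hstar m\<parallel>\<^sup>2\<close>. With \<open>\<rho> = 1 / (1 + \<omega>R)\<close> and \<open>\<lambda> M / N = 1 / (1 + \<omega>C)\<close> the compression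
  noise of the two updates cancels against the convexity defect of the squared norm. The conditional
  expectations are replaced by Fubini's theorem on the product of the past and the fresh \<open>\<sigma>\<close>-algebra.
\<close>

subsection \<open>Convex analysis\<close>

text \<open>The constants come from balancing two accounts. Let \<open>A\<close> and
  \<open>B\<close> be the averages of the squared norms of \<open>p m\<close> and
  \<open>q m\<close>. In units of \<open>\<rho> * \<gamma>\<^sup>2 * \<omega>av\<close>, Young's
  inequality leaves the noise \<open>(1 + b) * A\<close> and \<open>(1 + 1 / b) * B\<close>. The
  control update refunds a multiple of \<open>B\<close> and charges the same multiple of
  \<open>A\<close>; the weight in \<open>\<Psi>\<close> makes it \<open>b\<^sup>2 + b\<close>. As
  \<open>1 + 1 / b = (b\<^sup>2 + b) / b\<^sup>2\<close>, the share \<open>1 / b\<^sup>2\<close> of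
  the refund covers the noise in \<open>B\<close>, and the rate keeps
  \<open>1 - 1 / b\<^sup>2\<close>. As \<open>(1 + b) + (b\<^sup>2 + b) = (1 + b)\<^sup>2\<close>,
  this square multiplies \<omega>av in the step size. The squared norm of \<open>average M p\<close>
  keeps the coefficient \<open>1 - (1 + b) * r\<close>, clipped at 0 to give \<open>a\<close>: it
  may be replaced by the larger \<open>A\<close> only under a nonnegative coefficient. The operators
  are controlled at deterministic arguments but act on random states. Nonnegative extended integrals
  allow Fubini before integrability is known; the bound then yields integrability.\<close>

lemma GDERIV_unique:
  fixes f :: "'e::real_inner \<Rightarrow> real"
  assumes "GDERIV f x :> g" "GDERIV f x :> g'"
  shows "g = g'"
proof -
  have "(\<lambda>h. inner h g) = (\<lambda>h. inner h g')"
    using assms unfolding gderiv_def by (rule has_derivative_unique)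
  then have "inner (g - g') g = inner (g - g') g'" by metis
  then have "inner (g - g') (g - g') = 0" by (simp add: inner_diff_right)
  then show ?thesis by simp
qed

text \<open>\<open>grad\<close> is a definite description, so it carries information only once a
  gradient exists and is unique. Existence is the Riesz representation of the derivative, written
  out in the standard basis.\<close>

lemma GDERIV_grad:
  fixes f :: "'e::euclidean_space \<Rightarrow> real"
  assumes "f differentiable (at x)"
  shows "GDERIV f x :> grad f x"
proof -
  obtain f' where f': "(f has_derivative f') (at x)"
    using assms unfolding differentiable_def by blast
  interpret f': bounded_linear f' by (rule has_derivative_bounded_linear[OF f'])
  have "f' = (\<lambda>h. inner h (\<Sum>b\<in>Basis. f' b *\<^sub>R b))"
  proof
    fix h :: 'e
    have "f' h = f' (\<Sum>b\<in>Basis. inner h b *\<^sub>R b)" by (simp add: euclidean_representation)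
    also have "\<dots> = (\<Sum>b\<in>Basis. inner h b * f' b)" by (simp add: f'.sum f'.scaleR)
    also have "\<dots> = inner h (\<Sum>b\<in>Basis. f' b *\<^sub>R b)"
      by (simp add: inner_sum_right mult.commute)
    finally show "f' h = inner h (\<Sum>b\<in>Basis. f' b *\<^sub>R b)" .
  qed
  then have "GDERIV f x :> (\<Sum>b\<in>Basis. f' b *\<^sub>R b)"
    using f' by (simp add: gderiv_def)
  then have "\<exists>!g. GDERIV f x :> g" using GDERIV_unique by blast
  then show ?thesis unfolding grad_def by (rule theI')
qed

lemma GDERIV_line:
  fixes f :: "'e::real_inner \<Rightarrow> real"
  assumes "GDERIV f (x + t *\<^sub>R d) :> g"
  shows "((\<lambda>t. f (x + t *\<^sub>R d)) has_real_derivative inner g d) (at t)"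
proof -
  have "((\<lambda>t. f (x + t *\<^sub>R d)) has_derivative (\<lambda>s. inner (s *\<^sub>R d) g)) (at t)"
  proof (rule has_derivative_compose[of "\<lambda>t. x + t *\<^sub>R d" "\<lambda>s. s *\<^sub>R d" t UNIV f "\<lambda>h. inner h g"])
    show "((\<lambda>t. x + t *\<^sub>R d) has_derivative (\<lambda>s. s *\<^sub>R d)) (at t)"
      by (auto intro!: derivative_eq_intros)
  qed (use assms in \<open>simp add: gderiv_def\<close>)
  then show ?thesis
    by (simp add: has_field_derivative_def inner_commute mult_commute_abs)
qed

text \<open>Along a segment only one-sided minimality is available, hence a sign instead of a
  vanishing derivative. The gradient inequality for convex functions and the optimality condition of
  a minimizer both reduce to it.\<close>

lemma right_minimum_deriv_nonneg:
  fixes \<phi> :: "real \<Rightarrow> real"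
  assumes "(\<phi> has_real_derivative D) (at 0)"
    and "\<And>t. 0 < t \<Longrightarrow> t < 1 \<Longrightarrow> \<phi> 0 \<le> \<phi> t"
  shows "0 \<le> D"
proof (rule ccontr)
  assume "\<not> 0 \<le> D"
  then obtain \<delta> where "\<delta> > 0" and \<delta>: "\<And>h. 0 < h \<Longrightarrow> h < \<delta> \<Longrightarrow> \<phi> (0 + h) < \<phi> 0"
    using DERIV_neg_dec_right[OF assms(1)] by auto
  define h where "h = min \<delta> 1 / 2"
  have "0 < h" "h < \<delta>" "h < 1" using \<open>\<delta> > 0\<close> by (auto simp: h_def)
  then show False using \<delta>[of h] assms(2)[of h] by simp
qed

lemma convex_on_gradient_inequality:
  fixes f :: "'e::real_inner \<Rightarrow> real"
  assumes "convex_on UNIV f" "GDERIV f x :> g"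
  shows "f x + inner g (y - x) \<le> f y"
proof -
  \<comment> \<open>Up to the constant \<open>f x\<close>, the height of the chord above the graph;
    it is nonnegative on the segment and vanishes at 0.\<close>
  let ?\<phi> = "\<lambda>t. t * (f y - f x) - f (x + t *\<^sub>R (y - x))"
  have "((\<lambda>t. f (x + t *\<^sub>R (y - x))) has_real_derivative inner g (y - x)) (at 0)"
    by (rule GDERIV_line) (use assms(2) in simp)
  then have "(?\<phi> has_real_derivative (f y - f x) - inner g (y - x)) (at 0)"
    by (auto intro!: derivative_eq_intros)
  moreover have "?\<phi> 0 \<le> ?\<phi> t" if "0 < t" "t < 1" for t
  proof -
    have "f ((1 - t) *\<^sub>R x + t *\<^sub>R y) \<le> (1 - t) * f x + t * f y"
      using convex_onD[OF assms(1), of t x y] that by simp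
    moreover have "(1 - t) *\<^sub>R x + t *\<^sub>R y = x + t *\<^sub>R (y - x)"
      by (simp add: algebra_simps)
    ultimately show ?thesis by (simp add: algebra_simps)
  qed
  ultimately have "0 \<le> (f y - f x) - inner g (y - x)"
    by (rule right_minimum_deriv_nonneg)
  then show ?thesis by simp
qed

lemma descent_lemma:
  fixes f :: "'e::euclidean_space \<Rightarrow> real"
  assumes "L_smooth L f"
  shows "f y \<le> f x + inner (grad f x) (y - x) + L / 2 * (norm (y - x))\<^sup>2"
proof -
  define d where "d = y - x"
  have G: "GDERIV f z :> grad f z" for z
    using assms by (auto simp: L_smooth_def intro: GDERIV_grad)
  have lip: "norm (grad f u - grad f v) \<le> L * norm (u - v)" for u v
    using assms lipschitz_onD[of L UNIV "grad f" u v] by (simp add: L_smooth_def dist_norm)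
  \<comment> \<open>The claim is \<open>?\<phi> 1 \<le> ?\<phi> 0\<close>; the quadratic term is
    what the Lipschitz bound needs to make the derivative nonpositive, so no gradient has to be
    integrated.\<close>
  let ?\<phi> = "\<lambda>t. f (x + t *\<^sub>R d) - t * inner (grad f x) d - L / 2 * t\<^sup>2 * (norm d)\<^sup>2"
  have D: "(?\<phi> has_real_derivative
      inner (grad f (x + t *\<^sub>R d)) d - inner (grad f x) d - L * t * (norm d)\<^sup>2) (at t)" for t
    by (rule derivative_eq_intros GDERIV_line[OF G] refl)+ simp
  have "?\<phi> 1 \<le> ?\<phi> 0"
  proof (rule DERIV_nonpos_imp_nonincreasing[of 0 1])
    fix t :: real assume t: "0 \<le> t" "t \<le> 1"
    have "inner (grad f (x + t *\<^sub>R d) - grad f x) d \<le> norm (grad f (x + t *\<^sub>R d) - grad f x) * norm d"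
      by (rule norm_cauchy_schwarz)
    also have "\<dots> \<le> L * norm (t *\<^sub>R d) * norm d"
      using lip[of "x + t *\<^sub>R d" x] by (intro mult_right_mono) auto
    also have "\<dots> = L * t * (norm d)\<^sup>2" using t by (simp add: power2_eq_square)
    finally show "\<exists>D. (?\<phi> has_real_derivative D) (at t) \<and> D \<le> 0"
      using D[of t] by (auto simp: inner_diff_left)
  qed simp
  then show ?thesis by (simp add: d_def)
qed

text \<open>\<open>half\<close> sharpens the gradient inequality by a quadratic term in the
  difference of the gradients. Adding it to its copy with the points exchanged cancels the function
  values and doubles that term.\<close>

lemma L_smooth_cocoercive:
  fixes f :: "'e::euclidean_space \<Rightarrow> real"
  assumes "convex_on UNIV f" "L_smooth L f" "L > 0"
  shows "(norm (grad f x - grad f y))\<^sup>2 \<le> L * inner (grad f x - grad f y) (x - y)"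
proof -
  have G: "GDERIV f z :> grad f z" for z
    using assms by (auto simp: L_smooth_def intro: GDERIV_grad)
  have half: "f u + inner (grad f u) (v - u) + (norm (grad f v - grad f u))\<^sup>2 / (2 * L) \<le> f v" for u v
  proof -
    define g where "g = grad f v - grad f u"
    \<comment> \<open>The point \<open>v - (1 / L) *\<^sub>R g\<close> minimizes the quadratic upper
      model at \<open>v\<close> of \<open>f\<close> minus its linearization at \<open>u\<close>,
      whose gradient at \<open>v\<close> is \<open>g\<close>. Convexity bounds \<open>f\<close>
      there from below, smoothness from above.\<close>
    have "f u + inner (grad f u) (v - (1 / L) *\<^sub>R g - u) \<le> f (v - (1 / L) *\<^sub>R g)"
      by (rule convex_on_gradient_inequality[OF assms(1) G])
    also have "\<dots> \<le> f v + inner (grad f v) (- (1 / L) *\<^sub>R g) + L / 2 * (norm ((1 / L) *\<^sub>R g))\<^sup>2"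
      using descent_lemma[OF assms(2), of "v - (1 / L) *\<^sub>R g" v] by simp
    also have "L / 2 * (norm ((1 / L) *\<^sub>R g))\<^sup>2 = (norm g)\<^sup>2 / (2 * L)"
      using assms(3) by (simp add: field_simps power2_eq_square)
    finally have "f u + inner (grad f u) (v - u) + (1 / L) * inner (grad f v - grad f u) g
        - (norm g)\<^sup>2 / (2 * L) \<le> f v"
      by (simp add: inner_diff_left inner_diff_right inner_add_right diff_divide_distrib algebra_simps)
    moreover have "(1 / L) * inner (grad f v - grad f u) g = (norm g)\<^sup>2 / L"
      by (simp add: g_def power2_norm_eq_inner)
    moreover have "(norm g)\<^sup>2 / L - (norm g)\<^sup>2 / (2 * L) = (norm g)\<^sup>2 / (2 * L)" by (simp add: field_simps)
    ultimately show ?thesis unfolding g_def by linarith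
  qed
  have "(norm (grad f x - grad f y))\<^sup>2 / (2 * L) + (norm (grad f x - grad f y))\<^sup>2 / (2 * L)
      \<le> inner (grad f x - grad f y) (x - y)"
    using half[of x y] half[of y x] by (simp add: norm_minus_commute inner_diff_left inner_diff_right)
  then show ?thesis using assms(3) by (simp add: field_simps)
qed

section \<open>Strong convexity, minimizers and the proximal map\<close>

lemma GDERIV_half_norm_sq:
  fixes x :: "'e::real_inner"
  shows "GDERIV (\<lambda>x. (norm (x - w))\<^sup>2 / 2) x :> x - w"
  unfolding gderiv_def power2_norm_eq_inner
  by (auto intro!: derivative_eq_intros simp: inner_commute)

lemma strongly_convex_gradient_inequality:
  fixes G :: "'e::euclidean_space \<Rightarrow> real"
  assumes "strongly_convex \<mu> G" "GDERIV G x :> g"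
  shows "G x + inner g (y - x) + \<mu> / 2 * (norm (y - x))\<^sup>2 \<le> G y"
proof -
  have "GDERIV (\<lambda>x. G x - \<mu> / 2 * (norm x)\<^sup>2) x :> g - \<mu> *\<^sub>R x"
    using assms(2) unfolding gderiv_def power2_norm_eq_inner
    by (auto intro!: derivative_eq_intros simp: inner_commute inner_diff_right)
  from convex_on_gradient_inequality[OF assms(1)[unfolded strongly_convex_def] this, of y]
  show ?thesis
    by (simp add: power2_norm_eq_inner inner_diff_left inner_diff_right inner_commute algebra_simps)
qed

lemma strongly_convex_gradient_monotone:
  fixes G :: "'e::euclidean_space \<Rightarrow> real"
  assumes "strongly_convex \<mu> G" "GDERIV G x :> g" "GDERIV G y :> h"
  shows "\<mu> * (norm (x - y))\<^sup>2 \<le> inner (g - h) (x - y)"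
  using strongly_convex_gradient_inequality[OF assms(1,2), of y]
    strongly_convex_gradient_inequality[OF assms(1,3), of x]
  by (simp add: norm_minus_commute inner_diff_left inner_diff_right)

text \<open>A point strictly below the graph is separated from the closed convex epigraph. The
  minorant keeps \<open>R\<close> from decreasing faster than linearly, which the quadratic growth
  of a strongly convex summand can absorb.\<close>

lemma ereal_epigraph_affine_minorant:
  fixes R :: "'e::euclidean_space \<Rightarrow> ereal"
  assumes "proper_closed_convex R"
  obtains v c where "\<And>x t. (x, t) \<in> ereal_epigraph R \<Longrightarrow> inner v x + c \<le> t"
proof -
  obtain x0 where x0: "R x0 \<noteq> \<infinity>" "R x0 \<noteq> -\<infinity>"
    using assms unfolding proper_closed_convex_def by blast
  then obtain t0 where t0: "R x0 = ereal t0" by (cases "R x0") auto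
  have "(x0, t0 - 1) \<notin> ereal_epigraph R" by (simp add: ereal_epigraph_def t0)
  then obtain a \<beta> where *: "inner a (x0, t0 - 1) < \<beta>" "\<And>p. p \<in> ereal_epigraph R \<Longrightarrow> \<beta> < inner a p"
    using separating_hyperplane_closed_point[of "ereal_epigraph R" "(x0, t0 - 1)"] assms
    unfolding proper_closed_convex_def by blast
  obtain u s where a: "a = (u, s)" by (cases a)
  \<comment> \<open>The separated point and \<open>(x0, t0)\<close> differ in height only, which
    forces the vertical component \<open>s\<close> to be positive: the hyperplane is not vertical
    and can be solved for \<open>t\<close>.\<close>
  have "(x0, t0) \<in> ereal_epigraph R" by (simp add: ereal_epigraph_def t0)
  then have "inner u x0 + s * (t0 - 1) < inner u x0 + s * t0"
    using *(1) *(2)[of "(x0, t0)"] by (simp add: a)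
  then have s: "s > 0" by (simp add: algebra_simps)
  show ?thesis
  proof
    fix x t assume "(x, t) \<in> ereal_epigraph R"
    then have "\<beta> < inner u x + s * t" using *(2) by (fastforce simp: a)
    then have "(\<beta> - inner u x) / s \<le> t" using s by (simp add: field_simps)
    then show "inner (- (1 / s) *\<^sub>R u) x + \<beta> / s \<le> t" by (simp add: diff_divide_distrib)
  qed
qed

text \<open>\<open>arg_min\<close> is informative only if a minimum is attained, so existence must
  precede any use of \<open>prox\<close> or \<open>minimizer\<close>. Minimizing the real function
  \<open>snd p + G (fst p)\<close> over the epigraph, instead of an extended-valued sum over the
  space, turns lower semicontinuity of \<open>R\<close> into closedness of a set; growth of
  \<open>G\<close> makes the sublevel set compact.\<close>

lemma proper_closed_convex_minimizer_exists:
  fixes R :: "'e::euclidean_space \<Rightarrow> ereal"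
  assumes R: "proper_closed_convex R" and G: "strongly_convex \<mu> G" and \<mu>: "\<mu> > 0"
    and diff: "\<And>x. GDERIV G x :> g x"
  shows "\<exists>x. \<forall>y. R x + ereal (G x) \<le> R y + ereal (G y)"
proof -
  define E where "E = ereal_epigraph R"
  obtain v c where vc: "\<And>x t. (x, t) \<in> E \<Longrightarrow> inner v x + c \<le> t"
    using ereal_epigraph_affine_minorant[OF R] unfolding E_def by metis
  have clE: "closed E" using R by (simp add: proper_closed_convex_def E_def)
  have fin: "R x \<noteq> -\<infinity>" for x using R by (simp add: proper_closed_convex_def)
  obtain x0 where "R x0 \<noteq> \<infinity>" using R unfolding proper_closed_convex_def by blast
  then obtain t0 where t0: "R x0 = ereal t0" using fin[of x0] by (cases "R x0") auto
  have contG: "continuous_on UNIV G"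
    using diff unfolding gderiv_def
    by (meson UNIV_I continuous_at_imp_continuous_on has_derivative_continuous)
  define \<phi> where "\<phi> = (\<lambda>p. snd p + G (fst p))"
  have cont\<phi>: "continuous_on UNIV \<phi>"
    unfolding \<phi>_def
    by (intro continuous_intros continuous_on_compose2[OF contG]) auto
  define K where "K = E \<inter> {p. \<phi> p \<le> \<phi> (x0, t0)}"
  have "closed {p. \<phi> p \<le> \<phi> (x0, t0)}"
    using cont\<phi> by (intro closed_Collect_le continuous_on_const) 
  then have clK: "closed K" using clE by (auto simp: K_def)
  define A where "A = norm (v + g 0)"
  define B where "B = \<phi> (x0, t0) - c - G 0"
  \<comment> \<open>Beyond radius \<open>2 / \<mu> * (A + \<bar>B\<bar>)\<close> the quadratic
    growth of \<open>G\<close> outweighs the affine bound. The summand 1 ensures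
    \<open>norm x > 1\<close> outside the ball, so that \<open>\<bar>B\<bar>\<close> may be
    multiplied by \<open>norm x\<close>.\<close>
  define r where "r = 1 + 2 / \<mu> * (A + \<bar>B\<bar>)"
  have "r \<ge> 1" using \<mu> by (simp add: r_def A_def)
  have bnd: "norm x \<le> r \<and> t \<le> \<phi> (x0, t0) - G 0 + norm (g 0) * r \<and> - norm v * r + c \<le> t"
    if p: "(x, t) \<in> K" for x t
  proof -
    have 1: "inner v x + c \<le> t" "t + G x \<le> \<phi> (x0, t0)"
      using p vc by (auto simp: K_def \<phi>_def)
    have 2: "G 0 + inner (g 0) x + \<mu> / 2 * (norm x)\<^sup>2 \<le> G x"
      using strongly_convex_gradient_inequality[OF G diff, of 0 x] by simp
    have "\<mu> / 2 * (norm x)\<^sup>2 \<le> B - inner (v + g 0) x"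
      using 1 2 by (simp add: B_def inner_add_left)
    also have "\<dots> \<le> \<bar>B\<bar> + A * norm x"
      using norm_cauchy_schwarz[of "- (v + g 0)" x] unfolding A_def inner_minus_left norm_minus_cancel by linarith
    finally have 3: "\<mu> / 2 * (norm x)\<^sup>2 \<le> \<bar>B\<bar> + A * norm x" .
    have nx: "norm x \<le> r"
    proof (rule ccontr)
      assume "\<not> norm x \<le> r"
      then have x: "norm x > r" "norm x > 1" using \<open>r \<ge> 1\<close> by auto
      have "\<mu> / 2 * (norm x)\<^sup>2 \<le> (\<bar>B\<bar> + A) * norm x"
        using 3 mult_left_mono[of 1 "norm x" "\<bar>B\<bar>"] x by (simp add: algebra_simps)
      then have "(\<mu> / 2 * norm x) * norm x \<le> (\<bar>B\<bar> + A) * norm x"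
        by (simp add: power2_eq_square mult.assoc)
      then have "\<mu> / 2 * norm x \<le> \<bar>B\<bar> + A"
        using x by (subst (asm) mult_le_cancel_right_pos) auto
      then have "norm x \<le> 2 / \<mu> * (A + \<bar>B\<bar>)"
        using \<mu> by (simp add: field_simps)
      then show False using x by (simp add: r_def)
    qed
    have "- inner (g 0) x \<le> norm (g 0) * norm x"
      using norm_cauchy_schwarz[of "- g 0" x] by (simp add: inner_minus_left)
    also have "\<dots> \<le> norm (g 0) * r" using nx by (intro mult_left_mono) auto
    finally have 4: "- inner (g 0) x \<le> norm (g 0) * r" .
    have "- inner v x \<le> norm v * norm x"
      using norm_cauchy_schwarz[of "- v" x] by (simp add: inner_minus_left)
    also have "\<dots> \<le> norm v * r" using nx by (intro mult_left_mono) auto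
    finally have 5: "- inner v x \<le> norm v * r" .
    have "0 \<le> \<mu> / 2 * (norm x)\<^sup>2" using \<mu> by simp
    then show ?thesis using nx 1 2 4 5 by auto
  qed
  have "K \<subseteq> cball 0 r \<times> {- norm v * r + c .. \<phi> (x0, t0) - G 0 + norm (g 0) * r}"
    using bnd by auto
  moreover have "bounded (cball (0::'e) r \<times> {- norm v * r + c .. \<phi> (x0, t0) - G 0 + norm (g 0) * r})"
    by (intro bounded_Times bounded_cball bounded_closed_interval)
  ultimately have "compact K"
    using clK bounded_subset compact_eq_bounded_closed by blast
  moreover have "(x0, t0) \<in> K" by (simp add: K_def E_def ereal_epigraph_def t0)
  ultimately obtain p where p: "p \<in> K" and min: "\<And>q. q \<in> K \<Longrightarrow> \<phi> p \<le> \<phi> q"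
    using continuous_attains_inf[of K \<phi>] continuous_on_subset[OF cont\<phi>] by blast
  have minE: "\<phi> p \<le> \<phi> q" if "q \<in> E" for q
    using min[of q] min[OF \<open>(x0, t0) \<in> K\<close>] that by (cases "\<phi> q \<le> \<phi> (x0, t0)") (auto simp: K_def)
  show ?thesis
  proof (intro exI[of _ "fst p"] allI)
    fix y
    have "R (fst p) \<le> ereal (snd p)" using p by (auto simp: K_def E_def ereal_epigraph_def)
    then have "R (fst p) + ereal (G (fst p)) \<le> ereal (\<phi> p)"
      using add_right_mono[of "R (fst p)" "ereal (snd p)" "ereal (G (fst p))"] by (simp add: \<phi>_def)
    also have "\<dots> \<le> R y + ereal (G y)"
    proof (cases "R y")
      case (real s)
      then have "(y, s) \<in> E" by (simp add: E_def ereal_epigraph_def)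
      from minE[OF this] show ?thesis by (simp add: real \<phi>_def)
    qed (use fin in auto)
    finally show "R (fst p) + ereal (G (fst p)) \<le> R y + ereal (G y)" .
  qed
qed

text \<open>Convexity of \<open>R\<close> is used along a segment and differentiability of
  \<open>G\<close> at its start; the result expresses that \<open>- g\<close> is a subgradient of
  \<open>R\<close> at \<open>x\<close>. Real values are used so that infinities are never
  subtracted.\<close>

lemma minimizer_variational_inequality:
  fixes R :: "'e::euclidean_space \<Rightarrow> ereal"
  assumes R: "proper_closed_convex R" and min: "\<And>y. R x + ereal (G x) \<le> R y + ereal (G y)"
    and G: "GDERIV G x :> g"
  shows "\<exists>t. R x = ereal t \<and> (\<forall>y s. R y = ereal s \<longrightarrow> t + inner g (x - y) \<le> s)"
proof -
  obtain x0 where "R x0 \<noteq> \<infinity>" using R unfolding proper_closed_convex_def by blast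
  then have "R x \<noteq> \<infinity>" using min[of x0] by auto
  moreover have "R x \<noteq> -\<infinity>" using R by (simp add: proper_closed_convex_def)
  ultimately obtain t where t: "R x = ereal t" by (cases "R x") auto
  have "t + inner g (x - y) \<le> s" if "R y = ereal s" for y s
  proof -
    \<comment> \<open>On the segment, \<open>t\<close> plus this function majorizes the objective by
      convexity of the epigraph, with equality at 0, where the objective is minimal.\<close>
    let ?\<phi> = "\<lambda>\<theta>. \<theta> * (s - t) + G (x + \<theta> *\<^sub>R (y - x))"
    have "((\<lambda>t. G (x + t *\<^sub>R (y - x))) has_real_derivative inner g (y - x)) (at 0)"
      by (rule GDERIV_line) (use G in simp)
    then have "(?\<phi> has_real_derivative (s - t) + inner g (y - x)) (at 0)"
      by (auto intro!: derivative_eq_intros)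
    moreover have "?\<phi> 0 \<le> ?\<phi> \<theta>" if \<theta>: "0 < \<theta>" "\<theta> < 1" for \<theta>
    proof -
      have E: "(x, t) \<in> ereal_epigraph R" "(y, s) \<in> ereal_epigraph R"
        using t \<open>R y = ereal s\<close> by (auto simp: ereal_epigraph_def)
      have "convex (ereal_epigraph R)" using R by (simp add: proper_closed_convex_def)
      then have "(1 - \<theta>) *\<^sub>R (x, t) + \<theta> *\<^sub>R (y, s) \<in> ereal_epigraph R"
        by (rule convexD_alt) (use E \<theta> in auto)
      moreover have "(1 - \<theta>) *\<^sub>R (x, t) + \<theta> *\<^sub>R (y, s) = (x + \<theta> *\<^sub>R (y - x), t + \<theta> * (s - t))"
        by (simp add: algebra_simps)
      ultimately have "R (x + \<theta> *\<^sub>R (y - x)) \<le> ereal (t + \<theta> * (s - t))"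
        by (simp add: ereal_epigraph_def)
      then have "ereal (t + G x) \<le> ereal (t + \<theta> * (s - t)) + ereal (G (x + \<theta> *\<^sub>R (y - x)))"
        using min[of "x + \<theta> *\<^sub>R (y - x)"] t
        by (metis add_right_mono dual_order.trans plus_ereal.simps(1))
      then show ?thesis by simp
    qed
    ultimately have "0 \<le> (s - t) + inner g (y - x)" by (rule right_minimum_deriv_nonneg)
    then show ?thesis by (simp add: inner_diff_right)
  qed
  then show ?thesis using t by blast
qed

lemma proper_closed_convex_cmult:
  fixes R :: "'e::euclidean_space \<Rightarrow> ereal"
  assumes R: "proper_closed_convex R" and \<gamma>: "\<gamma> > 0"
  shows "proper_closed_convex (\<lambda>x. ereal \<gamma> * R x)"
proof -
  let ?T = "\<lambda>p::'e \<times> real. (fst p, snd p / \<gamma>)"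
  have lin: "linear ?T"
    by (intro linearI) (auto simp: add_divide_distrib)
  have "ereal \<gamma> * R x \<le> ereal t \<longleftrightarrow> R x \<le> ereal (t / \<gamma>)" for x t
    using \<gamma> by (cases "R x") (auto simp: field_simps)
  then have eq: "ereal_epigraph (\<lambda>x. ereal \<gamma> * R x) = ?T -` ereal_epigraph R"
    by (auto simp: ereal_epigraph_def)
  have "closed (?T -` ereal_epigraph R)"
    using R linear_continuous_on[OF lin[unfolded linear_conv_bounded_linear], of UNIV]
    by (intro closed_vimage) (auto simp: proper_closed_convex_def)
  moreover have "convex (?T -` ereal_epigraph R)"
    using R by (intro convex_linear_vimage lin) (auto simp: proper_closed_convex_def)
  moreover have "ereal \<gamma> * R x = -\<infinity> \<longleftrightarrow> R x = -\<infinity>" "ereal \<gamma> * R x = \<infinity> \<longleftrightarrow> R x = \<infinity>" for x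
    using \<gamma> by (cases "R x"; simp)+
  ultimately show ?thesis
    using R by (simp add: proper_closed_convex_def eq)
qed

lemma arg_min_UNIV_le:
  fixes f :: "'a \<Rightarrow> 'b::linorder"
  assumes "\<exists>x. \<forall>y. f x \<le> f y"
  shows "f (arg_min f (\<lambda>_. True)) \<le> f y"
proof -
  have "\<exists>x. is_arg_min f (\<lambda>_. True) x" using assms by (simp add: is_arg_min_linorder)
  then have "is_arg_min f (\<lambda>_. True) (arg_min f (\<lambda>_. True))"
    unfolding arg_min_def by (rule someI_ex)
  then show ?thesis by (simp add: is_arg_min_linorder)
qed

lemma strongly_convex_half_norm_sq:
  fixes w :: "'e::euclidean_space"
  shows "strongly_convex 1 (\<lambda>x. (norm (x - w))\<^sup>2 / 2)"
proof -
  have "(\<lambda>x. (norm (x - w))\<^sup>2 / 2 - 1 / 2 * (norm x)\<^sup>2) = (\<lambda>x. (norm w)\<^sup>2 / 2 - inner w x)"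
    by (auto simp: power2_norm_eq_inner inner_diff_left inner_diff_right inner_commute field_simps)
  moreover have "convex_on UNIV (\<lambda>x. (norm w)\<^sup>2 / 2 - inner w x)"
  proof (rule convex_onI)
    fix t :: real and x y :: 'e
    have "(norm w)\<^sup>2 / 2 = (1 - t) * ((norm w)\<^sup>2 / 2) + t * ((norm w)\<^sup>2 / 2)"
      by (simp only: distrib_right[symmetric]) simp
    then show "(norm w)\<^sup>2 / 2 - inner w ((1 - t) *\<^sub>R x + t *\<^sub>R y)
        \<le> (1 - t) * ((norm w)\<^sup>2 / 2 - inner w x) + t * ((norm w)\<^sup>2 / 2 - inner w y)"
      by (simp add: inner_add_right right_diff_distrib)
  qed simp
  ultimately show ?thesis by (simp add: strongly_convex_def)
qed

text \<open>This is the optimality condition for the scaled function plus the quadratic, whose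
  gradient at the proximal point is \<open>prox \<gamma> R w - w\<close>. Finiteness of
  \<open>R\<close> there is recorded because it permits one proximal point to serve as the test
  point \<open>y\<close> of another.\<close>

lemma prox_variational_inequality:
  fixes R :: "'e::euclidean_space \<Rightarrow> ereal"
  assumes R: "proper_closed_convex R" and \<gamma>: "\<gamma> > 0"
  shows "\<exists>t. R (prox \<gamma> R w) = ereal t \<and>
    (\<forall>y s. R y = ereal s \<longrightarrow> \<gamma> * t + inner (prox \<gamma> R w - w) (prox \<gamma> R w - y) \<le> \<gamma> * s)"
proof -
  let ?R = "\<lambda>x. ereal \<gamma> * R x" and ?G = "\<lambda>x. (norm (x - w))\<^sup>2 / 2"
  note R' = proper_closed_convex_cmult[OF R \<gamma>]
  have "?R (prox \<gamma> R w) + ereal (?G (prox \<gamma> R w)) \<le> ?R y + ereal (?G y)" for y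
    unfolding prox_def
    by (rule arg_min_UNIV_le,
        rule proper_closed_convex_minimizer_exists[OF R' strongly_convex_half_norm_sq _ GDERIV_half_norm_sq]) simp
  from minimizer_variational_inequality[OF R' this GDERIV_half_norm_sq]
  obtain t where t: "ereal \<gamma> * R (prox \<gamma> R w) = ereal t"
    and *: "\<And>y s. ereal \<gamma> * R y = ereal s \<Longrightarrow> t + inner (prox \<gamma> R w - w) (prox \<gamma> R w - y) \<le> s"
    by blast
  obtain t' where t': "R (prox \<gamma> R w) = ereal t'" "t = \<gamma> * t'"
    using t \<gamma> by (cases "R (prox \<gamma> R w)") auto
  show ?thesis
    using t' *[of _ "\<gamma> * _"] by auto
qed

text \<open>Each optimality condition is tested with the other proximal point, and the values of
  \<open>R\<close> cancel in the sum. The estimate yields the continuity, and so the measurability,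
  of the proximal map.\<close>

lemma prox_nonexpansive:
  fixes R :: "'e::euclidean_space \<Rightarrow> ereal"
  assumes R: "proper_closed_convex R" and \<gamma>: "\<gamma> > 0"
  shows "norm (prox \<gamma> R u - prox \<gamma> R v) \<le> norm (u - v)"
proof -
  let ?p = "prox \<gamma> R u" and ?q = "prox \<gamma> R v"
  obtain s t where "R ?p = ereal s" "R ?q = ereal t"
    and "\<gamma> * s + inner (?p - u) (?p - ?q) \<le> \<gamma> * t" "\<gamma> * t + inner (?q - v) (?q - ?p) \<le> \<gamma> * s"
    using prox_variational_inequality[OF R \<gamma>, of u] prox_variational_inequality[OF R \<gamma>, of v] by metis
  then have "(norm (?p - ?q))\<^sup>2 \<le> inner (u - v) (?p - ?q)"
    by (simp add: power2_norm_eq_inner inner_diff_left inner_diff_right inner_commute)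
  also have "\<dots> \<le> norm (u - v) * norm (?p - ?q)" by (rule norm_cauchy_schwarz)
  finally show ?thesis
    by (cases "?p = ?q") (auto simp: power2_eq_square)
qed

text \<open>This is nonexpansiveness of the proximal map, with \<open>xs = prox \<gamma> R (xs - \<gamma> g)\<close>
  replaced by the optimality of \<open>xs\<close>.\<close>
lemma norm_prox_diff_minimizer_le:
  fixes R :: "'e::euclidean_space \<Rightarrow> ereal"
  assumes R: "proper_closed_convex R" and \<gamma>: "\<gamma> > 0"
    and min: "\<And>y. R xs + ereal (G xs) \<le> R y + ereal (G y)" and G: "GDERIV G xs :> g"
  shows "norm (prox \<gamma> R w - xs) \<le> norm (w - (xs - \<gamma> *\<^sub>R g))"
proof -
  let ?p = "prox \<gamma> R w"
  obtain s t where st: "R ?p = ereal s" "R xs = ereal t"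
    and 1: "\<gamma> * s + inner (?p - w) (?p - xs) \<le> \<gamma> * t" and 2: "t + inner g (xs - ?p) \<le> s"
    using prox_variational_inequality[OF R \<gamma>, of w] minimizer_variational_inequality[OF R min G] by metis
  have "\<gamma> * t + \<gamma> * inner g (xs - ?p) \<le> \<gamma> * s"
    using mult_left_mono[OF 2, of \<gamma>] \<gamma> by (simp add: algebra_simps)
  with 1 have "(norm (?p - xs))\<^sup>2 \<le> inner (w - (xs - \<gamma> *\<^sub>R g)) (?p - xs)"
    by (simp add: power2_norm_eq_inner inner_diff_left inner_diff_right inner_commute inner_add_left algebra_simps)
  also have "\<dots> \<le> norm (w - (xs - \<gamma> *\<^sub>R g)) * norm (?p - xs)" by (rule norm_cauchy_schwarz)
  finally show ?thesis
    by (cases "?p = xs") (auto simp: power2_eq_square)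
qed

lemma borel_measurable_prox:
  fixes R :: "'e::euclidean_space \<Rightarrow> ereal"
  assumes "proper_closed_convex R" "\<gamma> > 0"
  shows "prox \<gamma> R \<in> borel_measurable borel"
proof -
  have "1-lipschitz_on UNIV (prox \<gamma> R)"
    using prox_nonexpansive[OF assms] by (auto simp: lipschitz_on_def dist_norm)
  then show ?thesis
    by (intro borel_measurable_continuous_onI lipschitz_on_continuous_on)
qed

lemma borel_measurable_grad:
  assumes "L_smooth L f"
  shows "grad f \<in> borel_measurable borel"
  using assms unfolding L_smooth_def
  by (intro borel_measurable_continuous_onI lipschitz_on_continuous_on) auto

lemma GDERIV_average:
  fixes F :: "nat \<Rightarrow> 'e::euclidean_space \<Rightarrow> real"
  assumes "\<And>m. m \<in> {1..M} \<Longrightarrow> GDERIV (F m) x :> g m"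
  shows "GDERIV (\<lambda>x. average M (\<lambda>m. F m x)) x :> average M g"
proof -
  have "((\<lambda>x. 1 / real M * (\<Sum>m\<in>{1..M}. F m x)) has_derivative
      (\<lambda>h. 1 / real M * (\<Sum>m\<in>{1..M}. inner h (g m)))) (at x)"
    using assms unfolding gderiv_def by (intro has_derivative_mult_right has_derivative_sum)
  then show ?thesis
    unfolding average_def gderiv_def by (simp add: inner_sum_right)
qed

subsection \<open>Independent sub-algebras and uniform random subsets\<close>

lemma (in prob_space) indep_set_mono:
  assumes "indep_set A B" "A' \<subseteq> A" "B' \<subseteq> B"
  shows "indep_set A' B'"
  using assms unfolding indep_sets2_eq by blast

lemma (in prob_space) indep_subalgebras_indep_var:
  assumes A: "subalgebra M A" and B: "subalgebra M B" and indep: "indep_set (sets A) (sets B)"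
  shows "indep_var A (\<lambda>x. x) B (\<lambda>x. x)"
proof -
  have eq: "sigma_sets (space M) {(\<lambda>x. x) -` a \<inter> space M |a. a \<in> sets G} = sets G" if "subalgebra M G" for G
  proof -
    have "(\<lambda>x. x) -` a \<inter> space M = a" if "a \<in> sets G" for a
      using sets.sets_into_space[OF that] \<open>subalgebra M G\<close> unfolding subalgebra_def by auto
    then have "{(\<lambda>x. x) -` a \<inter> space M |a. a \<in> sets G} = {a |a. a \<in> sets G}"
      by (intro Collect_cong) metis
    then show ?thesis using that sets.sigma_sets_eq[of G] by (simp add: subalgebra_def)
  qed
  show ?thesis
    unfolding indep_var_eq eq[OF A] eq[OF B]
    using indep A B by (simp add: measurable_from_subalg measurable_ident_sets)
qed

text \<open>Independence lets one copy of the outcome be frozen while the other is integrated out.\<close>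
lemma (in prob_space) nn_integral_indep_subalgebras:
  assumes A: "subalgebra M A" and B: "subalgebra M B" and indep: "indep_set (sets A) (sets B)"
    and f: "f \<in> borel_measurable (A \<Otimes>\<^sub>M B)"
  shows "(\<integral>\<^sup>+w. f (w, w) \<partial>M) = (\<integral>\<^sup>+w. \<integral>\<^sup>+w'. f (w, w') \<partial>M \<partial>M)"
proof -
  have iv: "indep_var A (\<lambda>x. x) B (\<lambda>x. x)"
    by (rule indep_subalgebras_indep_var[OF A B indep])
  have mA: "(\<lambda>x. x) \<in> M \<rightarrow>\<^sub>M A" and mB: "(\<lambda>x. x) \<in> M \<rightarrow>\<^sub>M B"
    using iv by (auto simp: indep_var_eq)
  interpret PB: prob_space "distr M B (\<lambda>x. x)" by (rule prob_space_distr[OF mB])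
  have f': "f \<in> borel_measurable (distr M A (\<lambda>x. x) \<Otimes>\<^sub>M distr M B (\<lambda>x. x))"
    using f by (simp cong: measurable_cong_sets)
  have "(\<integral>\<^sup>+w. f (w, w) \<partial>M) = (\<integral>\<^sup>+p. f p \<partial>distr M (A \<Otimes>\<^sub>M B) (\<lambda>x. (x, x)))"
    using f by (subst nn_integral_distr) (auto intro!: measurable_Pair mA mB)
  also have "\<dots> = (\<integral>\<^sup>+p. f p \<partial>(distr M A (\<lambda>x. x) \<Otimes>\<^sub>M distr M B (\<lambda>x. x)))"
    using iv by (simp add: indep_var_distribution_eq)
  also have "\<dots> = (\<integral>\<^sup>+w. \<integral>\<^sup>+w'. f (w, w') \<partial>distr M B (\<lambda>x. x) \<partial>distr M A (\<lambda>x. x))"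
    using PB.nn_integral_fst[OF f'] by simp
  also have "\<dots> = (\<integral>\<^sup>+w. \<integral>\<^sup>+w'. f (w, w') \<partial>distr M B (\<lambda>x. x) \<partial>M)"
    using PB.borel_measurable_nn_integral_fst[OF f'] by (subst nn_integral_distr[OF mA]) auto
  also have "\<dots> = (\<integral>\<^sup>+w. \<integral>\<^sup>+w'. f (w, w') \<partial>M \<partial>M)"
  proof (rule nn_integral_cong)
    fix w assume "w \<in> space M"
    then have "w \<in> space A" using A by (simp add: subalgebra_def)
    then have "(\<lambda>w'. f (w, w')) \<in> borel_measurable B" using f by simp
    then show "(\<integral>\<^sup>+w'. f (w, w') \<partial>distr M B (\<lambda>x. x)) = (\<integral>\<^sup>+w'. f (w, w') \<partial>M)"
      by (subst nn_integral_distr[OF mB]) auto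
  qed
  finally show ?thesis .
qed

text \<open>Coordinatewise, independence makes the product of two merely integrable variables
  integrable, without second moments. With \<open>'e = real\<close> the same facts serve for the
  participation indicators.\<close>

lemma (in prob_space) inner_indep_subalgebras:
  fixes X Y :: "'a \<Rightarrow> 'e::euclidean_space"
  assumes A: "subalgebra M A" and B: "subalgebra M B" and indep: "indep_set (sets A) (sets B)"
    and X: "X \<in> borel_measurable A" "integrable M X" and Y: "Y \<in> borel_measurable B" "integrable M Y"
  shows "integrable M (\<lambda>w. inner (X w) (Y w))"
    and "(\<integral>w. inner (X w) (Y w) \<partial>M) = inner (\<integral>w. X w \<partial>M) (\<integral>w. Y w \<partial>M)"
proof -
  have iv: "indep_var borel (\<lambda>w. inner (X w) b) borel (\<lambda>w. inner (Y w) b)" for b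
    using indep_var_compose[OF indep_subalgebras_indep_var[OF A B indep],
        of "\<lambda>w. inner (X w) b" borel "\<lambda>w. inner (Y w) b" borel] X Y
    by (simp add: o_def)
  have eq: "inner (X w) (Y w) = (\<Sum>b\<in>Basis. inner (X w) b * inner (Y w) b)" for w
    by (rule euclidean_inner)
  have int: "integrable M (\<lambda>w. inner (X w) b * inner (Y w) b)" for b
    by (rule indep_var_integrable[OF iv]) (use X Y in auto)
  then show "integrable M (\<lambda>w. inner (X w) (Y w))"
    unfolding eq by (intro Bochner_Integration.integrable_sum)
  have "(\<integral>w. inner (X w) (Y w) \<partial>M) = (\<Sum>b\<in>Basis. \<integral>w. inner (X w) b * inner (Y w) b \<partial>M)"
    unfolding eq by (intro Bochner_Integration.integral_sum int)
  also have "\<dots> = (\<Sum>b\<in>Basis. inner (\<integral>w. X w \<partial>M) b * inner (\<integral>w. Y w \<partial>M) b)"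
    using X Y by (intro sum.cong refl) (subst indep_var_lebesgue_integral[OF iv], auto)
  also have "\<dots> = inner (\<integral>w. X w \<partial>M) (\<integral>w. Y w \<partial>M)"
    by (rule euclidean_inner[symmetric])
  finally show "(\<integral>w. inner (X w) (Y w) \<partial>M) = inner (\<integral>w. X w \<partial>M) (\<integral>w. Y w \<partial>M)" .
qed

section \<open>Sigma-algebras generated by several sub-algebras\<close>

definition joint_algebra :: "'w measure \<Rightarrow> 'w measure set \<Rightarrow> 'w measure" where
  "joint_algebra P \<G> = sigma (space P) (\<Union>G\<in>\<G>. sets G)"

lemma space_joint_algebra [simp]: "space (joint_algebra P \<G>) = space P"
  by (simp add: joint_algebra_def space_measure_of_conv)

lemma subalgebras_Pow:
  assumes "\<And>G. G \<in> \<G> \<Longrightarrow> subalgebra P G"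
  shows "(\<Union>G\<in>\<G>. sets G) \<subseteq> Pow (space P)"
proof -
  have "a \<subseteq> space P" if "G \<in> \<G>" "a \<in> sets G" for G a
    using assms[OF that(1)] sets.sets_into_space[OF that(2)] by (simp add: subalgebra_def)
  then show ?thesis by blast
qed

lemma sets_joint_algebra:
  assumes "\<And>G. G \<in> \<G> \<Longrightarrow> subalgebra P G"
  shows "sets (joint_algebra P \<G>) = joint_events P \<G>"
  using subalgebras_Pow[OF assms]
  by (simp add: joint_algebra_def joint_events_def)

lemma joint_events_least:
  assumes "\<And>G. G \<in> \<G> \<Longrightarrow> sets G \<subseteq> sets B" "space B = space P"
  shows "joint_events P \<G> \<subseteq> sets B"
  unfolding joint_events_def assms(2)[symmetric]
  by (rule sets.sigma_sets_subset) (use assms in auto)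

lemma joint_events_mono: "\<G> \<subseteq> \<H> \<Longrightarrow> joint_events P \<G> \<subseteq> joint_events P \<H>"
  unfolding joint_events_def by (intro sigma_sets_mono') auto

lemma sets_subset_joint_events: "G \<in> \<G> \<Longrightarrow> sets G \<subseteq> joint_events P \<G>"
  unfolding joint_events_def by (auto intro: sigma_sets.Basic)

lemma subalgebra_joint_algebra:
  assumes "\<And>G. G \<in> \<G> \<Longrightarrow> subalgebra P G"
  shows "subalgebra P (joint_algebra P \<G>)"
proof -
  have "joint_events P \<G> \<subseteq> sets P"
    by (rule joint_events_least[OF _ refl]) (use assms in \<open>simp add: subalgebra_def\<close>)
  moreover have "sets (joint_algebra P \<G>) = joint_events P \<G>" by (rule sets_joint_algebra) (rule assms)
  ultimately show ?thesis by (simp add: subalgebra_def)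
qed

lemma subalgebra_of_joint_algebra:
  assumes "\<And>G. G \<in> \<G> \<Longrightarrow> subalgebra P G" "G \<in> \<G>"
  shows "subalgebra (joint_algebra P \<G>) G"
proof -
  have "sets (joint_algebra P \<G>) = joint_events P \<G>" by (rule sets_joint_algebra) (rule assms(1))
  then show ?thesis
    using sets_subset_joint_events[OF assms(2), of P] assms(1)[OF assms(2)] by (simp add: subalgebra_def)
qed

lemma subalgebra_joint_algebra_mono:
  assumes "\<And>G. G \<in> \<H> \<Longrightarrow> subalgebra P G" "\<G> \<subseteq> \<H>"
  shows "subalgebra (joint_algebra P \<H>) (joint_algebra P \<G>)"
proof -
  have sub: "\<And>G. G \<in> \<G> \<Longrightarrow> subalgebra P G" using assms by blast
  have "sets (joint_algebra P \<G>) = joint_events P \<G>" by (rule sets_joint_algebra) (rule sub)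
  moreover have "sets (joint_algebra P \<H>) = joint_events P \<H>" by (rule sets_joint_algebra) (rule assms(1))
  ultimately have "sets (joint_algebra P \<G>) \<subseteq> sets (joint_algebra P \<H>)"
    using joint_events_mono[OF assms(2), of P] by simp
  then show ?thesis by (simp add: subalgebra_def)
qed

text \<open>Independence comes in two layers: \<open>U\<close> against \<open>V\<close>, and then
  \<open>A1\<close> against \<open>A2\<close> inside \<open>U\<close> and \<open>B1\<close> against
  \<open>B2\<close> inside \<open>V\<close>. The probability of an intersection is split across the
  layers, then within each layer, and regrouped across them. The sets \<open>a \<inter> b\<close>
  form a stable family whose generated algebra contains the joint one.\<close>

lemma (in prob_space) indep_set_joint_pairs:
  assumes sub: "subalgebra M A1" "subalgebra M A2" "subalgebra M B1" "subalgebra M B2"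
    and UV: "indep_set (sets U) (sets V)"
    and AU: "sets A1 \<subseteq> sets U" "sets A2 \<subseteq> sets U" and BV: "sets B1 \<subseteq> sets V" "sets B2 \<subseteq> sets V"
    and A: "indep_set (sets A1) (sets A2)" and B: "indep_set (sets B1) (sets B2)"
  shows "indep_set (joint_events M {A1, B1}) (joint_events M {A2, B2})"
proof -
  define I where "I A B = {a \<inter> b |a b. a \<in> sets A \<and> b \<in> sets B}" for A B :: "'a measure"
  have Imem: "a \<inter> b \<in> I A B" if "a \<in> sets A" "b \<in> sets B" for a b A B
    using that unfolding I_def by blast
  have stable: "Int_stable (I A B)" for A B
  proof (rule Int_stableI)
    fix x y assume "x \<in> I A B" "y \<in> I A B"
    then obtain a b a' b' where xy: "x = a \<inter> b" "y = a' \<inter> b'"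
      and m: "a \<in> sets A" "b \<in> sets B" "a' \<in> sets A" "b' \<in> sets B"
      by (auto simp: I_def)
    have "(a \<inter> b) \<inter> (a' \<inter> b') = (a \<inter> a') \<inter> (b \<inter> b')" by blast
    then show "x \<inter> y \<in> I A B" unfolding xy by (auto intro!: Imem m)
  qed
  have joint: "joint_events M {A, B} \<subseteq> sigma_sets (space M) (I A B)"
    if "subalgebra M A" "subalgebra M B" for A B
  proof -
    have sp: "space A = space M" "space B = space M" using that by (simp_all add: subalgebra_def)
    have "x \<in> I A B" if x: "x \<in> sets A" for x
      using Imem[OF x sets.top[of B]] sets.sets_into_space[OF x] by (simp add: sp Int_absorb2)
    moreover have "x \<in> I A B" if x: "x \<in> sets B" for x
      using Imem[OF sets.top[of A] x] sets.sets_into_space[OF x] by (simp add: sp Int_absorb1)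
    ultimately have "sets A \<union> sets B \<subseteq> I A B" by blast
    then show ?thesis unfolding joint_events_def by (intro sigma_sets_mono') auto
  qed
  have ev: "I A B \<subseteq> events" if "subalgebra M A" "subalgebra M B" for A B
    using that by (auto simp: I_def subalgebra_def)
  have "indep_set (I A1 B1) (I A2 B2)"
    unfolding indep_sets2_eq
  proof (intro conjI ballI ev sub)
    fix x y assume "x \<in> I A1 B1" "y \<in> I A2 B2"
    then obtain a1 b1 a2 b2 where xy: "x = a1 \<inter> b1" "y = a2 \<inter> b2"
      and m: "a1 \<in> sets A1" "b1 \<in> sets B1" "a2 \<in> sets A2" "b2 \<in> sets B2"
      by (auto simp: I_def)
    have U: "a1 \<in> sets U" "a2 \<in> sets U" "b1 \<in> sets V" "b2 \<in> sets V" using m AU BV by auto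
    have "x \<inter> y = (a1 \<inter> a2) \<inter> (b1 \<inter> b2)" unfolding xy by blast
    then have "prob (x \<inter> y) = prob ((a1 \<inter> a2) \<inter> (b1 \<inter> b2))" by (rule arg_cong)
    also have "\<dots> = (prob a1 * prob a2) * (prob b1 * prob b2)"
      using indep_setD[OF UV, of "a1 \<inter> a2" "b1 \<inter> b2"] indep_setD[OF A, of a1 a2] indep_setD[OF B, of b1 b2] U m
      by simp
    also have "\<dots> = (prob a1 * prob b1) * (prob a2 * prob b2)" by simp
    also have "\<dots> = prob x * prob y"
      using indep_setD[OF UV, of a1 b1] indep_setD[OF UV, of a2 b2] U unfolding xy by simp
    finally show "prob (x \<inter> y) = prob x * prob y" .
  qed
  then have "indep_set (sigma_sets (space M) (I A1 B1)) (sigma_sets (space M) (I A2 B2))"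
    by (rule indep_set_sigma_sets[OF _ stable stable])
  then show ?thesis
    by (rule indep_set_mono[OF _ joint[OF sub(1,3)] joint[OF sub(2,4)]])
qed

lemma (in prob_space) indep_sets_initial_segment:
  assumes indep: "indep_sets (\<lambda>j. sets (E j)) UNIV"
  shows "indep_set (joint_events M (E ` {..<k::nat})) (sets (E k))"
proof -
  \<comment> \<open>A Boolean index encodes the two disjoint blocks, \<open>True\<close> for the
    indices below \<open>k\<close> and \<open>False\<close> for \<open>k\<close> itself.\<close>
  have "indep_sets (\<lambda>b. sigma_sets (space M) (\<Union>i\<in>(case b of True \<Rightarrow> {..<k} | False \<Rightarrow> {k}). sets (E i))) UNIV"
  proof (rule indep_sets_collect_sigma)
    show "indep_sets (\<lambda>j. sets (E j)) (\<Union>b\<in>UNIV. case b of True \<Rightarrow> {..<k} | False \<Rightarrow> {k})"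
      by (rule indep_sets_mono_index[OF _ indep]) auto
    show "disjoint_family_on (\<lambda>b. case b of True \<Rightarrow> {..<k} | False \<Rightarrow> {k}) UNIV"
      by (auto simp: disjoint_family_on_def split: bool.splits)
  qed (rule sets.Int_stable)
  then have "indep_set (sigma_sets (space M) (\<Union>i<k. sets (E i))) (sigma_sets (space M) (sets (E k)))"
    unfolding indep_set_def by (rule indep_sets_mono_sets) (auto split: bool.splits)
  then show ?thesis
    by (rule indep_set_mono) (auto simp: joint_events_def)
qed

section \<open>The participating set: measurability and inclusion probabilities\<close>

lemma generated_by_subalgebra:
  assumes "S \<in> measurable P (count_space (subsets_of_size M N))"
  shows "subalgebra P (generated_by P M N S)"
    and "S \<in> measurable (generated_by P M N S) (count_space (subsets_of_size M N))"
proof -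
  have "S \<in> space P \<rightarrow> space (count_space (subsets_of_size M N))"
    using measurable_space[OF assms] by auto
  then show "S \<in> measurable (generated_by P M N S) (count_space (subsets_of_size M N))"
    unfolding generated_by_def by (rule measurable_vimage_algebra1)
  have "sets (generated_by P M N S) \<subseteq> sets P"
    unfolding generated_by_def by (rule sets_image_in_sets[OF refl assms])
  then show "subalgebra P (generated_by P M N S)"
    by (simp add: subalgebra_def generated_by_def)
qed

lemma finite_subsets_of_size: "finite (subsets_of_size M N)"
  by (simp add: subsets_of_size_def)

lemma card_subsets_of_size: "card (subsets_of_size M N) = M choose N"
  using n_subsets[of "{1..M}" N] by (simp add: subsets_of_size_def)

lemma card_subsets_of_size_containing:
  assumes "K \<subseteq> {1..M}" "card K \<le> N"
  shows "card {T \<in> subsets_of_size M N. K \<subseteq> T} = (M - card K) choose (N - card K)"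
proof -
  have fin: "finite K" using assms(1) finite_subset by blast
  have "bij_betw (\<lambda>T. T - K) {T \<in> subsets_of_size M N. K \<subseteq> T}
      {B. B \<subseteq> {1..M} - K \<and> card B = N - card K}"
  proof (rule bij_betw_byWitness[where f' = "\<lambda>B. B \<union> K"])
    show "(\<lambda>T. T - K) ` {T \<in> subsets_of_size M N. K \<subseteq> T} \<subseteq> {B. B \<subseteq> {1..M} - K \<and> card B = N - card K}"
      using fin by (auto simp: subsets_of_size_def card_Diff_subset)
    show "(\<lambda>B. B \<union> K) ` {B. B \<subseteq> {1..M} - K \<and> card B = N - card K} \<subseteq> {T \<in> subsets_of_size M N. K \<subseteq> T}"
    proof safe
      fix B assume B: "B \<subseteq> {1..M} - K" "card B = N - card K"
      have "finite B" using B(1) finite_subset by blast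
      then have "card (B \<union> K) = card B + card K" using B fin by (intro card_Un_disjoint) auto
      then show "B \<union> K \<in> subsets_of_size M N"
        using B assms by (auto simp: subsets_of_size_def)
    qed
  qed auto
  then have "card {T \<in> subsets_of_size M N. K \<subseteq> T} = card {B. B \<subseteq> {1..M} - K \<and> card B = N - card K}"
    by (rule bij_betw_same_card)
  also have "\<dots> = card ({1..M} - K) choose (N - card K)" by (rule n_subsets) simp
  also have "card ({1..M} - K) = M - card K" using assms fin by (simp add: card_Diff_subset)
  finally show ?thesis .
qed

lemma uniform_random_subset_prob:
  assumes "uniform_random_subset P M N S" "K \<subseteq> {1..M}" "card K \<le> N"
  shows "measure P {w \<in> space P. K \<subseteq> S w} = ((M - card K) choose (N - card K)) / (M choose N)"
proof -
  let ?A = "subsets_of_size M N"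
  have S: "S \<in> measurable P (count_space ?A)"
    and d: "distr P (count_space ?A) S = uniform_count_measure ?A"
    using assms(1) by (auto simp: uniform_random_subset_def)
  have "measure P {w \<in> space P. K \<subseteq> S w} = measure (distr P (count_space ?A) S) {T \<in> ?A. K \<subseteq> T}"
    using measurable_space[OF S] by (subst measure_distr[OF S]) (auto intro!: arg_cong[where f = "measure P"])
  also have "\<dots> = card {T \<in> ?A. K \<subseteq> T} / card ?A"
    unfolding d by (rule measure_uniform_count_measure[OF finite_subsets_of_size]) auto
  finally show ?thesis
    by (simp add: card_subsets_of_size card_subsets_of_size_containing[OF assms(2,3)])
qed

lemma uniform_random_subset_single:
  assumes "uniform_random_subset P M N S" "m \<in> {1..M}" "1 \<le> N" "N \<le> M"
  shows "measure P {w \<in> space P. m \<in> S w} = N / M"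
proof -
  have "measure P {w \<in> space P. m \<in> S w} = ((M - 1) choose (N - 1)) / (M choose N)"
    using uniform_random_subset_prob[OF assms(1), of "{m}"] assms(2,3) by simp
  moreover have "real N * (M choose N) = real M * ((M - 1) choose (N - 1))"
    using arg_cong[OF times_binomial_minus1_eq[of N M], of real] assms(3) by simp
  moreover have "real (M choose N) > 0" "real M > 0" using assms by auto
  ultimately show ?thesis by (simp add: frac_eq_eq mult.commute)
qed

lemma uniform_random_subset_pair:
  assumes "uniform_random_subset P M N S" "m \<in> {1..M}" "n \<in> {1..M}" "m \<noteq> n" "1 \<le> N" "N \<le> M"
  shows "measure P {w \<in> space P. m \<in> S w \<and> n \<in> S w} = N * (real N - 1) / (M * (real M - 1))"
\<comment> \<open>For \<open>N = 1\<close> a pair is never contained, and the counting formula would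
  fail: the truncated \<open>N - 2\<close> is 0, so the binomial coefficient would be 1 instead of
  0. Otherwise the absorption identity of binomial coefficients is used twice.\<close>
proof (cases "N = 1")
  case True
  have "{w \<in> space P. m \<in> S w \<and> n \<in> S w} = {}"
  proof -
    have "\<not> (m \<in> S w \<and> n \<in> S w)" if "w \<in> space P" for w
    proof -
      have "S w \<in> subsets_of_size M N"
        using assms(1) that measurable_space[of S P "count_space (subsets_of_size M N)"]
        by (auto simp: uniform_random_subset_def)
      then have "card (S w) = 1" using True by (simp add: subsets_of_size_def)
      then show ?thesis using assms(4) by (metis card_1_singletonE singletonD)
    qed
    then show ?thesis by auto
  qed
  then show ?thesis using True by (simp only:) simp
next
  case False
  then have N: "2 \<le> N" using assms by simp
  have "measure P {w \<in> space P. m \<in> S w \<and> n \<in> S w} = ((M - 2) choose (N - 2)) / (M choose N)"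
    using uniform_random_subset_prob[OF assms(1), of "{m, n}"] assms(2-4) N by (simp add: numeral_2_eq_2)
  moreover have "N * (real N - 1) * (M choose N) = M * (real M - 1) * ((M - 2) choose (N - 2))"
  proof -
    have 1: "real N * (M choose N) = real M * ((M - 1) choose (N - 1))"
      using arg_cong[OF times_binomial_minus1_eq[of N M], of real] assms(5) by simp
    have "real (N - 1) * ((M - 1) choose (N - 1)) = real (M - 1) * ((M - 2) choose (N - 2))"
      using arg_cong[OF times_binomial_minus1_eq[of "N - 1" "M - 1"], of real] N
      by (simp add: numeral_2_eq_2)
    moreover have "real (N - 1) = real N - 1" "real (M - 1) = real M - 1" using assms by auto
    ultimately have 2: "(real N - 1) * ((M - 1) choose (N - 1)) = (real M - 1) * ((M - 2) choose (N - 2))"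
      by simp
    have "N * (real N - 1) * (M choose N) = (real N - 1) * (N * (M choose N))" by simp
    also have "\<dots> = (real N - 1) * (M * ((M - 1) choose (N - 1)))" using 1 by simp
    also have "\<dots> = M * ((real N - 1) * ((M - 1) choose (N - 1)))" by simp
    finally show ?thesis unfolding 2 by simp
  qed
  moreover have ne: "real (M choose N) \<noteq> 0" "real M * (real M - 1) \<noteq> 0" using N assms by auto
  ultimately show ?thesis by (simp only: frac_eq_eq[OF ne] mult_ac)
qed

subsection \<open>One round with a fixed state\<close>

lemma norm_add_scaleR_sq:
  fixes p v :: "'e::real_inner"
  shows "(norm (p + r *\<^sub>R v))\<^sup>2 = (norm p)\<^sup>2 + 2 * r * inner p v + r\<^sup>2 * (norm v)\<^sup>2"
  unfolding power2_norm_eq_inner power2_eq_square[of r]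
  by (simp add: inner_add_left inner_add_right inner_commute algebra_simps)

lemma (in prob_space) unbiased_second_moment:
  fixes c :: "'a \<Rightarrow> 'e::euclidean_space \<Rightarrow> 'e"
  assumes "unbiased_with_variance M \<omega> c"
  shows "integrable M (\<lambda>w. (norm (c w v))\<^sup>2)" "(\<integral>w. (norm (c w v))\<^sup>2 \<partial>M) \<le> (1 + \<omega>) * (norm v)\<^sup>2"
proof -
  have c: "integrable M (\<lambda>w. c w v)" "(\<integral>w. c w v \<partial>M) = v" "integrable M (\<lambda>w. (norm (c w v - v))\<^sup>2)"
    "(\<integral>w. (norm (c w v - v))\<^sup>2 \<partial>M) \<le> \<omega> * (norm v)\<^sup>2"
    using assms by (auto simp: unbiased_with_variance_def)
  have eq: "(norm (c w v))\<^sup>2 = (norm (c w v - v))\<^sup>2 + (2 * inner (c w v) v - (norm v)\<^sup>2)" for w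
    by (simp add: power2_norm_eq_inner inner_diff_left inner_diff_right inner_commute)
  have i: "integrable M (\<lambda>w. 2 * inner (c w v) v - (norm v)\<^sup>2)"
    using c(1) by simp
  show "integrable M (\<lambda>w. (norm (c w v))\<^sup>2)"
    unfolding eq by (rule Bochner_Integration.integrable_add[OF c(3) i])
  have "(\<integral>w. (norm (c w v))\<^sup>2 \<partial>M) = (\<integral>w. (norm (c w v - v))\<^sup>2 \<partial>M) + (\<integral>w. 2 * inner (c w v) v - (norm v)\<^sup>2 \<partial>M)"
    unfolding eq by (rule Bochner_Integration.integral_add[OF c(3) i])
  also have "(\<integral>w. 2 * inner (c w v) v - (norm v)\<^sup>2 \<partial>M) = (norm v)\<^sup>2"
    using c(1,2) by (simp add: prob_space power2_norm_eq_inner)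
  finally show "(\<integral>w. (norm (c w v))\<^sup>2 \<partial>M) \<le> (1 + \<omega>) * (norm v)\<^sup>2"
    using c(4) by (simp add: algebra_simps)
qed

text \<open>With step size \<open>1 / (1 + \<omega>)\<close> the variance of a compressed step is absorbed exactly
  by the convexity defect of the squared norm.\<close>
lemma (in prob_space) compressed_step_sq_le:
  fixes c :: "'a \<Rightarrow> 'e::euclidean_space \<Rightarrow> 'e"
  assumes c: "unbiased_with_variance M \<omega> c" and \<omega>: "\<omega> \<ge> 0" and \<rho>: "\<rho> = 1 / (1 + \<omega>)"
  shows "integrable M (\<lambda>w. (norm (p + \<rho> *\<^sub>R c w v))\<^sup>2)"
    and "(\<integral>w. (norm (p + \<rho> *\<^sub>R c w v))\<^sup>2 \<partial>M) \<le> (1 - \<rho>) * (norm p)\<^sup>2 + \<rho> * (norm (p + v))\<^sup>2"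
proof -
  have c1: "integrable M (\<lambda>w. c w v)" "(\<integral>w. c w v \<partial>M) = v"
    using c by (auto simp: unbiased_with_variance_def)
  note c2 = unbiased_second_moment[OF c, of v]
  show "integrable M (\<lambda>w. (norm (p + \<rho> *\<^sub>R c w v))\<^sup>2)"
    unfolding norm_add_scaleR_sq using c1(1) c2(1) by simp
  have "(\<integral>w. (norm (p + \<rho> *\<^sub>R c w v))\<^sup>2 \<partial>M)
      = (norm p)\<^sup>2 + 2 * \<rho> * inner p v + \<rho>\<^sup>2 * (\<integral>w. (norm (c w v))\<^sup>2 \<partial>M)"
    unfolding norm_add_scaleR_sq using c1 c2(1) by (simp add: prob_space)
  also have "\<dots> \<le> (norm p)\<^sup>2 + 2 * \<rho> * inner p v + \<rho>\<^sup>2 * ((1 + \<omega>) * (norm v)\<^sup>2)"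
    using c2(2) by (intro add_left_mono mult_left_mono) auto
  also have "\<rho>\<^sup>2 * ((1 + \<omega>) * (norm v)\<^sup>2) = \<rho> * (norm v)\<^sup>2"
    using \<omega> by (simp add: \<rho> power2_eq_square)
  also have "(norm p)\<^sup>2 + 2 * \<rho> * inner p v + \<rho> * (norm v)\<^sup>2 = (1 - \<rho>) * (norm p)\<^sup>2 + \<rho> * (norm (p + v))\<^sup>2"
    using norm_add_scaleR_sq[of p 1 v] by (simp add: algebra_simps)
  finally show "(\<integral>w. (norm (p + \<rho> *\<^sub>R c w v))\<^sup>2 \<partial>M) \<le> (1 - \<rho>) * (norm p)\<^sup>2 + \<rho> * (norm (p + v))\<^sup>2" .
qed

text \<open>Joint measurability of the random map enters here: a measurable vector \<open>g\<close>
  may replace the argument. The outcome passes through \<open>f\<close>, so that the same fact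
  covers a single outcome as well as a coordinate of a product space.\<close>

lemma random_map_measurable:
  assumes "random_map P G c" "f \<in> measurable D G" "g \<in> borel_measurable D"
  shows "(\<lambda>p. c (f p) (g p)) \<in> borel_measurable D"
proof -
  have "(\<lambda>p. (f p, g p)) \<in> measurable D (G \<Otimes>\<^sub>M borel)"
    using assms(2,3) by (rule measurable_Pair)
  moreover have "(\<lambda>(w, v). c w v) \<in> borel_measurable (G \<Otimes>\<^sub>M borel)"
    using assms(1) by (simp add: random_map_def)
  ultimately have "(\<lambda>p. (\<lambda>(w, v). c w v) (f p, g p)) \<in> borel_measurable D"
    by (rule measurable_compose)
  then show ?thesis by simp
qed

lemma random_map_section:
  assumes "random_map P G c"
  shows "(\<lambda>w. c w v) \<in> borel_measurable G"
  by (rule random_map_measurable[OF assms]) auto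

lemma subalgebra_measurable_ident: "subalgebra B G \<Longrightarrow> (\<lambda>w. w) \<in> measurable B G"
  by (simp add: measurable_from_subalg measurable_ident_sets)

text \<open>One iteration cut off from its history: the state is not part of the locale, and
  independence is assumed within the round only, between the sampled set and all clients jointly,
  among the clients, and between the uplink and the server operator.\<close>

locale diana_pp_round = prob_space P for P :: "'w measure" +
  fixes M N :: nat and S :: "'w \<Rightarrow> nat set" and C :: "nat \<Rightarrow> 'w \<Rightarrow> 'e::euclidean_space \<Rightarrow> 'e"
    and Q :: "'w \<Rightarrow> 'e \<Rightarrow> 'e" and GC :: "nat \<Rightarrow> 'w measure" and GQ :: "'w measure" and \<omega>C \<omega>R :: real
  assumes N: "1 \<le> N" "N \<le> M" and \<omega>: "\<omega>C \<ge> 0" "\<omega>R \<ge> 0"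
    and S: "uniform_random_subset P M N S"
    and C: "\<And>m. m \<in> {1..M} \<Longrightarrow> random_map P (GC m) (C m)"
      "\<And>m. m \<in> {1..M} \<Longrightarrow> unbiased_with_variance P \<omega>C (C m)"
    and Q: "random_map P GQ Q" "unbiased_with_variance P \<omega>R Q"
    and indep_GS_GC: "indep_set (sets (generated_by P M N S)) (joint_events P (GC ` {1..M}))"
    and indep_GC: "indep_sets (\<lambda>m. sets (GC m)) {1..M}"
    and indep_GQ: "indep_set (joint_events P (insert (generated_by P M N S) (GC ` {1..M}))) (sets GQ)"
begin

abbreviation GS where "GS \<equiv> generated_by P M N S"

abbreviation clients where "clients \<equiv> joint_algebra P (GC ` {1..M})"

abbreviation uplink where "uplink \<equiv> joint_algebra P (insert GS (GC ` {1..M}))"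

lemma S_measurable: "S \<in> measurable P (count_space (subsets_of_size M N))"
  using S by (simp add: uniform_random_subset_def)

lemma S_subset: "w \<in> space P \<Longrightarrow> S w \<subseteq> {1..M}"
  using measurable_space[OF S_measurable, of w] by (simp add: subsets_of_size_def)

lemma subalgebra_GS: "subalgebra P GS"
  by (rule generated_by_subalgebra(1)[OF S_measurable])

lemma subalgebra_GC: "m \<in> {1..M} \<Longrightarrow> subalgebra P (GC m)"
  using C(1)[of m] by (simp add: random_map_def)

lemma subalgebra_GQ: "subalgebra P GQ"
  using Q(1) by (simp add: random_map_def)

lemma subalgebra_clients: "subalgebra P clients"
  by (rule subalgebra_joint_algebra) (use subalgebra_GC in auto)

lemma subalgebra_uplink: "subalgebra P uplink"
  by (rule subalgebra_joint_algebra) (use subalgebra_GC subalgebra_GS in auto)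

lemma subalgebra_clients_GC: "m \<in> {1..M} \<Longrightarrow> subalgebra clients (GC m)"
  by (rule subalgebra_of_joint_algebra) (use subalgebra_GC in auto)

lemma subalgebra_uplink_GC: "m \<in> {1..M} \<Longrightarrow> subalgebra uplink (GC m)"
  by (rule subalgebra_of_joint_algebra) (use subalgebra_GC subalgebra_GS in auto)

lemma subalgebra_uplink_GS: "subalgebra uplink GS"
  by (rule subalgebra_of_joint_algebra) (use subalgebra_GC subalgebra_GS in auto)

lemma sets_clients: "sets clients = joint_events P (GC ` {1..M})"
  by (rule sets_joint_algebra) (use subalgebra_GC in auto)

lemma sets_uplink: "sets uplink = joint_events P (insert GS (GC ` {1..M}))"
  by (rule sets_joint_algebra) (use subalgebra_GC subalgebra_GS in auto)

lemma C_measurable_clients: "m \<in> {1..M} \<Longrightarrow> (\<lambda>w. C m w v) \<in> borel_measurable clients"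
  by (rule measurable_from_subalg[OF subalgebra_clients_GC random_map_section[OF C(1)]])

lemma C_measurable_uplink: "m \<in> {1..M} \<Longrightarrow> (\<lambda>w. C m w v) \<in> borel_measurable uplink"
  by (rule measurable_from_subalg[OF subalgebra_uplink_GC random_map_section[OF C(1)]])

lemma participation_measurable_GS: "(\<lambda>w. of_bool (A \<subseteq> S w) :: real) \<in> borel_measurable GS"
  by (rule measurable_compose[OF generated_by_subalgebra(2)[OF S_measurable]]) simp

lemma participation_measurable_uplink: "(\<lambda>w. of_bool (A \<subseteq> S w) :: real) \<in> borel_measurable uplink"
  by (rule measurable_from_subalg[OF subalgebra_uplink_GS participation_measurable_GS])

text \<open>The factor \<open>Y\<close> may depend on several clients at once, as it does for cross
  terms; therefore the sampled set must be independent of the clients' joint algebra, not only of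
  each client.\<close>

lemma participation_mult:
  fixes Y :: "'w \<Rightarrow> real"
  assumes Y: "Y \<in> borel_measurable clients" "integrable P Y"
  shows "integrable P (\<lambda>w. of_bool (A \<subseteq> S w) * Y w)"
    and "(\<integral>w. of_bool (A \<subseteq> S w) * Y w \<partial>P) = prob {w \<in> space P. A \<subseteq> S w} * (\<integral>w. Y w \<partial>P)"
proof -
  have indep: "indep_set (sets GS) (sets clients)" using indep_GS_GC by (simp only: sets_clients)
  have m: "(\<lambda>w. of_bool (A \<subseteq> S w) :: real) \<in> borel_measurable P"
    by (rule measurable_from_subalg[OF subalgebra_GS participation_measurable_GS])
  have i: "integrable P (\<lambda>w. of_bool (A \<subseteq> S w) :: real)"
    by (rule integrable_const_bound[where B = 1]) (use m in auto)
  have "(\<integral>w. of_bool (A \<subseteq> S w) \<partial>P) = (\<integral>w. indicator {w \<in> space P. A \<subseteq> S w} w \<partial>P :: real)"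
    by (rule Bochner_Integration.integral_cong) (auto simp: indicator_def)
  also have "\<dots> = prob ({w \<in> space P. A \<subseteq> S w} \<inter> space P)"
    by (rule Bochner_Integration.integral_indicator)
  also have "{w \<in> space P. A \<subseteq> S w} \<inter> space P = {w \<in> space P. A \<subseteq> S w}" by blast
  finally have E: "(\<integral>w. of_bool (A \<subseteq> S w) \<partial>P) = prob {w \<in> space P. A \<subseteq> S w}" .
  note inner = inner_indep_subalgebras[OF subalgebra_GS subalgebra_clients indep participation_measurable_GS i Y]
  show "integrable P (\<lambda>w. of_bool (A \<subseteq> S w) * Y w)" using inner(1) by simp
  show "(\<integral>w. of_bool (A \<subseteq> S w) * Y w \<partial>P) = prob {w \<in> space P. A \<subseteq> S w} * (\<integral>w. Y w \<partial>P)"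
    using inner(2) E by simp
qed

text \<open>Mutual independence of the clients' operators enters here: compression errors of
  distinct clients are uncorrelated, so the cross terms carry no factor \<omega>C.\<close>

lemma C_inner:
  assumes "m \<in> {1..M}" "n \<in> {1..M}" "m \<noteq> n"
  shows "integrable P (\<lambda>w. inner (C m w u) (C n w v))"
    and "(\<integral>w. inner (C m w u) (C n w v) \<partial>P) = inner u v"
proof -
  have indep: "indep_set (sets (GC m)) (sets (GC n))"
    unfolding indep_sets2_eq
  proof (intro conjI ballI)
    show "sets (GC m) \<subseteq> events" "sets (GC n) \<subseteq> events"
      using subalgebra_GC assms by (auto simp: subalgebra_def)
    fix a b assume ab: "a \<in> sets (GC m)" "b \<in> sets (GC n)"
    have "prob (\<Inter>j\<in>{m, n}. if j = m then a else b) = (\<Prod>j\<in>{m, n}. prob (if j = m then a else b))"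
      by (rule indep_setsD[OF indep_GC]) (use assms ab in auto)
    then show "prob (a \<inter> b) = prob a * prob b" using assms(3) by (auto simp: Int_commute)
  qed
  have u: "integrable P (\<lambda>w. C m w u)" "(\<integral>w. C m w u \<partial>P) = u" "integrable P (\<lambda>w. C n w v)" "(\<integral>w. C n w v \<partial>P) = v"
    using C(2) assms by (auto simp: unbiased_with_variance_def)
  note inner = inner_indep_subalgebras[OF subalgebra_GC[OF assms(1)] subalgebra_GC[OF assms(2)] indep
      random_map_section[OF C(1)[OF assms(1)]] u(1) random_map_section[OF C(1)[OF assms(2)]] u(3)]
  show "integrable P (\<lambda>w. inner (C m w u) (C n w v))" by (rule inner(1))
  show "(\<integral>w. inner (C m w u) (C n w v) \<partial>P) = inner u v" using inner(2) u by simp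
qed

text \<open>The off-diagonal case is in fact an equality, which matters because the inner product
  there has no sign; the variance bound acts on the diagonal alone.\<close>

lemma sampled_inner:
  assumes "m \<in> {1..M}" "n \<in> {1..M}"
  shows "integrable P (\<lambda>w. of_bool ({m, n} \<subseteq> S w) * inner (C m w (u m)) (C n w (u n)))"
    and "(\<integral>w. of_bool ({m, n} \<subseteq> S w) * inner (C m w (u m)) (C n w (u n)) \<partial>P)
      \<le> (if m = n then N / M * ((1 + \<omega>C) * (norm (u m))\<^sup>2)
          else N * (real N - 1) / (M * (real M - 1)) * inner (u m) (u n))"
proof -
  have i: "integrable P (\<lambda>w. inner (C m w (u m)) (C n w (u n)))"
  proof (cases "m = n")
    case True
    then show ?thesis
      using unbiased_second_moment(1)[OF C(2)[OF assms(1)]] by (simp add: power2_norm_eq_inner)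
  qed (use C_inner assms in auto)
  have meas: "(\<lambda>w. inner (C m w (u m)) (C n w (u n))) \<in> borel_measurable clients"
    by (intro borel_measurable_inner C_measurable_clients assms)
  note part = participation_mult[OF meas i, of "{m, n}"]
  show "integrable P (\<lambda>w. of_bool ({m, n} \<subseteq> S w) * inner (C m w (u m)) (C n w (u n)))"
    by (rule part(1))
  show "(\<integral>w. of_bool ({m, n} \<subseteq> S w) * inner (C m w (u m)) (C n w (u n)) \<partial>P)
      \<le> (if m = n then N / M * ((1 + \<omega>C) * (norm (u m))\<^sup>2)
          else N * (real N - 1) / (M * (real M - 1)) * inner (u m) (u n))"
  proof (cases "m = n")
    case True
    have "prob {w \<in> space P. {m, n} \<subseteq> S w} = N / M"
      using uniform_random_subset_single[OF S assms(1) N] True by simp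
    moreover have "real N / real M * (\<integral>w. inner (C m w (u m)) (C m w (u m)) \<partial>P)
        \<le> real N / real M * ((1 + \<omega>C) * (norm (u m))\<^sup>2)"
      using unbiased_second_moment(2)[OF C(2)[OF assms(1)], of "u m"]
      by (intro mult_left_mono) (auto simp: power2_norm_eq_inner)
    ultimately show ?thesis unfolding part(2) using True by simp
  next
    case False
    have "prob {w \<in> space P. {m, n} \<subseteq> S w} = N * (real N - 1) / (M * (real M - 1))"
      using uniform_random_subset_pair[OF S assms False N] by simp
    then show ?thesis
      unfolding part(2) C_inner(2)[OF assms False] using False by simp
  qed
qed

text \<open>This is \<open>d\<close> of the algorithm: the factor \<open>M / N\<close> of the
  messages and the average \<open>1 / M\<close> combine to \<open>1 / N\<close>. Indicators over the
  fixed range \<open>{1..M}\<close> replace the sum over the random set, so that expectations can be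
  taken termwise.\<close>

definition estimate :: "(nat \<Rightarrow> 'e) \<Rightarrow> 'w \<Rightarrow> 'e" where
  "estimate u w = (1 / N) *\<^sub>R (\<Sum>m\<in>{1..M}. of_bool ({m} \<subseteq> S w) *\<^sub>R C m w (u m))"

lemma estimate_measurable_uplink: "estimate u \<in> borel_measurable uplink"
  unfolding estimate_def
  by (intro borel_measurable_scaleR borel_measurable_sum borel_measurable_const
      participation_measurable_uplink C_measurable_uplink)

text \<open>The exact pair probability keeps the squared norm of the average with coefficient
  \<open>1 - r\<close>, where \<open>r\<close> is the participation ratio; this is the source of the
  negative term. The vector \<open>v\<close> is free because it is later combined with the linear
  term into a complete square.\<close>

lemma estimate_deviation_sq:
  fixes v :: 'e
  shows "integrable P (\<lambda>w. (norm (v - \<gamma> *\<^sub>R estimate u w))\<^sup>2)"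
    and "(\<integral>w. (norm (v - \<gamma> *\<^sub>R estimate u w))\<^sup>2 \<partial>P) \<le>
      (norm v)\<^sup>2 - 2 * \<gamma> * inner v (average M u) + \<gamma>\<^sup>2 *
        ((\<omega>C / M + participation_ratio M N * (1 + \<omega>C)) * (average M (\<lambda>m. (norm (u m))\<^sup>2))
          + (1 - participation_ratio M N) * (norm (average M u))\<^sup>2)"
proof -
  let ?J = "\<lambda>m n w. of_bool ({m, n} \<subseteq> S w) * inner (C m w (u m)) (C n w (u n))"
  let ?L = "\<lambda>m w. of_bool ({m} \<subseteq> S w) * inner v (C m w (u m))"
  have eq: "(norm (v - \<gamma> *\<^sub>R estimate u w))\<^sup>2 = (norm v)\<^sup>2 - 2 * \<gamma> / N * (\<Sum>m\<in>{1..M}. ?L m w)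
      + \<gamma>\<^sup>2 / N\<^sup>2 * (\<Sum>m\<in>{1..M}. \<Sum>n\<in>{1..M}. ?J m n w)" for w
  proof -
    have 1: "inner v (estimate u w) = (1 / N) * (\<Sum>m\<in>{1..M}. ?L m w)"
      unfolding estimate_def by (simp add: inner_sum_right)
    let ?f = "\<lambda>m. of_bool ({m} \<subseteq> S w) *\<^sub>R C m w (u m)"
    have "(norm (estimate u w))\<^sup>2 = (1 / N)\<^sup>2 * (norm (\<Sum>m\<in>{1..M}. ?f m))\<^sup>2"
      by (simp add: estimate_def power_divide)
    also have "(norm (\<Sum>m\<in>{1..M}. ?f m))\<^sup>2 = (\<Sum>m\<in>{1..M}. inner (?f m) (\<Sum>n\<in>{1..M}. ?f n))"
      unfolding power2_norm_eq_inner by (rule inner_sum_left)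
    also have "\<dots> = (\<Sum>m\<in>{1..M}. \<Sum>n\<in>{1..M}. inner (?f m) (?f n))"
      by (intro sum.cong refl inner_sum_right)
    also have "\<dots> = (\<Sum>m\<in>{1..M}. \<Sum>n\<in>{1..M}. ?J m n w)"
      by (intro sum.cong refl) auto
    finally have 2: "(norm (estimate u w))\<^sup>2 = (1 / N)\<^sup>2 * (\<Sum>m\<in>{1..M}. \<Sum>n\<in>{1..M}. ?J m n w)" .
    have "(norm (v - \<gamma> *\<^sub>R estimate u w))\<^sup>2 = (norm v)\<^sup>2 - 2 * \<gamma> * inner v (estimate u w) + \<gamma>\<^sup>2 * (norm (estimate u w))\<^sup>2"
      using norm_add_scaleR_sq[of v "- \<gamma>" "estimate u w"] by simp
    then show ?thesis unfolding 1 2 by (simp add: power_divide)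
  qed
  have L: "integrable P (?L m)" "(\<integral>w. ?L m w \<partial>P) = N / M * inner v (u m)" if m: "m \<in> {1..M}" for m
  proof -
    have c: "integrable P (\<lambda>w. C m w (u m))" "(\<integral>w. C m w (u m) \<partial>P) = u m"
      using C(2)[OF m] by (auto simp: unbiased_with_variance_def)
    have "(\<lambda>w. inner v (C m w (u m))) \<in> borel_measurable clients"
      by (intro borel_measurable_inner C_measurable_clients m borel_measurable_const)
    moreover have "integrable P (\<lambda>w. inner v (C m w (u m)))" using c(1) by simp
    ultimately show "integrable P (?L m)" "(\<integral>w. ?L m w \<partial>P) = N / M * inner v (u m)"
      using participation_mult[of "\<lambda>w. inner v (C m w (u m))" "{m}"] c
        uniform_random_subset_single[OF S m N] by auto
  qed
  have iL: "integrable P (\<lambda>w. \<Sum>m\<in>{1..M}. ?L m w)"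
    by (intro Bochner_Integration.integrable_sum L)
  have iJ: "integrable P (\<lambda>w. \<Sum>m\<in>{1..M}. \<Sum>n\<in>{1..M}. ?J m n w)"
    by (intro Bochner_Integration.integrable_sum sampled_inner)
  show "integrable P (\<lambda>w. (norm (v - \<gamma> *\<^sub>R estimate u w))\<^sup>2)"
    unfolding eq using iL iJ
    by (intro Bochner_Integration.integrable_add Bochner_Integration.integrable_diff integrable_mult_right integrable_const)
  have EL: "(\<integral>w. (\<Sum>m\<in>{1..M}. ?L m w) \<partial>P) = N * inner v (average M u)"
  proof -
    have "(\<integral>w. (\<Sum>m\<in>{1..M}. ?L m w) \<partial>P) = (\<Sum>m\<in>{1..M}. \<integral>w. ?L m w \<partial>P)"
      by (intro Bochner_Integration.integral_sum L)
    also have "\<dots> = (\<Sum>m\<in>{1..M}. N / M * inner v (u m))" by (intro sum.cong refl L)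
    also have "\<dots> = N * inner v (average M u)"
      by (simp add: average_def inner_sum_right sum_distrib_left)
    finally show ?thesis .
  qed
  define \<pi> where "\<pi> = N * (real N - 1) / (M * (real M - 1))"
  define s where "s = (\<Sum>m\<in>{1..M}. (norm (u m))\<^sup>2)"
  define t where "t = (norm (\<Sum>m\<in>{1..M}. u m))\<^sup>2"
  have "t = (\<Sum>m\<in>{1..M}. inner (u m) (\<Sum>n\<in>{1..M}. u n))"
    unfolding t_def power2_norm_eq_inner by (rule inner_sum_left)
  then have t_eq: "t = (\<Sum>m\<in>{1..M}. \<Sum>n\<in>{1..M}. inner (u m) (u n))"
    by (simp only: inner_sum_right)
  have EJ: "(\<integral>w. (\<Sum>m\<in>{1..M}. \<Sum>n\<in>{1..M}. ?J m n w) \<partial>P) \<le> N / M * (1 + \<omega>C) * s + \<pi> * (t - s)"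
  proof -
    have "(\<integral>w. (\<Sum>m\<in>{1..M}. \<Sum>n\<in>{1..M}. ?J m n w) \<partial>P) = (\<Sum>m\<in>{1..M}. \<integral>w. (\<Sum>n\<in>{1..M}. ?J m n w) \<partial>P)"
      by (intro Bochner_Integration.integral_sum Bochner_Integration.integrable_sum sampled_inner)
    also have "\<dots> = (\<Sum>m\<in>{1..M}. \<Sum>n\<in>{1..M}. \<integral>w. ?J m n w \<partial>P)"
      by (intro sum.cong refl Bochner_Integration.integral_sum sampled_inner)
    also have "\<dots> \<le> (\<Sum>m\<in>{1..M}. \<Sum>n\<in>{1..M}. if m = n then N / M * ((1 + \<omega>C) * (norm (u m))\<^sup>2) else \<pi> * inner (u m) (u n))"
      unfolding \<pi>_def by (intro sum_mono sampled_inner)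
    \<comment> \<open>The off-diagonal expression is extended to the diagonal and corrected there,
      so that the inner products form the full double sum \<open>t\<close>.\<close>
    also have "\<dots> = (\<Sum>m\<in>{1..M}. \<Sum>n\<in>{1..M}. \<pi> * inner (u m) (u n) + (if m = n then (N / M * (1 + \<omega>C) - \<pi>) * (norm (u m))\<^sup>2 else 0))"
      by (intro sum.cong refl) (auto simp: power2_norm_eq_inner algebra_simps add_divide_distrib)
    also have "\<dots> = \<pi> * t + (N / M * (1 + \<omega>C) - \<pi>) * s"
      by (simp add: sum.distrib t_eq s_def sum_distrib_left)
    finally show ?thesis by (simp add: algebra_simps)
  qed
  \<comment> \<open>The exact coefficient of \<open>s / M\<close> is
    \<open>\<omega>C / N + r\<close>; it is enlarged to the stated one by
    \<open>1 / N - 1 / M \<le> r\<close>. For \<open>M = 1\<close> both \<open>r\<close> and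
    \<open>\<pi>\<close> are \<open>0 / 0 = 0\<close>, and the two sides agree.\<close>
  have bound: "(N / M * (1 + \<omega>C) * s + \<pi> * (t - s)) / N\<^sup>2 \<le>
      (\<omega>C / M + participation_ratio M N * (1 + \<omega>C)) * (s / M) + (1 - participation_ratio M N) * (t / M\<^sup>2)"
  proof (cases "M = 1")
    case True
    then have "N = 1" "t = s" using N by (auto simp: t_def s_def)
    with True show ?thesis by (simp add: participation_ratio_def algebra_simps)
  next
    case False
    define r where "r = participation_ratio M N"
    have pos: "real M - 1 > 0" "real M > 0" "real N > 0" using N False by auto
    have "s \<ge> 0" by (simp add: s_def sum_nonneg)
    have 1: "1 - r = M * (real N - 1) / (N * (real M - 1))"
      unfolding r_def participation_ratio_def using pos by (simp add: field_simps)
    have le: "1 / N - 1 / M \<le> r"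
      unfolding r_def participation_ratio_def using pos N by (simp add: field_simps)
    have 2: "\<pi> = (1 - r) * (N / M)\<^sup>2"
      unfolding 1 \<pi>_def using pos by (simp add: power2_eq_square mult.commute)
    have 3: "1 / N - (1 - r) / M = r"
      unfolding r_def participation_ratio_def using pos by (simp add: field_simps)
    have "(N / M * (1 + \<omega>C) * s + \<pi> * (t - s)) / N\<^sup>2 = (\<omega>C / N + (1 / N - (1 - r) / M)) * (s / M) + (1 - r) * (t / M\<^sup>2)"
      unfolding 2 using pos by (simp add: field_simps power2_eq_square)
    also have "\<dots> = (\<omega>C / N + r) * (s / M) + (1 - r) * (t / M\<^sup>2)"
      unfolding 3 ..
    also have "\<dots> \<le> (\<omega>C / M + r * (1 + \<omega>C)) * (s / M) + (1 - r) * (t / M\<^sup>2)"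
      using mult_left_mono[OF le \<omega>(1)] \<open>s \<ge> 0\<close> by (intro add_right_mono mult_right_mono) (auto simp: algebra_simps)
    finally show ?thesis by (simp add: r_def)
  qed
  have "(\<integral>w. (norm (v - \<gamma> *\<^sub>R estimate u w))\<^sup>2 \<partial>P) = (norm v)\<^sup>2 - 2 * \<gamma> / N * (\<integral>w. (\<Sum>m\<in>{1..M}. ?L m w) \<partial>P)
      + \<gamma>\<^sup>2 / N\<^sup>2 * (\<integral>w. (\<Sum>m\<in>{1..M}. \<Sum>n\<in>{1..M}. ?J m n w) \<partial>P)"
    unfolding eq using iL iJ by (simp add: prob_space)
  also have "\<dots> \<le> (norm v)\<^sup>2 - 2 * \<gamma> / N * (N * inner v (average M u)) + \<gamma>\<^sup>2 / N\<^sup>2 * (N / M * (1 + \<omega>C) * s + \<pi> * (t - s))"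
    unfolding EL by (intro add_left_mono mult_left_mono EJ) auto
  also have "\<dots> = (norm v)\<^sup>2 - 2 * \<gamma> * inner v (average M u) + \<gamma>\<^sup>2 * ((N / M * (1 + \<omega>C) * s + \<pi> * (t - s)) / N\<^sup>2)"
    using N by simp
  also have "\<dots> \<le> (norm v)\<^sup>2 - 2 * \<gamma> * inner v (average M u) + \<gamma>\<^sup>2 *
      ((\<omega>C / M + participation_ratio M N * (1 + \<omega>C)) * (s / M) + (1 - participation_ratio M N) * (t / M\<^sup>2))"
    by (intro add_left_mono mult_left_mono bound) auto
  also have "s / M = average M (\<lambda>m. (norm (u m))\<^sup>2)" by (simp add: s_def average_def)
  also have "t / M\<^sup>2 = (norm (average M u))\<^sup>2" by (simp add: t_def average_def power_divide)
  finally show "(\<integral>w. (norm (v - \<gamma> *\<^sub>R estimate u w))\<^sup>2 \<partial>P) \<le>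
      (norm v)\<^sup>2 - 2 * \<gamma> * inner v (average M u) + \<gamma>\<^sup>2 *
        ((\<omega>C / M + participation_ratio M N * (1 + \<omega>C)) * (average M (\<lambda>m. (norm (u m))\<^sup>2))
          + (1 - participation_ratio M N) * (norm (average M u))\<^sup>2)" .
qed

text \<open>A selected client performs a compressed step of length \<open>\<eta>\<close>, to which
  \<open>compressed_step_sq_le\<close> applies, and an unselected one stays at \<open>q\<close>;
  averaging over the selection gives the factor \<open>N / M\<close>.\<close>

lemma control_update_sq:
  fixes q u :: 'e
  assumes m: "m \<in> {1..M}" and \<eta>: "\<eta> = 1 / (1 + \<omega>C)"
  shows "integrable P (\<lambda>w. (norm (q + (of_bool ({m} \<subseteq> S w) * \<eta>) *\<^sub>R C m w u))\<^sup>2)"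
    and "(\<integral>w. (norm (q + (of_bool ({m} \<subseteq> S w) * \<eta>) *\<^sub>R C m w u))\<^sup>2 \<partial>P) \<le>
      (1 - N / M * \<eta>) * (norm q)\<^sup>2 + N / M * \<eta> * (norm (q + u))\<^sup>2"
proof -
  \<comment> \<open>Subtracting \<open>(norm q)\<^sup>2\<close> makes the change proportional to the
    selection indicator, which is independent of the remaining factor.\<close>
  let ?Y = "\<lambda>w. (norm (q + \<eta> *\<^sub>R C m w u))\<^sup>2 - (norm q)\<^sup>2"
  note step = compressed_step_sq_le[OF C(2)[OF m] \<omega>(1) \<eta>, of q u]
  have eq: "(norm (q + (of_bool ({m} \<subseteq> S w) * \<eta>) *\<^sub>R C m w u))\<^sup>2 = (norm q)\<^sup>2 + of_bool ({m} \<subseteq> S w) * ?Y w" for w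
    by simp
  have iY: "integrable P ?Y" using step(1) by simp
  have mY: "?Y \<in> borel_measurable clients"
    using C_measurable_clients[OF m, of u] by simp
  note part = participation_mult[OF mY iY, of "{m}"]
  show "integrable P (\<lambda>w. (norm (q + (of_bool ({m} \<subseteq> S w) * \<eta>) *\<^sub>R C m w u))\<^sup>2)"
    unfolding eq using part(1) by simp
  have "(\<integral>w. (norm (q + (of_bool ({m} \<subseteq> S w) * \<eta>) *\<^sub>R C m w u))\<^sup>2 \<partial>P) = (norm q)\<^sup>2 + N / M * (\<integral>w. ?Y w \<partial>P)"
    unfolding eq using part uniform_random_subset_single[OF S m N] by (simp add: prob_space)
  also have "(\<integral>w. ?Y w \<partial>P) = (\<integral>w. (norm (q + \<eta> *\<^sub>R C m w u))\<^sup>2 \<partial>P) - (norm q)\<^sup>2"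
    using step(1) by (simp add: prob_space)
  also have "(norm q)\<^sup>2 + N / M * ((\<integral>w. (norm (q + \<eta> *\<^sub>R C m w u))\<^sup>2 \<partial>P) - (norm q)\<^sup>2)
      \<le> (norm q)\<^sup>2 + N / M * (((1 - \<eta>) * (norm q)\<^sup>2 + \<eta> * (norm (q + u))\<^sup>2) - (norm q)\<^sup>2)"
    by (intro add_left_mono mult_left_mono diff_right_mono step(2)) auto
  also have "\<dots> = (1 - N / M * \<eta>) * (norm q)\<^sup>2 + N / M * \<eta> * (norm (q + u))\<^sup>2"
    by (simp add: algebra_simps)
  finally show "(\<integral>w. (norm (q + (of_bool ({m} \<subseteq> S w) * \<eta>) *\<^sub>R C m w u))\<^sup>2 \<partial>P) \<le>
      (1 - N / M * \<eta>) * (norm q)\<^sup>2 + N / M * \<eta> * (norm (q + u))\<^sup>2" .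
qed

lemma server_update_sq:
  assumes y: "y \<in> borel_measurable uplink" and \<rho>: "\<rho> = 1 / (1 + \<omega>R)"
  shows "(\<integral>\<^sup>+w. ennreal ((norm (x + \<rho> *\<^sub>R Q w (y w - x) - z))\<^sup>2) \<partial>P)
    \<le> (\<integral>\<^sup>+w. ennreal ((1 - \<rho>) * (norm (x - z))\<^sup>2 + \<rho> * (norm (y w - z))\<^sup>2) \<partial>P)"
proof -
  let ?f = "\<lambda>(w, w'). ennreal ((norm (x + \<rho> *\<^sub>R Q w' (y w - x) - z))\<^sup>2)"
  have "(\<lambda>p. Q (snd p) (y (fst p) - x)) \<in> borel_measurable (uplink \<Otimes>\<^sub>M GQ)"
    by (rule random_map_measurable[OF Q(1)]) (use y in auto)
  then have f: "?f \<in> borel_measurable (uplink \<Otimes>\<^sub>M GQ)"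
    by (simp add: case_prod_beta)
  have indep: "indep_set (sets uplink) (sets GQ)" using indep_GQ by (simp only: sets_uplink)
  have "(\<integral>\<^sup>+w. ennreal ((norm (x + \<rho> *\<^sub>R Q w (y w - x) - z))\<^sup>2) \<partial>P)
      = (\<integral>\<^sup>+w. \<integral>\<^sup>+w'. ennreal ((norm (x + \<rho> *\<^sub>R Q w' (y w - x) - z))\<^sup>2) \<partial>P \<partial>P)"
    using nn_integral_indep_subalgebras[OF subalgebra_uplink subalgebra_GQ indep f] by simp
  also have "\<dots> \<le> (\<integral>\<^sup>+w. ennreal ((1 - \<rho>) * (norm (x - z))\<^sup>2 + \<rho> * (norm (y w - z))\<^sup>2) \<partial>P)"
  proof (rule nn_integral_mono)
    fix w
    note step = compressed_step_sq_le[OF Q(2) \<omega>(2) \<rho>, of "x - z" "y w - x"]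
    have eq: "x + \<rho> *\<^sub>R Q w' (y w - x) - z = x - z + \<rho> *\<^sub>R Q w' (y w - x)" for w' by simp
    have "(\<integral>\<^sup>+w'. ennreal ((norm (x + \<rho> *\<^sub>R Q w' (y w - x) - z))\<^sup>2) \<partial>P)
        = ennreal (\<integral>w'. (norm (x - z + \<rho> *\<^sub>R Q w' (y w - x)))\<^sup>2 \<partial>P)"
      unfolding eq by (rule nn_integral_eq_integral[OF step(1)]) simp
    also have "\<dots> \<le> ennreal ((1 - \<rho>) * (norm (x - z))\<^sup>2 + \<rho> * (norm (y w - z))\<^sup>2)"
      using step(2) by (intro ennreal_leI) simp
    finally show "(\<integral>\<^sup>+w'. ennreal ((norm (x + \<rho> *\<^sub>R Q w' (y w - x) - z))\<^sup>2) \<partial>P)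
        \<le> ennreal ((1 - \<rho>) * (norm (x - z))\<^sup>2 + \<rho> * (norm (y w - z))\<^sup>2)" .
  qed
  finally show ?thesis .
qed

end

subsection \<open>The Lyapunov inequality for one round\<close>

lemma norm_average_sq_le:
  fixes z :: "nat \<Rightarrow> 'e::real_inner"
  assumes "M \<ge> 1"
  shows "(norm (average M z))\<^sup>2 \<le> average M (\<lambda>m. (norm (z m))\<^sup>2)"
proof -
  let ?z = "average M z"
  have s: "(\<Sum>m\<in>{1..M}. z m) = real M *\<^sub>R ?z" using assms by (simp add: average_def)
  have "0 \<le> (\<Sum>m\<in>{1..M}. (norm (z m - ?z))\<^sup>2)" by (intro sum_nonneg) simp
  also have "\<dots> = (\<Sum>m\<in>{1..M}. (norm (z m))\<^sup>2 - 2 * inner (z m) ?z + (norm ?z)\<^sup>2)"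
    by (intro sum.cong refl) (simp add: power2_norm_eq_inner inner_diff_left inner_diff_right inner_commute)
  also have "\<dots> = (\<Sum>m\<in>{1..M}. (norm (z m))\<^sup>2) - 2 * inner (\<Sum>m\<in>{1..M}. z m) ?z + M * (norm ?z)\<^sup>2"
    by (simp add: sum.distrib sum_subtractf sum_distrib_left inner_sum_left)
  also have "\<dots> = (\<Sum>m\<in>{1..M}. (norm (z m))\<^sup>2) - M * (norm ?z)\<^sup>2"
    unfolding s by (simp add: power2_norm_eq_inner)
  finally have "M * (norm ?z)\<^sup>2 \<le> (\<Sum>m\<in>{1..M}. (norm (z m))\<^sup>2)" by simp
  moreover have "average M (\<lambda>m. (norm (z m))\<^sup>2) = (\<Sum>m\<in>{1..M}. (norm (z m))\<^sup>2) / M"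
    by (simp add: average_def)
  ultimately show ?thesis using assms by (simp add: pos_le_divide_eq mult.commute)
qed

lemma average_diff: "average M (\<lambda>m. f m - g m) = average M f - average M g"
  by (simp add: average_def sum_subtractf scaleR_diff_right)

lemma average_add: "average M (\<lambda>m. f m + g m) = average M f + average M g"
  by (simp add: average_def sum.distrib scaleR_add_right)

lemma average_scaleR: "average M (\<lambda>m. c *\<^sub>R f m) = c *\<^sub>R average M f"
  by (simp add: average_def scaleR_sum_right[symmetric] mult.commute)

text \<open>Young's inequality is applied keeping its defect \<open>\<parallel>b p + q\<parallel>\<^sup>2 / b\<close>, whose average dominates
  the defect for the averaged vectors.\<close>
lemma average_young:
  fixes p q :: "nat \<Rightarrow> 'e::real_inner"
  assumes "M \<ge> 1" "0 \<le> r" "r \<le> \<omega>" "b > 0"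
  shows "\<omega> * average M (\<lambda>m. (norm (p m - q m))\<^sup>2) - r * (norm (average M p - average M q))\<^sup>2
    \<le> (1 + b) * (\<omega> * average M (\<lambda>m. (norm (p m))\<^sup>2) - r * (norm (average M p))\<^sup>2)
      + (1 + 1 / b) * \<omega> * average M (\<lambda>m. (norm (q m))\<^sup>2)"
proof -
  have id: "(norm (x - y))\<^sup>2 = (1 + b) * (norm x)\<^sup>2 + (1 + 1 / b) * (norm y)\<^sup>2 - (1 / b) * (norm (b *\<^sub>R x + y))\<^sup>2"
    for x y :: 'e
    using assms(4) unfolding power2_norm_eq_inner
    by (simp add: inner_diff_left inner_diff_right inner_add_left inner_add_right inner_commute field_simps)
  let ?z = "\<lambda>m. b *\<^sub>R p m + q m"
  let ?p = "average M (\<lambda>m. (norm (p m))\<^sup>2)" and ?q = "average M (\<lambda>m. (norm (q m))\<^sup>2)"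
    and ?zz = "average M (\<lambda>m. (norm (?z m))\<^sup>2)"
  have z: "average M ?z = b *\<^sub>R average M p + average M q"
    by (simp add: average_add average_scaleR)
  have avg: "average M (\<lambda>m. (norm (p m - q m))\<^sup>2) = (1 + b) * ?p + (1 + 1 / b) * ?q - (1 / b) * ?zz"
    unfolding id average_diff average_add
    by (simp only: real_scaleR_def[symmetric] average_scaleR)
  have "r * (norm (average M ?z))\<^sup>2 \<le> \<omega> * ?zz"
    using assms norm_average_sq_le[OF assms(1), of ?z] by (intro mult_mono) auto
  then have "1 / b * (r * (norm (average M ?z))\<^sup>2) \<le> 1 / b * (\<omega> * ?zz)"
    using assms(4) by (intro mult_left_mono) auto
  \<comment> \<open>Young's identity applied to the negative term also leaves
    \<open>- r * (1 + 1 / b)\<close> times the squared norm of \<open>average M q\<close>, which is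
    dropped.\<close>
  moreover have "0 \<le> r * ((1 + 1 / b) * (norm (average M q))\<^sup>2)"
    using assms by (intro mult_nonneg_nonneg) auto
  moreover have "\<omega> * ((1 + b) * s + (1 + k) * t - k * y) - r * ((1 + b) * s' + (1 + k) * t' - k * y')
      \<le> (1 + b) * (\<omega> * s - r * s') + (1 + k) * \<omega> * t"
    if "k * (r * y') \<le> k * (\<omega> * y)" "0 \<le> r * ((1 + k) * t')" for k s s' t t' y y' :: real
    using that by (simp add: algebra_simps)
  ultimately show ?thesis
    unfolding avg id[of "average M p" "average M q"] z by blast
qed

text \<open>Here \<open>E\<close>, \<open>T\<close>, \<open>Pb\<close>, \<open>A\<close>,
  \<open>B\<close> stand for the squared distance, the inner product with
  \<open>average M p\<close>, the squared norm of \<open>average M p\<close>, and the averages of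
  squares for \<open>p\<close> and \<open>q\<close>; \<open>l\<close> is the control rate
  \<open>lam\<close>. The gain \<open>2 * \<gamma> * T\<close> is split into halves: one absorbs all
  noise in \<open>p\<close> through the step size condition, the other gives the contraction by
  \<mu>.\<close>

lemma lyapunov_contraction:
  fixes E T Pb A B :: real
  assumes nonneg: "0 \<le> E" "0 \<le> A" "0 \<le> B" "0 \<le> \<omega>" "0 \<le> a" "0 \<le> Pb"
    and le: "Pb \<le> A" "A \<le> L * T" "\<mu> * E \<le> T" "1 - (1 + b) * r \<le> a"
    and \<gamma>: "0 < \<gamma>" "\<gamma> * L * (a + (1 + b)\<^sup>2 * \<omega>) \<le> 1" and \<mu>: "\<mu> > 0"
    and \<rho>: "0 \<le> \<rho>" and b: "b > 0"
    and K: "0 \<le> K" "K * l * M = \<rho> * ((b\<^sup>2 + b) * \<gamma>\<^sup>2 * \<omega>)" and M: "0 \<le> M"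
    and c: "1 - \<gamma> * \<mu> * \<rho> \<le> c" "1 - l * (1 - 1 / b\<^sup>2) \<le> c"
  shows "(1 - \<rho>) * E + \<rho> * (E - 2 * \<gamma> * T + \<gamma>\<^sup>2 * Pb + \<gamma>\<^sup>2 * ((1 + b) * (\<omega> * A - r * Pb) + (1 + 1 / b) * \<omega> * B))
      + K * ((1 - l) * (M * B) + l * (M * A)) \<le> c * (E + K * (M * B))"
proof -
  define W where "W = a + (1 + b)\<^sup>2 * \<omega>"
  have W: "W \<ge> 0" using nonneg by (simp add: W_def)
  have T: "T \<ge> 0" using mult_nonneg_nonneg[of \<mu> E] le(3) \<mu> nonneg(1) by linarith
  have 1: "(1 - (1 + b) * r) * Pb \<le> a * A"
  proof -
    have "(1 - (1 + b) * r) * Pb \<le> a * Pb" using le(4) nonneg by (intro mult_right_mono)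
    also have "\<dots> \<le> a * A" using le(1) nonneg by (intro mult_left_mono)
    finally show ?thesis .
  qed
  have 2: "\<gamma>\<^sup>2 * (W * A) \<le> \<gamma> * T"
  proof -
    have "\<gamma>\<^sup>2 * (W * A) \<le> \<gamma>\<^sup>2 * (W * (L * T))"
      using le(2) W by (intro mult_left_mono) auto
    also have "\<dots> = (\<gamma> * T) * (\<gamma> * L * W)" by (simp add: power2_eq_square)
    also have "\<dots> \<le> (\<gamma> * T) * 1"
      using \<gamma> T unfolding W_def by (intro mult_left_mono) auto
    finally show ?thesis by simp
  qed
  have "\<gamma>\<^sup>2 * ((1 - (1 + b) * r) * Pb + (1 + b)\<^sup>2 * \<omega> * A) \<le> \<gamma>\<^sup>2 * (W * A)"
    using 1 by (intro mult_left_mono) (simp_all add: W_def distrib_right)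
  with 2 have 3: "\<gamma>\<^sup>2 * ((1 - (1 + b) * r) * Pb + (1 + b)\<^sup>2 * \<omega> * A) \<le> \<gamma> * T" by linarith
  have 4: "\<gamma> * (\<mu> * E) \<le> \<gamma> * T" using \<gamma> le(3) by (intro mult_left_mono) auto
  have 5: "\<rho> * (\<gamma>\<^sup>2 * ((1 - (1 + b) * r) * Pb + (1 + b)\<^sup>2 * \<omega> * A) - 2 * \<gamma> * T) \<le> \<rho> * (- (\<gamma> * (\<mu> * E)))"
    using 3 4 by (intro mult_left_mono \<rho>) linarith
  have KlA: "K * (l * (M * A)) = \<rho> * ((b\<^sup>2 + b) * \<gamma>\<^sup>2 * \<omega>) * A"
    using arg_cong[OF K(2), of "\<lambda>x. x * A"] by (simp add: mult_ac)
  have KlB: "K * (l * (1 / b\<^sup>2) * (M * B)) = \<rho> * (\<gamma>\<^sup>2 * ((1 + 1 / b) * \<omega> * B))"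
  proof -
    have "K * (l * (1 / b\<^sup>2) * (M * B)) = (K * l * M) * (B / b\<^sup>2)" by simp
    also have "\<dots> = \<rho> * ((b\<^sup>2 + b) * \<gamma>\<^sup>2 * \<omega>) * (B / b\<^sup>2)" unfolding K(2) ..
    also have "\<dots> = \<rho> * (\<gamma>\<^sup>2 * ((1 + 1 / b) * \<omega> * B))"
      using b by (simp add: field_simps power2_eq_square)
    finally show ?thesis .
  qed
  have "(1 - \<rho>) * E + \<rho> * (E - 2 * \<gamma> * T + \<gamma>\<^sup>2 * Pb + \<gamma>\<^sup>2 * ((1 + b) * (\<omega> * A - r * Pb) + (1 + 1 / b) * \<omega> * B))
      + K * ((1 - l) * (M * B) + l * (M * A))
    = E + \<rho> * (\<gamma>\<^sup>2 * ((1 - (1 + b) * r) * Pb + (1 + b)\<^sup>2 * \<omega> * A) - 2 * \<gamma> * T)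
      + \<rho> * (\<gamma>\<^sup>2 * ((1 + 1 / b) * \<omega> * B)) + K * ((1 - l) * (M * B))
      + (K * (l * (M * A)) - \<rho> * ((b\<^sup>2 + b) * \<gamma>\<^sup>2 * \<omega>) * A)"
  proof -
    have sq: "(1 + b)\<^sup>2 = (1 + b) + (b\<^sup>2 + b)" by (simp add: power2_sum)
    have "(1 - \<rho>) * E + \<rho> * (E - t + g * Pb + g * (f * (\<omega> * A - r * Pb) + y)) + K * (s + s')
      = E + \<rho> * (g * ((1 - f * r) * Pb + (f + k) * \<omega> * A) - t)
        + \<rho> * (g * y) + K * s + (K * s' - \<rho> * (k * g * \<omega>) * A)" for t g f k y s s'
      by (simp add: algebra_simps)
    then show ?thesis unfolding sq .
  qed
  also have "\<dots> \<le> E + \<rho> * (- (\<gamma> * (\<mu> * E))) + K * (l * (1 / b\<^sup>2) * (M * B)) + K * ((1 - l) * (M * B))"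
    using 5 unfolding KlA KlB by simp
  also have "\<dots> = (1 - \<gamma> * \<mu> * \<rho>) * E + (1 - l * (1 - 1 / b\<^sup>2)) * (K * (M * B))"
    by (simp add: algebra_simps)
  also have "\<dots> \<le> c * E + c * (K * (M * B))"
    using c nonneg K(1) M by (intro add_mono mult_right_mono) auto
  finally show ?thesis by (simp add: distrib_left)
qed

section \<open>The step of the algorithm: indicator form, measurability, descent\<close>

lemma diana_pp_step_eq:
  assumes "T \<subseteq> {1..M}" "M \<ge> 1"
  shows "diana_pp_step M N F R \<gamma> lam \<rho> T C Q (x, h, hs) =
    (let u = (\<lambda>m. grad (F m) x - h m); d = (1 / real N) *\<^sub>R (\<Sum>m\<in>{1..M}. of_bool ({m} \<subseteq> T) *\<^sub>R C m (u m))
     in (x + \<rho> *\<^sub>R Q (prox \<gamma> R (x - \<gamma> *\<^sub>R (hs + d)) - x),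
         (\<lambda>m. h m + (of_bool ({m} \<subseteq> T) * (lam * (real M / real N))) *\<^sub>R C m (u m)),
         hs + lam *\<^sub>R d))"
proof -
  have "(1 / real M) *\<^sub>R (\<Sum>m\<in>T. (real M / real N) *\<^sub>R v m) =
      (1 / real N) *\<^sub>R (\<Sum>m\<in>{1..M}. of_bool ({m} \<subseteq> T) *\<^sub>R v m)" for v :: "nat \<Rightarrow> 'a"
  proof -
    have "(\<Sum>m\<in>{1..M}. of_bool ({m} \<subseteq> T) *\<^sub>R v m) = (\<Sum>m\<in>T. v m)"
      using assms(1) by (intro sum.mono_neutral_cong_right) auto
    then show ?thesis using assms(2) by (simp add: scaleR_sum_right[symmetric])
  qed
  then show ?thesis
    unfolding diana_pp_step_def Let_def by (auto simp: fun_eq_iff)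
qed

text \<open>The average of the clients' increments is \<open>lam\<close> times \<open>d\<close>.
  Hence the shift in the proximal map can always be compared with the average gradient at the
  minimizer.\<close>

lemma diana_pp_step_server_average:
  assumes "T \<subseteq> {1..M}" "M \<ge> 1"
  shows "snd (snd (diana_pp_step M N F R \<gamma> lam \<rho> T C Q (x, h, average M h))) =
    average M (fst (snd (diana_pp_step M N F R \<gamma> lam \<rho> T C Q (x, h, average M h))))"
proof -
  have "(1 / real M) *\<^sub>R (\<Sum>m\<in>{1..M}. (of_bool ({m} \<subseteq> T) * (lam * (real M / real N))) *\<^sub>R v m)
      = lam *\<^sub>R ((1 / real N) *\<^sub>R (\<Sum>m\<in>{1..M}. of_bool ({m} \<subseteq> T) *\<^sub>R v m))" for v :: "nat \<Rightarrow> 'a"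
    using assms(2) unfolding scaleR_sum_right scaleR_scaleR
    by (intro sum.cong refl) auto
  then show ?thesis
    unfolding diana_pp_step_eq[OF assms] Let_def
    by (simp add: average_add del: of_bool_eq_iff) (simp add: average_def)
qed

context diana_pp_round
begin

text \<open>The state lives on the first factor of the product and the randomness of the round on
  the second, as Fubini's theorem demands.\<close>

lemma diana_pp_step_measurable:
  fixes F :: "nat \<Rightarrow> 'e \<Rightarrow> real" and lam \<rho> :: real
  assumes smooth: "\<And>m. m \<in> {1..M} \<Longrightarrow> L_smooth L (F m)"
    and R: "proper_closed_convex R" "\<gamma> > 0"
    and B: "space A = space P" "subalgebra B GS" "\<And>m. m \<in> {1..M} \<Longrightarrow> subalgebra B (GC m)" "subalgebra B GQ"
    and x: "x \<in> borel_measurable A" and h: "\<And>m. m \<in> {1..M} \<Longrightarrow> (\<lambda>w. h w m) \<in> borel_measurable A"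
    and hs: "hs \<in> borel_measurable A"
  defines "step \<equiv> \<lambda>p. diana_pp_step M N F R \<gamma> lam \<rho> (S (snd p)) (\<lambda>m. C m (snd p)) (Q (snd p))
      (x (fst p), h (fst p), hs (fst p))"
  shows "(\<lambda>p. fst (step p)) \<in> borel_measurable (A \<Otimes>\<^sub>M B)"
    and "m \<in> {1..M} \<Longrightarrow> (\<lambda>p. fst (snd (step p)) m) \<in> borel_measurable (A \<Otimes>\<^sub>M B)"
    and "(\<lambda>p. snd (snd (step p))) \<in> borel_measurable (A \<Otimes>\<^sub>M B)"
proof -
  let ?D = "A \<Otimes>\<^sub>M B"
  have x'[measurable]: "(\<lambda>p. x (fst p)) \<in> borel_measurable ?D"
    and hs'[measurable]: "(\<lambda>p. hs (fst p)) \<in> borel_measurable ?D"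
    using x hs by simp_all
  have h': "(\<lambda>p. h (fst p) m) \<in> borel_measurable ?D" if "m \<in> {1..M}" for m
    by (rule measurable_compose[OF measurable_fst h[OF that]])
  have g: "(\<lambda>p. grad (F m) (x (fst p))) \<in> borel_measurable ?D" if "m \<in> {1..M}" for m
    by (rule measurable_compose[OF x' borel_measurable_grad[OF smooth[OF that]]])
  have snd_meas: "snd \<in> measurable ?D G" if "subalgebra B G" for G
    using measurable_compose[OF measurable_snd subalgebra_measurable_ident[OF that]] .
  define c where "c m p = C m (snd p) (grad (F m) (x (fst p)) - h (fst p) m)" for m p
  have c: "c m \<in> borel_measurable ?D" if m: "m \<in> {1..M}" for m
    unfolding c_def
    by (rule random_map_measurable[OF C(1)[OF m] snd_meas[OF B(3)[OF m]]])
      (intro borel_measurable_diff g h' m)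
  have s: "(\<lambda>p. of_bool ({m} \<subseteq> S (snd p)) :: real) \<in> borel_measurable ?D" for m
    by (rule measurable_compose[OF snd_meas[OF B(2)] participation_measurable_GS])
  define d where "d p = (1 / real N) *\<^sub>R (\<Sum>m\<in>{1..M}. of_bool ({m} \<subseteq> S (snd p)) *\<^sub>R c m p)" for p
  have d[measurable]: "d \<in> borel_measurable ?D"
    unfolding d_def
    by (intro borel_measurable_scaleR borel_measurable_sum borel_measurable_const s c)
  have pr: "(\<lambda>p. prox \<gamma> R (x (fst p) - \<gamma> *\<^sub>R (hs (fst p) + d p))) \<in> borel_measurable ?D"
    by (rule measurable_compose[OF _ borel_measurable_prox[OF R]]) measurable
  have q: "(\<lambda>p. Q (snd p) (prox \<gamma> R (x (fst p) - \<gamma> *\<^sub>R (hs (fst p) + d p)) - x (fst p))) \<in> borel_measurable ?D"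
    by (rule random_map_measurable[OF Q(1) snd_meas[OF B(4)]])
      (intro borel_measurable_diff pr x')
  have eq: "step p = (x (fst p) + \<rho> *\<^sub>R Q (snd p) (prox \<gamma> R (x (fst p) - \<gamma> *\<^sub>R (hs (fst p) + d p)) - x (fst p)),
         (\<lambda>m. h (fst p) m + (of_bool ({m} \<subseteq> S (snd p)) * (lam * (real M / real N))) *\<^sub>R c m p),
         hs (fst p) + lam *\<^sub>R d p)" if p: "p \<in> space ?D" for p
  proof -
    have "snd p \<in> space P" using p B(2) subalgebra_GS by (auto simp: space_pair_measure subalgebra_def)
    from S_subset[OF this] show ?thesis
      using N unfolding step_def by (simp only: diana_pp_step_eq) (simp only: Let_def c_def d_def)
  qed
  show "(\<lambda>p. fst (step p)) \<in> borel_measurable ?D"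
  proof (subst measurable_cong)
    show "fst (step p) = x (fst p) + \<rho> *\<^sub>R Q (snd p) (prox \<gamma> R (x (fst p) - \<gamma> *\<^sub>R (hs (fst p) + d p)) - x (fst p))"
      if "p \<in> space ?D" for p using eq[OF that] by simp
  qed (intro borel_measurable_add x' borel_measurable_scaleR borel_measurable_const q)
  show "(\<lambda>p. snd (snd (step p))) \<in> borel_measurable ?D"
  proof (subst measurable_cong)
    show "snd (snd (step p)) = hs (fst p) + lam *\<^sub>R d p"
      if "p \<in> space ?D" for p using eq[OF that] by simp
  qed measurable
  show "(\<lambda>p. fst (snd (step p)) m) \<in> borel_measurable ?D" if m: "m \<in> {1..M}"
  proof (subst measurable_cong)
    show "fst (snd (step p)) m = h (fst p) m + (of_bool ({m} \<subseteq> S (snd p)) * (lam * (real M / real N))) *\<^sub>R c m p"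
      if "p \<in> space ?D" for p using eq[OF that] by simp
  qed (intro borel_measurable_add borel_measurable_scaleR borel_measurable_times borel_measurable_const h' s c m)
qed

text \<open>The current state is deterministic here. The two summands of \<open>\<Psi>\<close> are
  bounded separately, since only the first involves the server operator; they share the sampled set
  and the clients' draws, but expectations add regardless.\<close>

lemma diana_pp_step_descent:
  fixes F :: "nat \<Rightarrow> 'e \<Rightarrow> real" and h hstar :: "nat \<Rightarrow> 'e" and x xs :: 'e and L \<mu> \<gamma> b a c \<rho> lam \<omega>av :: real
  assumes L: "L > 0" and \<mu>: "\<mu> > 0"
    and F: "\<And>m. m \<in> {1..M} \<Longrightarrow> convex_on UNIV (F m) \<and> L_smooth L (F m)"
    and sc: "strongly_convex \<mu> (\<lambda>x. average M (\<lambda>m. F m x))"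
    and R: "proper_closed_convex R"
    and min: "\<And>y. R xs + ereal (average M (\<lambda>m. F m xs)) \<le> R y + ereal (average M (\<lambda>m. F m y))"
    and hstar: "hstar = (\<lambda>m. grad (F m) xs)"
    and \<omega>av: "\<omega>av = \<omega>C / real M + participation_ratio M N * (1 + \<omega>C)"
    and lam: "lam = real N / real M * (1 / (1 + \<omega>C))" and \<rho>: "\<rho> = 1 / (1 + \<omega>R)" and b: "b > 1"
    and a: "a = max (1 - (1 + b) * participation_ratio M N) 0"
    and \<gamma>: "0 < \<gamma>" "\<gamma> * L * (a + (1 + b)\<^sup>2 * \<omega>av) \<le> 1"
    and K: "K = (b\<^sup>2 + b) * \<gamma>\<^sup>2 * \<omega>av * ((1 + \<omega>C) / (1 + \<omega>R)) * (1 / real N)"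
    and \<Psi>: "\<Psi> = (\<lambda>x h. (norm (x - xs))\<^sup>2 + K * (\<Sum>m\<in>{1..M}. (norm (h m - hstar m))\<^sup>2))"
    and c: "c = 1 - min (\<gamma> * \<mu> / (1 + \<omega>R)) (real N / real M * ((1 - 1 / b\<^sup>2) / (1 + \<omega>C)))"
  defines "step \<equiv> \<lambda>w. diana_pp_step M N F R \<gamma> lam \<rho> (S w) (\<lambda>m. C m w) (Q w) (x, h, average M h)"
  shows "(\<integral>\<^sup>+w. ennreal (\<Psi> (fst (step w)) (fst (snd (step w)))) \<partial>P) \<le> ennreal (c * \<Psi> x h)"
proof -
  let ?r = "participation_ratio M N"
  define u where "u m = grad (F m) x - h m" for m
  define p where "p m = grad (F m) x - hstar m" for m
  define q where "q m = h m - hstar m" for m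
  define e where "e = x - xs"
  \<comment> \<open>The deviation of \<open>x - \<gamma> *\<^sub>R average M h\<close> from its
    counterpart at \<open>xs\<close>; the argument of the proximal map deviates by
    \<open>v - \<gamma> *\<^sub>R estimate u w\<close>.\<close>
  define v where "v = e - \<gamma> *\<^sub>R average M q"
  define y where "y w = prox \<gamma> R (x - \<gamma> *\<^sub>R (average M h + estimate u w))" for w
  have M1: "M \<ge> 1" using N by simp
  have u_eq: "u m = p m - q m" for m by (simp add: u_def p_def q_def)
  have r0: "0 \<le> ?r" using N by (simp add: participation_ratio_def)
  have r\<omega>: "?r \<le> \<omega>av" using r0 \<omega> by (simp add: \<omega>av algebra_simps)
  have \<omega>av0: "0 \<le> \<omega>av" using r0 r\<omega> by simp
  have K0: "0 \<le> K" using b \<omega> \<omega>av0 by (simp add: K)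
  have \<rho>0: "0 \<le> \<rho>" "\<rho> \<le> 1" using \<omega> by (auto simp: \<rho>)
  have step_eq: "step w = (x + \<rho> *\<^sub>R Q w (y w - x),
      (\<lambda>m. h m + (of_bool ({m} \<subseteq> S w) * (1 / (1 + \<omega>C))) *\<^sub>R C m w (u m)),
      average M h + lam *\<^sub>R estimate u w)" if w: "w \<in> space P" for w
  proof -
    have "lam * (real M / real N) = 1 / (1 + \<omega>C)" using N by (simp add: lam)
    then show ?thesis
      unfolding step_def diana_pp_step_eq[OF S_subset[OF w] M1] Let_def y_def estimate_def u_def by simp
  qed

  have G: "GDERIV (F m) z :> grad (F m) z" if "m \<in> {1..M}" for m z
    using F[OF that] by (auto simp: L_smooth_def intro: GDERIV_grad)
  have Gavg: "GDERIV (\<lambda>x. average M (\<lambda>m. F m x)) z :> average M (\<lambda>m. grad (F m) z)" for z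
    by (rule GDERIV_average) (rule G)
  have yv: "(norm (y w - xs))\<^sup>2 \<le> (norm (v - \<gamma> *\<^sub>R estimate u w))\<^sup>2" for w
  proof -
    have "norm (y w - xs) \<le> norm (x - \<gamma> *\<^sub>R (average M h + estimate u w) - (xs - \<gamma> *\<^sub>R average M hstar))"
      unfolding y_def hstar by (rule norm_prox_diff_minimizer_le[OF R \<gamma>(1) min Gavg])
    also have "x - \<gamma> *\<^sub>R (average M h + estimate u w) - (xs - \<gamma> *\<^sub>R average M hstar) = v - \<gamma> *\<^sub>R estimate u w"
      unfolding v_def e_def q_def average_diff by (simp add: algebra_simps)
    finally show ?thesis by (intro power_mono) auto
  qed

  define E where "E = (norm e)\<^sup>2"
  define T where "T = inner e (average M p)"
  define Pb where "Pb = (norm (average M p))\<^sup>2"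
  define A where "A = average M (\<lambda>m. (norm (p m))\<^sup>2)"
  define B where "B = average M (\<lambda>m. (norm (q m))\<^sup>2)"
  have y_meas: "y \<in> borel_measurable uplink"
    unfolding y_def
    by (rule measurable_compose[OF _ borel_measurable_prox[OF R \<gamma>(1)]])
      (intro borel_measurable_diff borel_measurable_scaleR borel_measurable_add borel_measurable_const estimate_measurable_uplink)
  note dev = estimate_deviation_sq[of v \<gamma> u]
  have V: "(\<integral>w. (norm (v - \<gamma> *\<^sub>R estimate u w))\<^sup>2 \<partial>P) \<le>
      E - 2 * \<gamma> * T + \<gamma>\<^sup>2 * Pb + \<gamma>\<^sup>2 * ((1 + b) * (\<omega>av * A - ?r * Pb) + (1 + 1 / b) * \<omega>av * B)"
  proof -
    have ubar: "average M u = average M p - average M q"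
      unfolding u_eq by (rule average_diff)
    have young: "\<omega>av * average M (\<lambda>m. (norm (u m))\<^sup>2) - ?r * (norm (average M u))\<^sup>2
      \<le> (1 + b) * (\<omega>av * A - ?r * Pb) + (1 + 1 / b) * \<omega>av * B"
      unfolding ubar u_eq A_def Pb_def B_def using b by (intro average_young M1 r0 r\<omega>) auto
    \<comment> \<open>The mean of the estimate recombines with \<open>v\<close>: subtracting it
      turns \<open>v\<close> into \<open>e - \<gamma> *\<^sub>R average M p\<close>, in which the
      control vectors have disappeared.\<close>
    have sq: "(norm v)\<^sup>2 - 2 * \<gamma> * inner v (average M u) + \<gamma>\<^sup>2 * (norm (average M u))\<^sup>2 = E - 2 * \<gamma> * T + \<gamma>\<^sup>2 * Pb"
    proof -
      have "v - \<gamma> *\<^sub>R average M u = e - \<gamma> *\<^sub>R average M p"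
        unfolding v_def ubar by (simp add: algebra_simps)
      then have "(norm (v - \<gamma> *\<^sub>R average M u))\<^sup>2 = (norm (e - \<gamma> *\<^sub>R average M p))\<^sup>2" by simp
      then show ?thesis
        using norm_add_scaleR_sq[of v "- \<gamma>" "average M u"] norm_add_scaleR_sq[of e "- \<gamma>" "average M p"]
        by (simp add: E_def T_def Pb_def)
    qed
    have "(\<integral>w. (norm (v - \<gamma> *\<^sub>R estimate u w))\<^sup>2 \<partial>P) \<le>
        ((norm v)\<^sup>2 - 2 * \<gamma> * inner v (average M u) + \<gamma>\<^sup>2 * (norm (average M u))\<^sup>2)
        + \<gamma>\<^sup>2 * (\<omega>av * average M (\<lambda>m. (norm (u m))\<^sup>2) - ?r * (norm (average M u))\<^sup>2)"
      using dev(2) by (simp add: \<omega>av algebra_simps)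
    also have "\<dots> \<le> (E - 2 * \<gamma> * T + \<gamma>\<^sup>2 * Pb) + \<gamma>\<^sup>2 * ((1 + b) * (\<omega>av * A - ?r * Pb) + (1 + 1 / b) * \<omega>av * B)"
      unfolding sq by (intro add_left_mono mult_left_mono young) auto
    finally show ?thesis .
  qed

  define X2 where "X2 = (1 - \<rho>) * E + \<rho> * (E - 2 * \<gamma> * T + \<gamma>\<^sup>2 * Pb + \<gamma>\<^sup>2 * ((1 + b) * (\<omega>av * A - ?r * Pb) + (1 + 1 / b) * \<omega>av * B))"
  have x_part: "(\<integral>\<^sup>+w. ennreal ((norm (x + \<rho> *\<^sub>R Q w (y w - x) - xs))\<^sup>2) \<partial>P) \<le> ennreal X2"
  proof -
    have "(\<integral>\<^sup>+w. ennreal ((norm (x + \<rho> *\<^sub>R Q w (y w - x) - xs))\<^sup>2) \<partial>P)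
        \<le> (\<integral>\<^sup>+w. ennreal ((1 - \<rho>) * (norm (x - xs))\<^sup>2 + \<rho> * (norm (y w - xs))\<^sup>2) \<partial>P)"
      by (rule server_update_sq[OF y_meas \<rho>])
    also have "\<dots> \<le> (\<integral>\<^sup>+w. ennreal ((1 - \<rho>) * E + \<rho> * (norm (v - \<gamma> *\<^sub>R estimate u w))\<^sup>2) \<partial>P)"
      unfolding E_def e_def using \<rho>0 yv by (intro nn_integral_mono ennreal_leI add_left_mono mult_left_mono) auto
    also have "\<dots> = ennreal (\<integral>w. (1 - \<rho>) * E + \<rho> * (norm (v - \<gamma> *\<^sub>R estimate u w))\<^sup>2 \<partial>P)"
      using \<rho>0 dev(1) by (intro nn_integral_eq_integral) (auto simp: E_def)
    also have "(\<integral>w. (1 - \<rho>) * E + \<rho> * (norm (v - \<gamma> *\<^sub>R estimate u w))\<^sup>2 \<partial>P)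
        = (1 - \<rho>) * E + \<rho> * (\<integral>w. (norm (v - \<gamma> *\<^sub>R estimate u w))\<^sup>2 \<partial>P)"
      using dev(1) by (simp add: prob_space)
    also have "ennreal \<dots> \<le> ennreal X2"
      unfolding X2_def using \<rho>0 V by (intro ennreal_leI add_left_mono mult_left_mono)
    finally show ?thesis .
  qed

  define h' where "h' m w = q m + (of_bool ({m} \<subseteq> S w) * (1 / (1 + \<omega>C))) *\<^sub>R C m w (u m)" for m w
  \<comment> \<open>As \<open>q m + u m = p m\<close>, a full uncompressed step would replace the
    control error by the gradient difference \<open>p m\<close>.\<close>
  have ctrl: "integrable P (\<lambda>w. (norm (h' m w))\<^sup>2)"
    "(\<integral>w. (norm (h' m w))\<^sup>2 \<partial>P) \<le> (1 - lam) * (norm (q m))\<^sup>2 + lam * (norm (p m))\<^sup>2" if m: "m \<in> {1..M}" for m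
    using control_update_sq[OF m refl, of "q m" "u m"] unfolding h'_def lam by (auto simp: u_eq)
  have ih: "integrable P (\<lambda>w. K * (\<Sum>m\<in>{1..M}. (norm (h' m w))\<^sup>2))"
    by (intro integrable_mult_right Bochner_Integration.integrable_sum ctrl)
  have h_part: "(\<integral>\<^sup>+w. ennreal (K * (\<Sum>m\<in>{1..M}. (norm (h' m w))\<^sup>2)) \<partial>P)
      \<le> ennreal (K * ((1 - lam) * (M * B) + lam * (M * A)))"
  proof -
    have "(\<integral>\<^sup>+w. ennreal (K * (\<Sum>m\<in>{1..M}. (norm (h' m w))\<^sup>2)) \<partial>P) = ennreal (\<integral>w. K * (\<Sum>m\<in>{1..M}. (norm (h' m w))\<^sup>2) \<partial>P)"
      using K0 by (intro nn_integral_eq_integral ih) (auto intro!: mult_nonneg_nonneg sum_nonneg)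
    also have "(\<integral>w. K * (\<Sum>m\<in>{1..M}. (norm (h' m w))\<^sup>2) \<partial>P) = K * (\<Sum>m\<in>{1..M}. \<integral>w. (norm (h' m w))\<^sup>2 \<partial>P)"
      using ctrl(1) by (subst integral_mult_right_zero, subst Bochner_Integration.integral_sum) auto
    also have "\<dots> \<le> K * (\<Sum>m\<in>{1..M}. (1 - lam) * (norm (q m))\<^sup>2 + lam * (norm (p m))\<^sup>2)"
      by (intro mult_left_mono sum_mono ctrl K0)
    also have "\<dots> = K * ((1 - lam) * (M * B) + lam * (M * A))"
      using M1 by (simp add: sum.distrib sum_distrib_left[symmetric] A_def B_def average_def)
    finally show ?thesis using ennreal_leI by simp
  qed

  have contraction: "X2 + K * ((1 - lam) * (M * B) + lam * (M * A)) \<le> c * (E + K * (M * B))"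
    unfolding X2_def
  proof (rule lyapunov_contraction[where a = a and L = L and \<mu> = \<mu>])
    show "0 \<le> E" "0 \<le> A" "0 \<le> B" "0 \<le> Pb"
      by (auto simp: E_def A_def B_def Pb_def average_def intro!: divide_nonneg_nonneg sum_nonneg)
    show "Pb \<le> A" unfolding Pb_def A_def by (rule norm_average_sq_le[OF M1])
    have "(\<Sum>m\<in>{1..M}. (norm (p m))\<^sup>2) \<le> (\<Sum>m\<in>{1..M}. L * inner (p m) e)"
      using F L unfolding p_def e_def hstar by (intro sum_mono L_smooth_cocoercive) auto
    also have "\<dots> = L * (M * T)"
      using M1 by (simp add: T_def average_def sum_distrib_left inner_sum_right inner_commute)
    finally show "A \<le> L * T" using M1 by (simp add: A_def average_def field_simps)
    have "\<mu> * (norm (x - xs))\<^sup>2 \<le> inner (average M (\<lambda>m. grad (F m) x) - average M (\<lambda>m. grad (F m) xs)) (x - xs)"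
      by (rule strongly_convex_gradient_monotone[OF sc Gavg Gavg])
    moreover have "average M p = average M (\<lambda>m. grad (F m) x) - average M (\<lambda>m. grad (F m) xs)"
      unfolding average_diff[symmetric] by (simp add: average_def p_def hstar)
    ultimately show "\<mu> * E \<le> T"
      by (simp add: E_def T_def e_def inner_commute)
    have NN: "real N > 0" "real M > 0" using N by auto
    have \<omega>1: "1 + \<omega>C > 0" "1 + \<omega>R > 0" using \<omega> by auto
    then show "K * lam * real M = \<rho> * ((b\<^sup>2 + b) * \<gamma>\<^sup>2 * \<omega>av)"
      using NN unfolding K lam \<rho> by simp
    show "1 - \<gamma> * \<mu> * \<rho> \<le> c" "1 - lam * (1 - 1 / b\<^sup>2) \<le> c"
      unfolding c \<rho> lam by auto
  qed (use \<omega>av0 a \<gamma> \<mu> \<rho>0 b K0 in auto)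

  have mX: "(\<lambda>w. x + \<rho> *\<^sub>R Q w (y w - x) - xs) \<in> borel_measurable P"
  proof -
    have "(\<lambda>w. Q w (y w - x)) \<in> borel_measurable P"
      by (rule random_map_measurable[OF Q(1) subalgebra_measurable_ident[OF subalgebra_GQ]])
        (intro borel_measurable_diff borel_measurable_const measurable_from_subalg[OF subalgebra_uplink y_meas])
    then show ?thesis by simp
  qed
  have "(\<integral>\<^sup>+w. ennreal (\<Psi> (fst (step w)) (fst (snd (step w)))) \<partial>P)
      = (\<integral>\<^sup>+w. ennreal ((norm (x + \<rho> *\<^sub>R Q w (y w - x) - xs))\<^sup>2) + ennreal (K * (\<Sum>m\<in>{1..M}. (norm (h' m w))\<^sup>2)) \<partial>P)"
  proof (rule nn_integral_cong)
    fix w assume w: "w \<in> space P"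
    have "(\<Sum>m\<in>{1..M}. (norm (fst (snd (step w)) m - hstar m))\<^sup>2) = (\<Sum>m\<in>{1..M}. (norm (h' m w))\<^sup>2)"
      unfolding step_eq[OF w] h'_def q_def by (intro sum.cong refl) (simp add: algebra_simps)
    then show "ennreal (\<Psi> (fst (step w)) (fst (snd (step w)))) =
        ennreal ((norm (x + \<rho> *\<^sub>R Q w (y w - x) - xs))\<^sup>2) + ennreal (K * (\<Sum>m\<in>{1..M}. (norm (h' m w))\<^sup>2))"
      unfolding \<Psi> using K0 by (subst ennreal_plus[symmetric]) (auto simp: step_eq[OF w] intro!: mult_nonneg_nonneg sum_nonneg)
  qed
  also have "\<dots> = (\<integral>\<^sup>+w. ennreal ((norm (x + \<rho> *\<^sub>R Q w (y w - x) - xs))\<^sup>2) \<partial>P)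
      + (\<integral>\<^sup>+w. ennreal (K * (\<Sum>m\<in>{1..M}. (norm (h' m w))\<^sup>2)) \<partial>P)"
    using mX ih by (intro nn_integral_add) auto
  also have "\<dots> \<le> ennreal X2 + ennreal (K * ((1 - lam) * (M * B) + lam * (M * A)))"
    by (intro add_mono x_part h_part)
  also have "\<dots> = ennreal (X2 + K * ((1 - lam) * (M * B) + lam * (M * A)))"
  \<comment> \<open>\<open>ennreal\<close> sends negative reals to 0, so the two terms may be merged
    only if both are nonnegative. \<open>X2\<close> qualifies since, by \<open>V\<close>, its part
    weighted by \<rho> bounds an integral of a square.\<close>
  proof (rule ennreal_plus[symmetric])
    have "0 \<le> (\<integral>w. (norm (v - \<gamma> *\<^sub>R estimate u w))\<^sup>2 \<partial>P)" by simp
    with V have z: "0 \<le> E - 2 * \<gamma> * T + \<gamma>\<^sup>2 * Pb + \<gamma>\<^sup>2 * ((1 + b) * (\<omega>av * A - ?r * Pb) + (1 + 1 / b) * \<omega>av * B)"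
      by linarith
    show "0 \<le> X2" unfolding X2_def
      by (rule add_nonneg_nonneg[OF mult_nonneg_nonneg mult_nonneg_nonneg[OF _ z]])
        (use \<rho>0 in \<open>simp_all add: E_def\<close>)
    have "real N / real M \<le> 1" "1 / (1 + \<omega>C) \<le> 1" "0 \<le> 1 / (1 + \<omega>C)" using N \<omega> by auto
    then have "lam \<le> 1" "0 \<le> lam"
      unfolding lam by (intro mult_le_one mult_nonneg_nonneg; simp)+
    then show "0 \<le> K * ((1 - lam) * (M * B) + lam * (M * A))"
      using K0 by (auto simp: A_def B_def average_def intro!: mult_nonneg_nonneg add_nonneg_nonneg divide_nonneg_nonneg sum_nonneg)
  qed
  also have "\<dots> \<le> ennreal (c * (E + K * (M * B)))" by (intro ennreal_leI contraction)
  also have "E + K * (M * B) = \<Psi> x h"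
    using M1 by (simp add: \<Psi> E_def e_def B_def q_def average_def)
  finally show ?thesis .
qed

end

lemma (in prob_space) indep_set_commute:
  assumes "indep_set A B"
  shows "indep_set B A"
  unfolding indep_sets2_eq
proof (intro conjI ballI)
  show "B \<subseteq> events" "A \<subseteq> events" using assms unfolding indep_sets2_eq by auto
  fix b a assume "b \<in> B" "a \<in> A"
  then show "prob (b \<inter> a) = prob b * prob a"
    using indep_setD[OF assms, of a b] by (simp add: Int_commute mult.commute)
qed

subsection \<open>The whole run\<close>

locale diana_pp_randomness = prob_space P for P :: "'w measure" +
  fixes M N :: nat and S :: "nat \<Rightarrow> 'w \<Rightarrow> nat set" and C :: "nat \<Rightarrow> nat \<Rightarrow> 'w \<Rightarrow> 'e::euclidean_space \<Rightarrow> 'e"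
    and Q :: "nat \<Rightarrow> 'w \<Rightarrow> 'e \<Rightarrow> 'e" and GC :: "nat \<Rightarrow> nat \<Rightarrow> 'w measure" and GQ :: "nat \<Rightarrow> 'w measure"
    and \<omega>C \<omega>R :: real
  assumes N: "1 \<le> N" "N \<le> M" and \<omega>: "\<omega>C \<ge> 0" "\<omega>R \<ge> 0"
    and C: "\<And>k m. m \<in> {1..M} \<Longrightarrow> random_map P (GC k m) (C k m) \<and> unbiased_with_variance P \<omega>C (C k m)"
    and Q: "\<And>k. random_map P (GQ k) (Q k) \<and> unbiased_with_variance P \<omega>R (Q k)"
    and S: "\<And>k. uniform_random_subset P M N (S k)"
    and indep: "independent_randomness P M (\<lambda>k. generated_by P M N (S k)) GC GQ"
    and indep_GC: "\<And>k. indep_sets (\<lambda>m. sets (GC k m)) {1..M}"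
begin

definition GU :: "nat \<Rightarrow> 'w measure set" where
  "GU k = insert (generated_by P M N (S k)) (GC k ` {1..M})"

text \<open>The union stops before \<open>k\<close>: the state with index \<open>k\<close> has
  consumed the randomness of the iterations below \<open>k\<close>, and the draws of iteration
  \<open>k\<close> belong to \<open>fresh k\<close>.\<close>

definition past :: "nat \<Rightarrow> 'w measure" where
  "past k = joint_algebra P (\<Union>j<k. insert (GQ j) (GU j))"

definition fresh :: "nat \<Rightarrow> 'w measure" where
  "fresh k = joint_algebra P (insert (GQ k) (GU k))"

lemma round: "diana_pp_round P M N (S k) (C k) (Q k) (GC k) (GQ k) \<omega>C \<omega>R"
proof (rule diana_pp_round.intro)
  show "prob_space P" by (rule prob_space_axioms)
  show "diana_pp_round_axioms P M N (S k) (C k) (Q k) (GC k) (GQ k) \<omega>C \<omega>R"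
  proof
    note I = indep[unfolded independent_randomness_def]
    show "indep_set (sets (generated_by P M N (S k))) (joint_events P (GC k ` {1..M}))"
      by (rule indep_set_mono[OF I[THEN conjunct1]])
        (auto intro!: sets_subset_joint_events joint_events_mono)
    have "indep_set (joint_events P (\<Union>k. insert (generated_by P M N (S k)) (GC k ` {1..M})))
        (joint_events P (range GQ))"
      by (rule indep_set_commute) (use I in blast)
    then show "indep_set (joint_events P (insert (generated_by P M N (S k)) (GC k ` {1..M}))) (sets (GQ k))"
      by (rule indep_set_mono) (intro joint_events_mono sets_subset_joint_events; blast)+
  qed (use N \<omega> C Q S indep_GC in auto)
qed

lemma subalgebra_GU: "G \<in> GU k \<Longrightarrow> subalgebra P G"
  unfolding GU_def
  by (elim insertE imageE) (simp_all only: diana_pp_round.subalgebra_GS[OF round] diana_pp_round.subalgebra_GC[OF round])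

lemma subalgebra_GQ: "subalgebra P (GQ k)"
  by (rule diana_pp_round.subalgebra_GQ[OF round])

lemma subalgebra_gens: "G \<in> insert (GQ k) (GU k) \<Longrightarrow> subalgebra P G"
  using subalgebra_GU subalgebra_GQ by auto

lemma subalgebra_past: "subalgebra P (past k)"
  unfolding past_def by (rule subalgebra_joint_algebra) (use subalgebra_gens in blast)

lemma subalgebra_fresh: "subalgebra P (fresh k)"
  unfolding fresh_def by (rule subalgebra_joint_algebra) (rule subalgebra_gens)

lemma subalgebra_fresh_gens: "G \<in> insert (GQ k) (GU k) \<Longrightarrow> subalgebra (fresh k) G"
  unfolding fresh_def by (rule subalgebra_of_joint_algebra) (use subalgebra_gens in blast)+

lemma subalgebra_past_Suc: "subalgebra (past (Suc k)) (past k)"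
  unfolding past_def by (rule subalgebra_joint_algebra_mono) (use subalgebra_gens in \<open>auto simp: less_Suc_eq\<close>)

lemma subalgebra_past_Suc_fresh: "subalgebra (past (Suc k)) (fresh k)"
  unfolding past_def fresh_def by (rule subalgebra_joint_algebra_mono) (use subalgebra_gens in auto)

text \<open>Independence across iterations is assumed separately for the uplinks and for the server
  operators, together with independence between these two layers.
  \<open>indep_set_joint_pairs\<close> reassembles it along time, with \<open>A\<close>,
  \<open>B\<close> as the past and \<open>E k\<close>, \<open>GQ k\<close> as the present of the two
  layers.\<close>

lemma indep_past_fresh: "indep_set (sets (past k)) (sets (fresh k))"
proof -
  define E where "E j = joint_algebra P (GU j)" for j
  have E: "subalgebra P (E j)" for j
    unfolding E_def by (rule subalgebra_joint_algebra) (rule subalgebra_GU)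
  have sE: "sets (E j) = joint_events P (GU j)" for j
    unfolding E_def by (rule sets_joint_algebra) (rule subalgebra_GU)
  define A where "A = joint_algebra P (E ` {..<k})"
  define B where "B = joint_algebra P (GQ ` {..<k})"
  define U where "U = joint_algebra P (\<Union>j. GU j)"
  define V where "V = joint_algebra P (range GQ)"
  have A: "subalgebra P A" unfolding A_def by (rule subalgebra_joint_algebra) (use E in auto)
  have B: "subalgebra P B" unfolding B_def by (rule subalgebra_joint_algebra) (use subalgebra_GQ in auto)
  have sA: "sets A = joint_events P (E ` {..<k})" unfolding A_def by (rule sets_joint_algebra) (use E in auto)
  have sB: "sets B = joint_events P (GQ ` {..<k})" unfolding B_def by (rule sets_joint_algebra) (use subalgebra_GQ in auto)
  have sU: "sets U = joint_events P (\<Union>j. GU j)" unfolding U_def by (rule sets_joint_algebra) (use subalgebra_GU in blast)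
  have sV: "sets V = joint_events P (range GQ)" unfolding V_def by (rule sets_joint_algebra) (use subalgebra_GQ in auto)
  note I = indep[unfolded independent_randomness_def, folded GU_def]
  have EU: "sets (E j) \<subseteq> sets U" for j
    unfolding sE sU by (rule joint_events_mono) blast
  have AU: "sets A \<subseteq> sets U"
    unfolding sA by (rule joint_events_least) (use EU in \<open>auto simp: U_def\<close>)
  have BV: "sets B \<subseteq> sets V" "sets (GQ k) \<subseteq> sets V"
    unfolding sB sV by (auto intro!: joint_events_mono sets_subset_joint_events)
  have UV: "indep_set (sets U) (sets V)"
    unfolding sU sV by (rule indep_set_commute) (use I in blast)
  have "indep_sets (\<lambda>j. sets (E j)) UNIV" using I unfolding sE by blast
  then have AE: "indep_set (sets A) (sets (E k))"
    unfolding sA by (rule indep_sets_initial_segment)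
  have "indep_sets (\<lambda>j. sets (GQ j)) UNIV" using I by blast
  then have BQ: "indep_set (sets B) (sets (GQ k))"
    unfolding sB by (rule indep_sets_initial_segment)
  have joint: "indep_set (joint_events P {A, B}) (joint_events P {E k, GQ k})"
    by (rule indep_set_joint_pairs[OF A E B subalgebra_GQ UV AU EU BV AE BQ])
  have GE: "sets G \<subseteq> sets (E j)" if "G \<in> GU j" for G j
    unfolding sE by (rule sets_subset_joint_events[OF that])
  have EA: "sets (E j) \<subseteq> sets A" if "j < k" for j
    unfolding sA by (rule sets_subset_joint_events) (use that in auto)
  have QB: "sets (GQ j) \<subseteq> sets B" if "j < k" for j
    unfolding sB by (rule sets_subset_joint_events) (use that in auto)
  have sAB: "sets (joint_algebra P {A, B}) = joint_events P {A, B}"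
    by (rule sets_joint_algebra) (use A B in auto)
  have sEQ: "sets (joint_algebra P {E k, GQ k}) = joint_events P {E k, GQ k}"
    by (rule sets_joint_algebra) (use E subalgebra_GQ in auto)
  have AB: "sets A \<subseteq> joint_events P {A, B}" "sets B \<subseteq> joint_events P {A, B}"
    by (auto intro!: sets_subset_joint_events)
  have EQ: "sets (E k) \<subseteq> joint_events P {E k, GQ k}" "sets (GQ k) \<subseteq> joint_events P {E k, GQ k}"
    by (auto intro!: sets_subset_joint_events)
  have "sets (past k) = joint_events P (\<Union>j<k. insert (GQ j) (GU j))"
    unfolding past_def by (rule sets_joint_algebra) (use subalgebra_gens in blast)
  also have "\<dots> \<subseteq> sets (joint_algebra P {A, B})"
  proof (rule joint_events_least)
    fix G assume "G \<in> (\<Union>j<k. insert (GQ j) (GU j))"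
    then obtain j where j: "j < k" "G = GQ j \<or> G \<in> GU j" by blast
    then show "sets G \<subseteq> sets (joint_algebra P {A, B})"
      unfolding sAB using GE[of G j] EA[OF j(1)] QB[OF j(1)] AB by blast
  qed simp
  finally have past: "sets (past k) \<subseteq> joint_events P {A, B}" unfolding sAB .
  have "sets (fresh k) = joint_events P (insert (GQ k) (GU k))"
    unfolding fresh_def by (rule sets_joint_algebra) (rule subalgebra_gens)
  also have "\<dots> \<subseteq> sets (joint_algebra P {E k, GQ k})"
  proof (rule joint_events_least)
    fix G assume "G \<in> insert (GQ k) (GU k)"
    then show "sets G \<subseteq> sets (joint_algebra P {E k, GQ k})"
      unfolding sEQ using GE[of G k] EQ by blast
  qed simp
  finally have fresh: "sets (fresh k) \<subseteq> joint_events P {E k, GQ k}" unfolding sEQ .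
  show ?thesis by (rule indep_set_mono[OF joint past fresh])
qed

lemma diana_pp_step_measurable_fresh:
  fixes F :: "nat \<Rightarrow> 'e \<Rightarrow> real" and lam \<rho> :: real
  assumes F: "\<And>m. m \<in> {1..M} \<Longrightarrow> L_smooth L (F m)" and R: "proper_closed_convex R" "\<gamma> > 0"
    and st: "(\<lambda>w. fst (st w)) \<in> borel_measurable (past k)"
      "\<And>m. m \<in> {1..M} \<Longrightarrow> (\<lambda>w. fst (snd (st w)) m) \<in> borel_measurable (past k)"
      "(\<lambda>w. snd (snd (st w))) \<in> borel_measurable (past k)"
  defines "step \<equiv> \<lambda>p. diana_pp_step M N F R \<gamma> lam \<rho> (S k (snd p)) (\<lambda>m. C k m (snd p)) (Q k (snd p)) (st (fst p))"
  shows "(\<lambda>p. fst (step p)) \<in> borel_measurable (past k \<Otimes>\<^sub>M fresh k)"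
    and "m \<in> {1..M} \<Longrightarrow> (\<lambda>p. fst (snd (step p)) m) \<in> borel_measurable (past k \<Otimes>\<^sub>M fresh k)"
    and "(\<lambda>p. snd (snd (step p))) \<in> borel_measurable (past k \<Otimes>\<^sub>M fresh k)"
proof -
  interpret round: diana_pp_round P M N "S k" "C k" "Q k" "GC k" "GQ k" \<omega>C \<omega>R by (rule round)
  have sp: "space (past k) = space P" by (simp add: past_def)
  have sub: "subalgebra (fresh k) (generated_by P M N (S k))"
    "\<And>m. m \<in> {1..M} \<Longrightarrow> subalgebra (fresh k) (GC k m)" "subalgebra (fresh k) (GQ k)"
    by (rule subalgebra_fresh_gens; auto simp: GU_def)+
  note meas = round.diana_pp_step_measurable[where h = "\<lambda>w. fst (snd (st w))", OF F R sp sub st]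
  show "(\<lambda>p. fst (step p)) \<in> borel_measurable (past k \<Otimes>\<^sub>M fresh k)"
    using meas(1) unfolding step_def by simp
  show "(\<lambda>p. fst (snd (step p)) m) \<in> borel_measurable (past k \<Otimes>\<^sub>M fresh k)" if "m \<in> {1..M}"
    using meas(2)[OF _ _ _ that] unfolding step_def by simp
  show "(\<lambda>p. snd (snd (step p))) \<in> borel_measurable (past k \<Otimes>\<^sub>M fresh k)"
    using meas(3) unfolding step_def by simp
qed

lemma diana_pp_measurable:
  fixes F :: "nat \<Rightarrow> 'e \<Rightarrow> real" and lam \<rho> :: real and x0 :: 'e and h0 :: "nat \<Rightarrow> 'e"
  assumes F: "\<And>m. m \<in> {1..M} \<Longrightarrow> L_smooth L (F m)" and R: "proper_closed_convex R" "\<gamma> > 0"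
  defines "st \<equiv> diana_pp M N F R \<gamma> lam \<rho> S C Q x0 h0"
  shows "(\<lambda>w. fst (st k w)) \<in> borel_measurable (past k) \<and>
    (\<forall>m\<in>{1..M}. (\<lambda>w. fst (snd (st k w)) m) \<in> borel_measurable (past k)) \<and>
    (\<lambda>w. snd (snd (st k w))) \<in> borel_measurable (past k)"
proof (induction k)
  case 0
  then show ?case by (simp add: st_def)
next
  case (Suc k)
  \<comment> \<open>The run evaluates state and fresh randomness at the same outcome; composing with
    the diagonal is legitimate as \<open>past (Suc k)\<close> contains both algebras.\<close>
  have diag: "(\<lambda>w. (w, w)) \<in> measurable (past (Suc k)) (past k \<Otimes>\<^sub>M fresh k)"
    by (intro measurable_Pair subalgebra_measurable_ident subalgebra_past_Suc subalgebra_past_Suc_fresh)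
  have IH: "(\<lambda>w. fst (st k w)) \<in> borel_measurable (past k)"
    "\<And>m. m \<in> {1..M} \<Longrightarrow> (\<lambda>w. fst (snd (st k w)) m) \<in> borel_measurable (past k)"
    "(\<lambda>w. snd (snd (st k w))) \<in> borel_measurable (past k)"
    using Suc by auto
  note step = diana_pp_step_measurable_fresh[where lam = lam and \<rho> = \<rho>, OF F R IH]
  have eq: "st (Suc k) w = diana_pp_step M N F R \<gamma> lam \<rho> (S k w) (\<lambda>m. C k m w) (Q k w) (st k w)" for w
    by (simp add: st_def)
  show ?case
    unfolding eq
    using measurable_compose[OF diag step(1)] measurable_compose[OF diag step(2)] measurable_compose[OF diag step(3)]
    by simp
qed

lemma diana_pp_server_average:
  assumes "w \<in> space P"
  shows "snd (snd (diana_pp M N F R \<gamma> lam \<rho> S C Q x0 h0 k w)) = average M (fst (snd (diana_pp M N F R \<gamma> lam \<rho> S C Q x0 h0 k w)))"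
proof (induction k)
  case (Suc k)
  obtain x h hs where st: "diana_pp M N F R \<gamma> lam \<rho> S C Q x0 h0 k w = (x, h, hs)" by (metis prod_cases3)
  with Suc have "hs = average M h" by simp
  then show ?case
    using N st by (simp add: diana_pp_step_server_average[OF diana_pp_round.S_subset[OF round assms]])
qed simp

text \<open>In the induction step the state is frozen at one outcome and the randomness of the round
  is integrated over an independent copy, so the bound for a deterministic state applies outcome by
  outcome.\<close>

lemma diana_pp_descent:
  fixes F :: "nat \<Rightarrow> 'e \<Rightarrow> real" and h0 hstar :: "nat \<Rightarrow> 'e" and x0 xs :: 'e and L \<mu> \<gamma> b a c \<rho> lam \<omega>av :: real
  assumes L: "L > 0" and \<mu>: "\<mu> > 0"
    and F: "\<And>m. m \<in> {1..M} \<Longrightarrow> convex_on UNIV (F m) \<and> L_smooth L (F m)"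
    and sc: "strongly_convex \<mu> (\<lambda>x. average M (\<lambda>m. F m x))"
    and R: "proper_closed_convex R"
    and min: "\<And>y. R xs + ereal (average M (\<lambda>m. F m xs)) \<le> R y + ereal (average M (\<lambda>m. F m y))"
    and hstar: "hstar = (\<lambda>m. grad (F m) xs)"
    and \<omega>av: "\<omega>av = \<omega>C / real M + participation_ratio M N * (1 + \<omega>C)"
    and lam: "lam = real N / real M * (1 / (1 + \<omega>C))" and \<rho>: "\<rho> = 1 / (1 + \<omega>R)" and b: "b > 1"
    and a: "a = max (1 - (1 + b) * participation_ratio M N) 0"
    and \<gamma>: "0 < \<gamma>" "\<gamma> * L * (a + (1 + b)\<^sup>2 * \<omega>av) \<le> 1"
    and K: "K = (b\<^sup>2 + b) * \<gamma>\<^sup>2 * \<omega>av * ((1 + \<omega>C) / (1 + \<omega>R)) * (1 / real N)"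
    and \<Psi>: "\<Psi> = (\<lambda>x h. (norm (x - xs))\<^sup>2 + K * (\<Sum>m\<in>{1..M}. (norm (h m - hstar m))\<^sup>2))"
    and c: "c = 1 - min (\<gamma> * \<mu> / (1 + \<omega>R)) (real N / real M * ((1 - 1 / b\<^sup>2) / (1 + \<omega>C)))"
    and c0: "0 \<le> c" and K0: "0 \<le> K"
  defines "st \<equiv> diana_pp M N F R \<gamma> lam \<rho> S C Q x0 h0"
  shows "integrable P (\<lambda>w. \<Psi> (fst (st k w)) (fst (snd (st k w)))) \<and>
    (\<integral>w. \<Psi> (fst (st k w)) (fst (snd (st k w))) \<partial>P) \<le> c ^ k * \<Psi> x0 h0"
proof -
  have smooth: "\<And>m. m \<in> {1..M} \<Longrightarrow> L_smooth L (F m)" using F by blast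
  have \<Psi>0: "0 \<le> \<Psi> x h" for x h
    unfolding \<Psi> using K0 by (auto intro!: add_nonneg_nonneg mult_nonneg_nonneg sum_nonneg)
  have meas: "(\<lambda>w. fst (st k w)) \<in> borel_measurable (past k)"
    "\<And>m. m \<in> {1..M} \<Longrightarrow> (\<lambda>w. fst (snd (st k w)) m) \<in> borel_measurable (past k)"
    "(\<lambda>w. snd (snd (st k w))) \<in> borel_measurable (past k)" for k
    using diana_pp_measurable[where lam = lam and \<rho> = \<rho> and ?x0.0 = x0 and ?h0.0 = h0 and k = k, OF smooth R \<gamma>(1)] unfolding st_def by auto
  have \<Psi>_meas: "(\<lambda>p. \<Psi> (f p) (g p)) \<in> borel_measurable D"
    if f: "f \<in> borel_measurable D" and g: "\<And>m. m \<in> {1..M} \<Longrightarrow> (\<lambda>p. g p m) \<in> borel_measurable D"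
    for f g and D :: "'d measure"
    unfolding \<Psi>
    by (intro borel_measurable_add borel_measurable_times borel_measurable_power
        measurable_compose[OF _ borel_measurable_norm]
        borel_measurable_diff borel_measurable_sum borel_measurable_const f g)
  have m: "(\<lambda>w. \<Psi> (fst (st k w)) (fst (snd (st k w)))) \<in> borel_measurable P" for k
    by (intro \<Psi>_meas measurable_from_subalg[OF subalgebra_past[of k]] meas)
  have bound: "(\<integral>\<^sup>+w. ennreal (\<Psi> (fst (st k w)) (fst (snd (st k w)))) \<partial>P) \<le> ennreal (c ^ k * \<Psi> x0 h0)" for k
  proof (induction k)
    case 0
    then show ?case by (simp add: st_def emeasure_space_1)
  next
    case (Suc k)
    interpret round: diana_pp_round P M N "S k" "C k" "Q k" "GC k" "GQ k" \<omega>C \<omega>R by (rule round)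
    define step where "step p = diana_pp_step M N F R \<gamma> lam \<rho> (S k (snd p)) (\<lambda>m. C k m (snd p)) (Q k (snd p)) (st k (fst p))" for p
    have f: "(\<lambda>p. ennreal (\<Psi> (fst (step p)) (fst (snd (step p))))) \<in> borel_measurable (past k \<Otimes>\<^sub>M fresh k)"
      unfolding step_def
      by (intro measurable_compose[OF _ measurable_ennreal] \<Psi>_meas diana_pp_step_measurable_fresh[OF smooth R \<gamma>(1) meas])
    have eq: "st (Suc k) w = step (w, w)" for w by (simp add: st_def step_def)
    have "(\<integral>\<^sup>+w. ennreal (\<Psi> (fst (st (Suc k) w)) (fst (snd (st (Suc k) w)))) \<partial>P)
        = (\<integral>\<^sup>+w. \<integral>\<^sup>+w'. ennreal (\<Psi> (fst (step (w, w'))) (fst (snd (step (w, w'))))) \<partial>P \<partial>P)"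
      unfolding eq by (rule nn_integral_indep_subalgebras[OF subalgebra_past subalgebra_fresh indep_past_fresh f])
    also have "\<dots> \<le> (\<integral>\<^sup>+w. ennreal c * ennreal (\<Psi> (fst (st k w)) (fst (snd (st k w)))) \<partial>P)"
    proof (rule nn_integral_mono)
      fix w assume w: "w \<in> space P"
      obtain x h hs where sw: "st k w = (x, h, hs)" by (metis prod_cases3)
      have "hs = average M h" using diana_pp_server_average[where k = k and F = F and R = R and \<gamma> = \<gamma> and lam = lam and \<rho> = \<rho> and ?x0.0 = x0 and ?h0.0 = h0, OF w] sw by (simp add: st_def)
      then have "(\<integral>\<^sup>+w'. ennreal (\<Psi> (fst (step (w, w'))) (fst (snd (step (w, w'))))) \<partial>P) \<le> ennreal (c * \<Psi> x h)"
        using round.diana_pp_step_descent[where x = x and h = h, OF L \<mu> F sc R min hstar \<omega>av lam \<rho> b a \<gamma> K \<Psi> c]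
        by (simp add: step_def sw)
      then show "(\<integral>\<^sup>+w'. ennreal (\<Psi> (fst (step (w, w'))) (fst (snd (step (w, w'))))) \<partial>P)
          \<le> ennreal c * ennreal (\<Psi> (fst (st k w)) (fst (snd (st k w))))"
        using c0 \<Psi>0 by (simp add: sw ennreal_mult)
    qed
    also have "\<dots> = ennreal c * (\<integral>\<^sup>+w. ennreal (\<Psi> (fst (st k w)) (fst (snd (st k w)))) \<partial>P)"
      by (intro nn_integral_cmult measurable_compose[OF m measurable_ennreal])
    also have "\<dots> \<le> ennreal c * ennreal (c ^ k * \<Psi> x0 h0)"
      by (intro mult_left_mono Suc) simp
    also have "\<dots> = ennreal (c ^ Suc k * \<Psi> x0 h0)"
      using c0 \<Psi>0 by (simp add: ennreal_mult mult.assoc)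
    finally show ?case .
  qed
  \<comment> \<open>A finite bound on the extended integral of a nonnegative function provides
    integrability, so that the real-valued integral below is not a default value.\<close>
  have int: "integrable P (\<lambda>w. \<Psi> (fst (st k w)) (fst (snd (st k w))))"
    using \<Psi>0 by (intro integrableI_nonneg m le_less_trans[OF bound]) auto
  have "ennreal (\<integral>w. \<Psi> (fst (st k w)) (fst (snd (st k w))) \<partial>P) \<le> ennreal (c ^ k * \<Psi> x0 h0)"
    using bound[of k] nn_integral_eq_integral[OF int] \<Psi>0 by simp
  moreover have "0 \<le> c ^ k * \<Psi> x0 h0" using c0 \<Psi>0 by simp
  ultimately show ?thesis using int by simp
qed

end

section \<open>From the contraction factor to the iteration count\<close>

lemma one_minus_power_le:
  fixes m \<epsilon> :: real
  assumes "m \<le> 1" "0 < \<epsilon>" "ln (1 / \<epsilon>) \<le> real k * m"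
  shows "(1 - m) ^ k \<le> \<epsilon>"
proof -
  \<comment> \<open>The comparison \<open>1 - m \<le> exp (- m)\<close> may be raised to a power
    because \<open>m \<le> 1\<close> keeps the base nonnegative.\<close>
  have "(1 - m) ^ k \<le> exp (- m) ^ k"
    using exp_ge_add_one_self[of "- m"] assms(1) by (intro power_mono) auto
  also have "\<dots> = exp (- (real k * m))" by (simp add: exp_of_nat_mult[symmetric])
  also have "\<dots> \<le> exp (- ln (1 / \<epsilon>))" using assms(3) by simp
  also have "\<dots> = \<epsilon>" using assms(2) by (simp add: exp_minus)
  finally show ?thesis .
qed

text \<open>The lower bound makes the denominator positive: with \<open>r\<close> the participation
  ratio, what \<open>a\<close> loses through \<open>(1 + b) * r\<close> is returned by
  \<open>(1 + b)\<^sup>2 * \<omega>av\<close>, as \<open>r \<le> \<omega>av\<close>. The upper bound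
  rests on \<open>r \<le> 1 / N\<close>; the factor 2 arises because each of the two summands of
  \<omega>av is at most \<open>1 + \<omega>C / N\<close>.\<close>

lemma stepsize_denominator_bounds:
  fixes \<omega>C b :: real
  assumes "1 \<le> N" "N \<le> M" "0 \<le> \<omega>C" "b > 1"
    and \<omega>av: "\<omega>av = \<omega>C / real M + participation_ratio M N * (1 + \<omega>C)"
    and a: "a = max (1 - (1 + b) * participation_ratio M N) 0"
  shows "1 \<le> a + (1 + b)\<^sup>2 * \<omega>av"
    and "a + (1 + b)\<^sup>2 * \<omega>av \<le> (1 + 2 * (1 + b)\<^sup>2) * (1 + \<omega>C / real N)"
proof -
  let ?r = "participation_ratio M N"
  have r0: "0 \<le> ?r" using assms by (simp add: participation_ratio_def)
  have r1: "?r \<le> 1 / N"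
  proof (cases "M = 1")
    case False
    then have "real M - 1 > 0" "real N > 0" using assms by auto
    then show ?thesis using assms by (simp add: participation_ratio_def field_simps)
  qed (simp add: participation_ratio_def)
  have M: "0 \<le> \<omega>C / M" using assms by simp
  have "?r \<le> \<omega>av" using r0 assms(3) M by (simp add: \<omega>av algebra_simps)
  then have "(1 + b)\<^sup>2 * ?r \<le> (1 + b)\<^sup>2 * \<omega>av" by (intro mult_left_mono) auto
  moreover have "(1 + b) * ?r \<le> (1 + b)\<^sup>2 * ?r"
    using assms(4) r0 by (intro mult_right_mono) (auto simp: power2_eq_square)
  moreover have "1 - (1 + b) * ?r \<le> a" by (simp add: a)
  ultimately show "1 \<le> a + (1 + b)\<^sup>2 * \<omega>av" by linarith
  have N: "1 / real N \<le> 1" "0 \<le> \<omega>C / N" using assms by auto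
  have "\<omega>C / M \<le> \<omega>C / N" using assms by (intro divide_left_mono) auto
  moreover have "?r * (1 + \<omega>C) \<le> 1 / N * (1 + \<omega>C)"
    using r1 assms(3) by (intro mult_right_mono) auto
  moreover have "1 / N * (1 + \<omega>C) = 1 / N + \<omega>C / N" by (simp add: add_divide_distrib)
  ultimately have "\<omega>av \<le> 2 * (1 + \<omega>C / N)" using N by (simp add: \<omega>av)
  then have "(1 + b)\<^sup>2 * \<omega>av \<le> (1 + b)\<^sup>2 * (2 * (1 + \<omega>C / N))" by (intro mult_left_mono) auto
  moreover have "a \<le> 1 + \<omega>C / N" using r0 assms(4) N by (simp add: a) (smt (verit) mult_nonneg_nonneg)
  ultimately show "a + (1 + b)\<^sup>2 * \<omega>av \<le> (1 + 2 * (1 + b)\<^sup>2) * (1 + \<omega>C / real N)"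
    by (simp add: algebra_simps)
qed

lemma one_minus_inverse_sq_bounds:
  fixes b :: real
  assumes "b > 1"
  shows "0 \<le> 1 - 1 / b\<^sup>2" "1 - 1 / b\<^sup>2 \<le> 1"
proof -
  have "1 < b\<^sup>2" using assms by (simp add: one_less_power)
  then show "0 \<le> 1 - 1 / b\<^sup>2" "1 - 1 / b\<^sup>2 \<le> 1" by (simp_all add: divide_le_eq_1)
qed

text \<open>The product of the two sums dominates each product of matching terms, as everything is
  nonnegative. The first summands are matched with the first entry of the minimum through the lower
  bound on \<gamma>; the product of the second ones is the reciprocal of the second entry.\<close>

lemma complexity_constant_le_exponent:
  fixes L \<mu> \<kappa> \<omega>C \<omega>R \<omega>av \<gamma> a b \<theta> :: real
  assumes N: "1 \<le> N" "N \<le> M" and pos: "L > 0" "\<mu> > 0" "0 \<le> \<omega>C" "0 \<le> \<omega>R" "b > 1" "0 < \<theta>"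
    and \<kappa>: "\<kappa> = L / \<mu>"
    and \<omega>av: "\<omega>av = \<omega>C / real M + participation_ratio M N * (1 + \<omega>C)"
    and a: "a = max (1 - (1 + b) * participation_ratio M N) 0"
    and \<gamma>: "\<theta> / L * (1 / (a + (1 + b)\<^sup>2 * \<omega>av)) \<le> \<gamma>"
  shows "1 \<le> complexity_constant b \<theta> *
      (\<kappa> * (1 + \<omega>C / real N) * (1 + \<omega>R) + real M / real N * (1 + \<omega>C)) *
      min (\<gamma> * \<mu> / (1 + \<omega>R)) (real N / real M * ((1 - 1 / b\<^sup>2) / (1 + \<omega>C)))"
proof -
  define W where "W = a + (1 + b)\<^sup>2 * \<omega>av"
  define D1 where "D1 = (1 + 2 * (1 + b)\<^sup>2) / \<theta>"
  define D2 where "D2 = b\<^sup>2 / (b\<^sup>2 - 1)"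
  define T1 where "T1 = \<kappa> * (1 + \<omega>C / N) * (1 + \<omega>R)"
  define T2 where "T2 = real M / real N * (1 + \<omega>C)"
  define m1 where "m1 = \<gamma> * \<mu> / (1 + \<omega>R)"
  define m2 where "m2 = real N / real M * ((1 - 1 / b\<^sup>2) / (1 + \<omega>C))"
  have W: "1 \<le> W" "W \<le> (1 + 2 * (1 + b)\<^sup>2) * (1 + \<omega>C / real N)"
    unfolding W_def by (rule stepsize_denominator_bounds[OF N pos(3,5) \<omega>av a])+
  have \<gamma>W: "\<theta> \<le> L * \<gamma> * W"
  proof -
    have "\<theta> / (L * W) \<le> \<gamma>" using \<gamma> by (simp add: W_def)
    then show ?thesis using W pos by (simp add: pos_divide_le_eq mult_ac)
  qed
  have "0 < \<theta> / L * (1 / W)" using W pos by simp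
  then have \<gamma>0: "\<gamma> > 0" using \<gamma> by (simp only: W_def)
  have b2: "b\<^sup>2 > 1" using pos by simp
  have D: "0 \<le> D1" "0 \<le> D2" using pos b2 by (auto simp: D1_def D2_def)
  have T: "0 \<le> T1" "0 \<le> T2" using pos N by (auto simp: T1_def T2_def \<kappa>)
  have m: "0 \<le> m1" "0 \<le> m2" using pos \<gamma>0 one_minus_inverse_sq_bounds[OF pos(5)] by (auto simp: m1_def m2_def)
  have DT: "D1 * T1 \<le> (D1 + D2) * (T1 + T2)" "D2 * T2 \<le> (D1 + D2) * (T1 + T2)"
    using D T by (auto intro!: mult_mono)
  have "1 \<le> D1 * T1 * m1"
  proof -
    have "D1 * T1 * m1 = (L * \<gamma> * ((1 + 2 * (1 + b)\<^sup>2) * (1 + \<omega>C / N))) / \<theta>"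
      using pos unfolding D1_def T1_def m1_def \<kappa> by simp
    moreover have "\<theta> \<le> L * \<gamma> * ((1 + 2 * (1 + b)\<^sup>2) * (1 + \<omega>C / N))"
      by (rule order_trans[OF \<gamma>W mult_left_mono[OF W(2)]]) (use pos \<gamma>0 in simp)
    ultimately show ?thesis using pos by (simp only: pos_le_divide_eq mult_1)
  qed
  also have "\<dots> \<le> (D1 + D2) * (T1 + T2) * m1" using DT m by (intro mult_right_mono)
  finally have 1: "1 \<le> (D1 + D2) * (T1 + T2) * m1" .
  have "D2 * T2 * m2 = (b\<^sup>2 / (b\<^sup>2 - 1)) * (1 - 1 / b\<^sup>2)"
    using N pos unfolding D2_def T2_def m2_def by simp
  also have "\<dots> = 1" using b2 pos(5) by (simp add: field_simps)
  finally have "1 \<le> D2 * T2 * m2" by simp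
  also have "\<dots> \<le> (D1 + D2) * (T1 + T2) * m2" using DT m by (intro mult_right_mono)
  finally have 2: "1 \<le> (D1 + D2) * (T1 + T2) * m2" .
  have "1 \<le> (D1 + D2) * (T1 + T2) * min m1 m2"
    using 1 2 by (auto simp: min_def)
  then show ?thesis
    by (simp only: complexity_constant_def D1_def D2_def T1_def T2_def m1_def m2_def)
qed

theorem theorem6:
  fixes P :: "'w measure"
    and M N :: nat
    and F :: "nat \<Rightarrow> 'e::euclidean_space \<Rightarrow> real"
    and R :: "'e \<Rightarrow> ereal"
    and S :: "nat \<Rightarrow> 'w \<Rightarrow> nat set"
    and C :: "nat \<Rightarrow> nat \<Rightarrow> 'w \<Rightarrow> 'e \<Rightarrow> 'e"
    and Q :: "nat \<Rightarrow> 'w \<Rightarrow> 'e \<Rightarrow> 'e"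
    and GC :: "nat \<Rightarrow> nat \<Rightarrow> 'w measure"
    and GQ :: "nat \<Rightarrow> 'w measure"
    and x0 xstar :: 'e
    and h0 hstar :: "nat \<Rightarrow> 'e"
    and X :: "nat \<Rightarrow> 'w \<Rightarrow> 'e"
    and H :: "nat \<Rightarrow> 'w \<Rightarrow> nat \<Rightarrow> 'e"
    and L \<mu> \<kappa> \<omega>C \<omega>R \<omega>av \<gamma> lam \<rho> a b c :: real
    and \<Psi> :: "'e \<Rightarrow> (nat \<Rightarrow> 'e) \<Rightarrow> real"
  assumes "prob_space P"
    and "1 \<le> N" and "N \<le> M"
    and "L > 0" and "\<mu> > 0" and "\<kappa> = L / \<mu>"
    and "\<And>m. m \<in> {1..M} \<Longrightarrow> convex_on UNIV (F m) \<and> L_smooth L (F m)"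
    and "strongly_convex \<mu> (\<lambda>x. average M (\<lambda>m. F m x))"
    and "proper_closed_convex R"
    and "xstar = minimizer M F R"
    and "hstar = (\<lambda>m. grad (F m) xstar)"
    and "\<omega>C \<ge> 0" and "\<omega>R \<ge> 0"
    and "\<And>k m. m \<in> {1..M} \<Longrightarrow>
           random_map P (GC k m) (C k m) \<and> unbiased_with_variance P \<omega>C (C k m)"
    and "\<And>k. random_map P (GQ k) (Q k) \<and> unbiased_with_variance P \<omega>R (Q k)"
    and "\<And>k. uniform_random_subset P M N (S k)"
    and "independent_randomness P M (\<lambda>k. generated_by P M N (S k)) GC GQ"
    and "\<And>k. prob_space.indep_sets P (\<lambda>m. sets (GC k m)) {1..M}"
    and "\<omega>av = \<omega>C / real M + participation_ratio M N * (1 + \<omega>C)"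
    and "lam = real N / real M * (1 / (1 + \<omega>C))"
    and "\<rho> = 1 / (1 + \<omega>R)"
    and "b > 1"
    and "a = max (1 - (1 + b) * participation_ratio M N) 0"
    and "0 < \<gamma>" and "\<gamma> \<le> 1 / L * (1 / (a + (1 + b)\<^sup>2 * \<omega>av))"
    and "X = (\<lambda>k w. fst (diana_pp M N F R \<gamma> lam \<rho> S C Q x0 h0 k w))"
    and "H = (\<lambda>k w. fst (snd (diana_pp M N F R \<gamma> lam \<rho> S C Q x0 h0 k w)))"
    and "\<Psi> = (\<lambda>x h. (norm (x - xstar))\<^sup>2 +
           (b\<^sup>2 + b) * \<gamma>\<^sup>2 * \<omega>av * ((1 + \<omega>C) / (1 + \<omega>R)) * (1 / real N) *
           (\<Sum>m\<in>{1..M}. (norm (h m - hstar m))\<^sup>2))"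
    and "c = 1 - min (\<gamma> * \<mu> / (1 + \<omega>R)) (real N / real M * ((1 - 1 / b\<^sup>2) / (1 + \<omega>C)))"
  shows "(\<forall>k. integrable P (\<lambda>w. \<Psi> (X k w) (H k w)) \<and>
              (\<integral>w. \<Psi> (X k w) (H k w) \<partial>P) \<le> c ^ k * \<Psi> x0 h0) \<and>
         (\<forall>\<theta>. 0 < \<theta> \<and> \<theta> \<le> 1 \<and> \<theta> / L * (1 / (a + (1 + b)\<^sup>2 * \<omega>av)) \<le> \<gamma> \<longrightarrow>
           (\<forall>\<epsilon> k. 0 < \<epsilon> \<and> \<epsilon> \<le> 1 / 2 \<and>
              real k \<ge> complexity_constant b \<theta> *
                (\<kappa> * (1 + \<omega>C / real N) * (1 + \<omega>R) + real M / real N * (1 + \<omega>C)) * ln (1 / \<epsilon>) \<longrightarrow>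
              (\<integral>w. \<Psi> (X k w) (H k w) \<partial>P) \<le> \<epsilon> * \<Psi> x0 h0))"
proof -
  interpret prob_space P by (rule assms(1))
  note N = assms(2,3) and L = assms(4) and \<mu> = assms(5) and \<kappa> = assms(6) and F = assms(7) and sc = assms(8)
    and R = assms(9) and xstar = assms(10) and hstar = assms(11) and \<omega> = assms(12,13) and C = assms(14)
    and Q = assms(15) and S = assms(16) and indep = assms(17) and indep_GC = assms(18) and \<omega>av = assms(19)
    and lam = assms(20) and \<rho> = assms(21) and b = assms(22) and a = assms(23) and \<gamma> = assms(24,25)
    and X = assms(26) and H = assms(27) and \<Psi> = assms(28) and c = assms(29)
  interpret diana_pp_randomness P M N S C Q GC GQ \<omega>C \<omega>R
    by unfold_locales (fact N \<omega> C Q S indep indep_GC)+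
  have G: "GDERIV (F m) z :> grad (F m) z" if "m \<in> {1..M}" for m z
    using F[OF that] by (auto simp: L_smooth_def intro: GDERIV_grad)
  have min: "R xstar + ereal (average M (\<lambda>m. F m xstar)) \<le> R y + ereal (average M (\<lambda>m. F m y))" for y
    unfolding xstar minimizer_def
    by (rule arg_min_UNIV_le,
        rule proper_closed_convex_minimizer_exists[OF R sc \<mu> GDERIV_average[where g = "\<lambda>m. grad (F m) _", OF G]])
  note W = stepsize_denominator_bounds(1)[OF N \<omega>(1) b \<omega>av a]
  have \<gamma>': "\<gamma> * L * (a + (1 + b)\<^sup>2 * \<omega>av) \<le> 1"
  proof -
    have "\<gamma> \<le> 1 / (L * (a + (1 + b)\<^sup>2 * \<omega>av))" using \<gamma>(2) by simp
    then show ?thesis using L W by (simp add: pos_le_divide_eq mult_ac)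
  qed
  define K where "K = (b\<^sup>2 + b) * \<gamma>\<^sup>2 * \<omega>av * ((1 + \<omega>C) / (1 + \<omega>R)) * (1 / real N)"
  have "0 \<le> participation_ratio M N" using N by (simp add: participation_ratio_def)
  then have "0 \<le> \<omega>av" using \<omega> by (simp add: \<omega>av)
  then have K0: "0 \<le> K" using b \<omega> by (simp add: K_def)
  \<comment> \<open>It suffices that one entry of the minimum is at most 1 for \<open>c\<close> to
    be nonnegative.\<close>
  have m2: "real N / real M * ((1 - 1 / b\<^sup>2) / (1 + \<omega>C)) \<le> 1"
  proof -
    have "0 \<le> 1 - 1 / b\<^sup>2" "1 - 1 / b\<^sup>2 \<le> 1 + \<omega>C"
      using \<omega> one_minus_inverse_sq_bounds[OF b] by linarith+
    then have "(1 - 1 / b\<^sup>2) / (1 + \<omega>C) \<le> 1" "0 \<le> (1 - 1 / b\<^sup>2) / (1 + \<omega>C)"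
      using \<omega> by (auto simp: divide_le_eq_1)
    moreover have "real N / real M \<le> 1" using N by simp
    ultimately show ?thesis by (intro mult_le_one) auto
  qed
  then have c0: "0 \<le> c" by (simp add: c)
  have descent: "integrable P (\<lambda>w. \<Psi> (X k w) (H k w)) \<and> (\<integral>w. \<Psi> (X k w) (H k w) \<partial>P) \<le> c ^ k * \<Psi> x0 h0" for k
    unfolding X H
    by (rule diana_pp_descent[OF L \<mu> F sc R min hstar \<omega>av lam \<rho> b a \<gamma>(1) \<gamma>' K_def \<Psi>[folded K_def] c c0 K0])
  have \<Psi>0: "0 \<le> \<Psi> x0 h0"
    unfolding \<Psi> K_def[symmetric] using K0 by (auto intro!: add_nonneg_nonneg mult_nonneg_nonneg sum_nonneg)
  have complexity: "(\<integral>w. \<Psi> (X k w) (H k w) \<partial>P) \<le> \<epsilon> * \<Psi> x0 h0"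
    if \<theta>: "0 < \<theta>" "\<theta> / L * (1 / (a + (1 + b)\<^sup>2 * \<omega>av)) \<le> \<gamma>" and \<epsilon>: "0 < \<epsilon>" "\<epsilon> \<le> 1 / 2"
      and k: "real k \<ge> complexity_constant b \<theta> *
        (\<kappa> * (1 + \<omega>C / real N) * (1 + \<omega>R) + real M / real N * (1 + \<omega>C)) * ln (1 / \<epsilon>)" for \<theta> \<epsilon> k
  proof -
    let ?m = "min (\<gamma> * \<mu> / (1 + \<omega>R)) (real N / real M * ((1 - 1 / b\<^sup>2) / (1 + \<omega>C)))"
    let ?T = "complexity_constant b \<theta> * (\<kappa> * (1 + \<omega>C / real N) * (1 + \<omega>R) + real M / real N * (1 + \<omega>C))"
    have m0: "0 \<le> ?m" using \<gamma>(1) \<mu> \<omega> one_minus_inverse_sq_bounds[OF b] by simp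
    have ln0: "0 \<le> ln (1 / \<epsilon>)" using \<epsilon> by simp
    have "ln (1 / \<epsilon>) * 1 \<le> ln (1 / \<epsilon>) * (?T * ?m)"
      using complexity_constant_le_exponent[OF N L \<mu> \<omega> b \<theta>(1) \<kappa> \<omega>av a \<theta>(2)] ln0
      by (intro mult_left_mono)
    also have "\<dots> = (?T * ln (1 / \<epsilon>)) * ?m" by (simp only: mult_ac)
    also have "\<dots> \<le> real k * ?m" using k m0 by (intro mult_right_mono)
    finally have "c ^ k \<le> \<epsilon>"
      unfolding c using m2 \<epsilon>(1) by (intro one_minus_power_le) (auto simp: min_le_iff_disj)
    then have "c ^ k * \<Psi> x0 h0 \<le> \<epsilon> * \<Psi> x0 h0" using \<Psi>0 by (intro mult_right_mono)
    then show ?thesis using descent[of k] by linarith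
  qed
  show ?thesis using descent complexity by blast
qed

end
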